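(* Let $\Phi\equiv\Phi(\cdot;a=0)$ be the half-soliton state, with components $\alpha_j^{-1}\operatorname{sech}(x)$ on edge $j$. There exists $\epsilon>0$ such that for every sufficiently small $\delta>0$ there exists $V\in H^1_\Gamma$ with $\|V\|_{H^1(\Gamma)}\le\delta$ such that the unique solution $\Psi\in C(\mathbb{R},H^1_\Gamma)\cap C^1(\mathbb{R},H^{-1}_\Gamma)$ of the NLS equation $i\partial_t\Psi=-\Delta\Psi-2\alpha^2|\Psi|^2\Psi$ on the balanced star graph $\Gamma$ with $\Psi(0,\cdot)=\Phi+V$ satisfies $$\inf_{\theta\in\mathbb{R}}\|e^{-i\theta}\Psi(T,\cdot)-\Phi\|_{H^1(\Gamma)}>\epsilon\quad\text{for some }T>0.$$ Consequently, the orbit $\{\Phi e^{i\theta}\}_{\theta\in\mathbb{R}}$ is unstable under the time flow of this NLS equation.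
   Context: Balanced star graph: fix $N\ge 3$ and positive reals $\alpha=(\alpha_1,\dots,\alpha_N)$ with $\frac{1}{\alpha_1^2}=\sum_{j=2}^N\frac{1}{\alpha_j^2}$. The star graph $\Gamma$ has one incoming edge parametrized by $\mathbb{R}^-=(-\infty,0]$ (edge 1) and $N-1$ outgoing edges parametrized by $\mathbb{R}^+=[0,\infty)$ (edges $2,\dots,N$), joined at the vertex $x=0$. Functions on $\Gamma$ are (complex-valued) $N$-tuples $\Psi=(\psi_1,\dots,\psi_N)$; $L^2(\Gamma)=L^2(\mathbb{R}^-)\oplus L^2(\mathbb{R}^+)\oplus\cdots\oplus L^2(\mathbb{R}^+)$ and $H^k(\Gamma)$ are defined componentwise. Define $$H^1_\Gamma=\{\Psi\in H^1(\Gamma):\ \alpha_1\psi_1(0)=\alpha_2\psi_2(0)=\dots=\alpha_N\psi_N(0)\},$$ $$H^2_\Gamma=\Big\{\Psi\in H^2(\Gamma)\cap H^1_\Gamma:\ \alpha_1^{-1}\psi_1'(0)=\sum_{j=2}^N\alpha_j^{-1}\psi_j'(0)\Big\},$$ with one-sided derivatives at $0$; $H^{-1}_\Gamma$ is the dual of $H^1_\Gamma$. $\Delta\Psi=(\psi_1'',\dots,\psi_N'')$ with domain $H^2_\Gamma$ is self-adjoint in $L^2(\Gamma)$, and is extended to $H^1_\Gamma\to H^{-1}_\Gamma$ for weak solutions. The term $\alpha^2|\Psi|^2\Psi$ means $(\alpha_1^2|\psi_1|^2\psi_1,\dots,\alpha_N^2|\psi_N|^2\psi_N)$. The Cauchy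 problem in $H^1_\Gamma$ is globally well posed. *)

theory Defs
  imports "HOL-Analysis.Analysis"
begin

section \<open>Sobolev spaces on an interval\<close>

definition L2_on :: "real set \<Rightarrow> (real \<Rightarrow> complex) set" where
  "L2_on I = {f. set_borel_measurable lebesgue I f \<and>
                 set_integrable lebesgue I (\<lambda>x. (cmod (f x))\<^sup>2)}"

definition test_functions :: "real set \<Rightarrow> (real \<Rightarrow> real) set" where
  "test_functions I = {\<phi>. \<phi> C1_differentiable_on UNIV \<and>
     (\<exists>K. compact K \<and> K \<subseteq> interior I \<and> (\<forall>x. x \<notin> K \<longrightarrow> \<phi> x = 0))}"

text \<open>Weak derivatives are tested against compactly supported \<open>C\<^sup>1\<close> functions, which for
  square integrable functions is the same as testing against smooth ones.\<close>

definition is_weak_deriv :: "real set \<Rightarrow> (real \<Rightarrow> complex) \<Rightarrow> (real \<Rightarrow> complex) \<Rightarrow> bool" where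
  "is_weak_deriv I f g \<longleftrightarrow> f \<in> L2_on I \<and> g \<in> L2_on I \<and>
     (\<forall>\<phi>\<in>test_functions I.
        (LINT x:I|lebesgue. f x * complex_of_real (deriv \<phi> x)) =
        - (LINT x:I|lebesgue. g x * complex_of_real (\<phi> x)))"

text \<open>The weak derivative is determined almost everywhere only; the chosen representative is
  used under integrals exclusively.\<close>

definition weak_deriv :: "real set \<Rightarrow> (real \<Rightarrow> complex) \<Rightarrow> real \<Rightarrow> complex" where
  "weak_deriv I f = (SOME g. is_weak_deriv I f g)"

text \<open>An element of \<open>H\<^sup>1(I)\<close> is given by its continuous representative on the closed interval
  \<open>I\<close>, so that boundary values make sense.\<close>

definition H1_on :: "real set \<Rightarrow> (real \<Rightarrow> complex) set" where
  "H1_on I = {f. continuous_on I f \<and> (\<exists>g. is_weak_deriv I f g)}"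

definition H2_on :: "real set \<Rightarrow> (real \<Rightarrow> complex) set" where
  "H2_on I = {f \<in> H1_on I. \<exists>g\<in>H1_on I. is_weak_deriv I f g}"


section \<open>Function spaces on the star graph\<close>

type_synonym star_fun = "nat \<Rightarrow> real \<Rightarrow> complex"

definition edge :: "nat \<Rightarrow> real set" where
  "edge j = (if j = 1 then {..0} else {0..})"

text \<open>A function on the graph is a tuple \<open>\<Psi> 1, \<dots>, \<Psi> N\<close> with \<open>\<Psi> j\<close> defined on \<open>edge j\<close>.
  All other values are fixed to be \<open>0\<close>, so that equality of functions on the graph is equality
  in HOL.\<close>

definition star_functions :: "nat \<Rightarrow> star_fun set" where
  "star_functions N = {\<Psi>. \<forall>j x. j \<notin> {1..N} \<or> x \<notin> edge j \<longrightarrow> \<Psi> j x = 0}"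

definition balanced_star :: "nat \<Rightarrow> (nat \<Rightarrow> real) \<Rightarrow> bool" where
  "balanced_star N \<alpha> \<longleftrightarrow> N \<ge> 3 \<and> (\<forall>j\<in>{1..N}. \<alpha> j > 0) \<and>
     1 / (\<alpha> 1)\<^sup>2 = (\<Sum>j=2..N. 1 / (\<alpha> j)\<^sup>2)"

definition L2_inner :: "nat \<Rightarrow> star_fun \<Rightarrow> star_fun \<Rightarrow> complex" where
  "L2_inner N \<Psi> W = (\<Sum>j=1..N. LINT x:edge j|lebesgue. \<Psi> j x * cnj (W j x))"

definition H1_norm :: "nat \<Rightarrow> star_fun \<Rightarrow> real" where
  "H1_norm N \<Psi> = sqrt (\<Sum>j=1..N.
      (LINT x:edge j|lebesgue. (cmod (\<Psi> j x))\<^sup>2) +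
      (LINT x:edge j|lebesgue. (cmod (weak_deriv (edge j) (\<Psi> j) x))\<^sup>2))"

definition H1_Gamma :: "nat \<Rightarrow> (nat \<Rightarrow> real) \<Rightarrow> star_fun set" where
  "H1_Gamma N \<alpha> = {\<Psi> \<in> star_functions N.
      (\<forall>j\<in>{1..N}. \<Psi> j \<in> H1_on (edge j)) \<and>
      (\<forall>j\<in>{1..N}. complex_of_real (\<alpha> j) * \<Psi> j 0 = complex_of_real (\<alpha> 1) * \<Psi> 1 0)}"

definition deriv_at_vertex :: "star_fun \<Rightarrow> nat \<Rightarrow> complex" where
  "deriv_at_vertex \<Psi> j = vector_derivative (\<Psi> j) (at 0 within edge j)"

definition H2_Gamma :: "nat \<Rightarrow> (nat \<Rightarrow> real) \<Rightarrow> star_fun set" where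
  "H2_Gamma N \<alpha> = {\<Psi> \<in> H1_Gamma N \<alpha>.
      (\<forall>j\<in>{1..N}. \<Psi> j \<in> H2_on (edge j)) \<and>
      deriv_at_vertex \<Psi> 1 / complex_of_real (\<alpha> 1) =
        (\<Sum>j=2..N. deriv_at_vertex \<Psi> j / complex_of_real (\<alpha> j))}"

definition laplacian :: "star_fun \<Rightarrow> star_fun" where
  "laplacian \<Psi> = (\<lambda>j. weak_deriv (edge j) (weak_deriv (edge j) (\<Psi> j)))"


section \<open>The dual space and the extended Laplacian\<close>

text \<open>The dual of \<open>H\<^sup>1\<^sub>\<Gamma>\<close> is realised by the bounded antilinear functionals, so that the
  embedding of \<open>L\<^sup>2(\<Gamma>)\<close> into it, \<open>\<Psi> \<mapsto> L2_inner N \<Psi>\<close>, is complex linear. Only the values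
  of a functional on \<open>H1_Gamma N \<alpha>\<close> matter.\<close>

definition Hm1_Gamma :: "nat \<Rightarrow> (nat \<Rightarrow> real) \<Rightarrow> (star_fun \<Rightarrow> complex) set" where
  "Hm1_Gamma N \<alpha> = {F.
      (\<forall>U\<in>H1_Gamma N \<alpha>. \<forall>W\<in>H1_Gamma N \<alpha>. \<forall>a b.
         F (\<lambda>j x. a * U j x + b * W j x) = cnj a * F U + cnj b * F W) \<and>
      (\<exists>C. \<forall>W\<in>H1_Gamma N \<alpha>. cmod (F W) \<le> C * H1_norm N W)}"

definition Hm1_norm :: "nat \<Rightarrow> (nat \<Rightarrow> real) \<Rightarrow> (star_fun \<Rightarrow> complex) \<Rightarrow> real" where
  "Hm1_norm N \<alpha> F = (SUP W\<in>{W \<in> H1_Gamma N \<alpha>. H1_norm N W \<le> 1}. cmod (F W))"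

text \<open>The operator \<open>\<Delta>\<close> with domain \<open>H\<^sup>2\<^sub>\<Gamma>\<close>, extended by continuity to \<open>H\<^sup>1\<^sub>\<Gamma> \<rightarrow> H\<^sup>-\<^sup>1\<^sub>\<Gamma>\<close>:
  \<open>F\<close> is the image of \<open>\<Psi>\<close> if \<open>\<Psi>\<close> is an \<open>H\<^sup>1\<close>-limit of elements of the domain whose images
  converge to \<open>F\<close> in the dual norm. As the domain is dense in \<open>H\<^sup>1\<^sub>\<Gamma>\<close> and \<open>\<Delta>\<close> is bounded from
  the \<open>H\<^sup>1\<close> norm to the dual norm, this is the graph of an everywhere defined bounded operator,
  namely \<open>F W = - L2_inner N \<Psi>' W'\<close>.\<close>

definition ext_laplacian ::
    "nat \<Rightarrow> (nat \<Rightarrow> real) \<Rightarrow> star_fun \<Rightarrow> (star_fun \<Rightarrow> complex) \<Rightarrow> bool" where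
  "ext_laplacian N \<alpha> \<Psi> F \<longleftrightarrow> \<Psi> \<in> H1_Gamma N \<alpha> \<and> F \<in> Hm1_Gamma N \<alpha> \<and>
     (\<exists>U :: nat \<Rightarrow> star_fun. (\<forall>n. U n \<in> H2_Gamma N \<alpha>) \<and>
        (\<lambda>n. H1_norm N (\<lambda>j x. U n j x - \<Psi> j x)) \<longlonglongrightarrow> 0 \<and>
        (\<lambda>n. Hm1_norm N \<alpha> (\<lambda>W. L2_inner N (laplacian (U n)) W - F W)) \<longlonglongrightarrow> 0)"


section \<open>The nonlinear Schroedinger flow\<close>

definition continuous_H1 :: "nat \<Rightarrow> (nat \<Rightarrow> real) \<Rightarrow> (real \<Rightarrow> star_fun) \<Rightarrow> bool" where
  "continuous_H1 N \<alpha> \<Psi> \<longleftrightarrow> (\<forall>t. \<Psi> t \<in> H1_Gamma N \<alpha>) \<and>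
     (\<forall>t. ((\<lambda>s. H1_norm N (\<lambda>j x. \<Psi> s j x - \<Psi> t j x)) \<longlongrightarrow> 0) (at t))"

text \<open>\<open>has_C1_deriv_Hm1 N \<alpha> \<Psi> D\<close>: as a map from the real line into the dual space, \<open>\<Psi>\<close> is
  continuously differentiable with derivative \<open>D\<close>.\<close>

definition has_C1_deriv_Hm1 ::
    "nat \<Rightarrow> (nat \<Rightarrow> real) \<Rightarrow> (real \<Rightarrow> star_fun) \<Rightarrow> (real \<Rightarrow> star_fun \<Rightarrow> complex) \<Rightarrow> bool" where
  "has_C1_deriv_Hm1 N \<alpha> \<Psi> D \<longleftrightarrow> (\<forall>t. D t \<in> Hm1_Gamma N \<alpha>) \<and>
     (\<forall>t. ((\<lambda>s. Hm1_norm N \<alpha> (\<lambda>W.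
        (L2_inner N (\<Psi> s) W - L2_inner N (\<Psi> t) W) / complex_of_real (s - t) - D t W))
           \<longlongrightarrow> 0) (at t)) \<and>
     (\<forall>t. ((\<lambda>s. Hm1_norm N \<alpha> (\<lambda>W. D s W - D t W)) \<longlongrightarrow> 0) (at t))"

definition cubic :: "(nat \<Rightarrow> real) \<Rightarrow> star_fun \<Rightarrow> star_fun" where
  "cubic \<alpha> \<Psi> = (\<lambda>j x. complex_of_real ((\<alpha> j)\<^sup>2 * (cmod (\<Psi> j x))\<^sup>2) * \<Psi> j x)"

definition nls_solution ::
    "nat \<Rightarrow> (nat \<Rightarrow> real) \<Rightarrow> star_fun \<Rightarrow> (real \<Rightarrow> star_fun) \<Rightarrow> bool" where
  "nls_solution N \<alpha> \<Psi>0 \<Psi> \<longleftrightarrow> continuous_H1 N \<alpha> \<Psi> \<and> \<Psi> 0 = \<Psi>0 \<and>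
     (\<exists>D L. has_C1_deriv_Hm1 N \<alpha> \<Psi> D \<and> (\<forall>t. ext_laplacian N \<alpha> (\<Psi> t) (L t)) \<and>
        (\<forall>t. \<forall>W\<in>H1_Gamma N \<alpha>.
           \<i> * D t W = - L t W - 2 * L2_inner N (cubic \<alpha> (\<Psi> t)) W))"

definition half_soliton :: "nat \<Rightarrow> (nat \<Rightarrow> real) \<Rightarrow> star_fun" where
  "half_soliton N \<alpha> = (\<lambda>j x. if j \<in> {1..N} \<and> x \<in> edge j
      then complex_of_real (1 / (\<alpha> j * cosh x)) else 0)"

definition orbit_dist :: "nat \<Rightarrow> star_fun \<Rightarrow> star_fun \<Rightarrow> real" where
  "orbit_dist N \<Phi> \<Psi> =
     (INF \<theta>::real. H1_norm N (\<lambda>j x. exp (- \<i> * complex_of_real \<theta>) * \<Psi> j x - \<Phi> j x))"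

definition orbitally_stable :: "nat \<Rightarrow> (nat \<Rightarrow> real) \<Rightarrow> star_fun \<Rightarrow> bool" where
  "orbitally_stable N \<alpha> \<Phi> \<longleftrightarrow>
     (\<forall>\<epsilon>>0. \<exists>\<delta>>0. \<forall>\<Psi>0\<in>H1_Gamma N \<alpha>. H1_norm N (\<lambda>j x. \<Psi>0 j x - \<Phi> j x) \<le> \<delta> \<longrightarrow>
        (\<forall>\<Psi>. nls_solution N \<alpha> \<Psi>0 \<Psi> \<longrightarrow> (\<forall>t>0. orbit_dist N \<Phi> (\<Psi> t) \<le> \<epsilon>)))"

end

(* With u = alpha_j psi_j on every edge, the balance condition turns the vertex conditions into C^1
   matching of u at 0, so every solution u of the focusing cubic NLS equation on the line yields a
   solution on the graph. In particular the Galilean-boosted solitons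
     u(t,x) = exp(i(v x + (1 - v^2) t)) sech(x - 2 v t)
   give explicit solutions. Their initial data converge to the half-soliton as v tends to 0, yet at
   time 1 / (2 v) the profile has been shifted by 1, which keeps it away from the orbit by a distance
   independent of v. Uniqueness comes from an L^2 energy estimate for the difference of two solutions:
   the pairing of the Laplacian with its argument is real, and the cubic term is Lipschitz by the
   one-dimensional Sobolev inequality. *)
theory Submission
  imports Defs
begin

section \<open>Square integrable functions\<close>

text \<open>The obstacle is that \<open>weak_deriv\<close> picks an arbitrary representative and
  that test functions see only the interior of an edge, whereas everything decisive happens at the
  vertex. A fundamental theorem of calculus for weak derivatives therefore carries the proof: it
  yields a.e. uniqueness of the derivative, the sup bound, one-sided derivatives at 0 and the
  boundary terms of integration by parts. Those terms cancel by the vertex conditions; the closure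
  that defines \<open>ext_laplacian\<close> then calls for a limit. The time derivative lives only
  in the dual space, so the energy identity pairs the increment of a solution with the sum of its
  two values, which is in H^1. Existence costs little because the soliton and its first derivatives
  belong to one family of profiles, controlled by a single exponential envelope. The infimum over
  \<theta> is harmless since only moduli are compared: on [-1,0] sech(x) exceeds sech(x - 1) by a
  fixed margin, from which \<epsilon> is obtained.\<close>

lemma cmod_add_sq: "(cmod (a + b))\<^sup>2 \<le> 2 * (cmod a)\<^sup>2 + 2 * (cmod b)\<^sup>2"
  using power_mono[OF norm_triangle_ineq[of a b], of 2] sum_squares_bound[of "cmod a" "cmod b"]
  by (simp add: power2_sum)

lemma set_borel_measurable_mult:
  fixes f g :: "'a \<Rightarrow> complex"
  assumes "set_borel_measurable M I f" "set_borel_measurable M I g"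
  shows "set_borel_measurable M I (\<lambda>x. f x * g x)"
proof -
  have "(\<lambda>x. (indicator I x *\<^sub>R f x) * (indicator I x *\<^sub>R g x)) \<in> borel_measurable M"
    using assms unfolding set_borel_measurable_def by (rule borel_measurable_times)
  also have "(\<lambda>x. (indicator I x *\<^sub>R f x) * (indicator I x *\<^sub>R g x)) = (\<lambda>x. indicator I x *\<^sub>R (f x * g x))"
    by (auto simp: indicator_def)
  finally show ?thesis by (simp add: set_borel_measurable_def)
qed

lemma set_borel_measurable_add:
  fixes f g :: "'a \<Rightarrow> complex"
  assumes "set_borel_measurable M I f" "set_borel_measurable M I g"
  shows "set_borel_measurable M I (\<lambda>x. f x + g x)"
  using borel_measurable_add[OF assms[unfolded set_borel_measurable_def]]
  by (simp add: set_borel_measurable_def scaleR_add_right)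

lemma set_borel_measurable_cnj:
  assumes "set_borel_measurable M I f"
  shows "set_borel_measurable M I (\<lambda>x. cnj (f x))"
proof -
  have "cnj \<in> borel_measurable borel" by (intro borel_measurable_continuous_onI continuous_intros)
  from measurable_compose[OF assms[unfolded set_borel_measurable_def] this]
  show ?thesis by (simp add: set_borel_measurable_def)
qed

lemma set_borel_measurable_continuous:
  fixes f :: "real \<Rightarrow> 'b::real_normed_vector"
  assumes "continuous_on I f" "I \<in> sets borel"
  shows "set_borel_measurable lebesgue I f"
  using borel_measurable_continuous_on_indicator[OF assms(2,1)]
  by (simp add: set_borel_measurable_def measurable_completion)

lemma L2_onD:
  assumes "f \<in> L2_on I"
  shows "set_borel_measurable lebesgue I f" "set_integrable lebesgue I (\<lambda>x. (cmod (f x))\<^sup>2)"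
  using assms by (auto simp: L2_on_def)

lemma L2_on_mult:
  assumes "f \<in> L2_on I" "g \<in> L2_on I"
  shows "set_integrable lebesgue I (\<lambda>x. f x * g x)"
proof (rule set_integrable_bound)
  show "set_integrable lebesgue I (\<lambda>x. (cmod (f x))\<^sup>2 + (cmod (g x))\<^sup>2)"
    using assms by (auto simp: L2_on_def)
  show "set_borel_measurable lebesgue I (\<lambda>x. f x * g x)"
    using assms by (auto simp: L2_on_def intro: set_borel_measurable_mult)
  have "cmod (a * b) \<le> norm ((cmod a)\<^sup>2 + (cmod b)\<^sup>2)" for a b
    using sum_squares_bound[of "cmod a" "cmod b"] mult_nonneg_nonneg[OF norm_ge_zero norm_ge_zero, of a b]
    unfolding norm_mult real_norm_def abs_of_nonneg[OF add_nonneg_nonneg[OF zero_le_power2 zero_le_power2]] by linarith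
  then show "AE x in lebesgue. x \<in> I \<longrightarrow> norm (f x * g x) \<le> norm ((cmod (f x))\<^sup>2 + (cmod (g x))\<^sup>2)"
    by simp
qed

lemma L2_on_cnj:
  assumes "f \<in> L2_on I" shows "(\<lambda>x. cnj (f x)) \<in> L2_on I"
  using assms set_borel_measurable_cnj by (auto simp: L2_on_def)

lemma set_borel_measurable_cmod_sq:
  assumes "set_borel_measurable M I f"
  shows "set_borel_measurable M I (\<lambda>x. (cmod (f x))\<^sup>2)"
proof -
  have "(\<lambda>x. (cmod (indicator I x *\<^sub>R f x))\<^sup>2) \<in> borel_measurable M"
    using assms unfolding set_borel_measurable_def by measurable
  also have "(\<lambda>x. (cmod (indicator I x *\<^sub>R f x))\<^sup>2) = (\<lambda>x. indicator I x *\<^sub>R (cmod (f x))\<^sup>2)"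
    by (auto simp: indicator_def)
  finally show ?thesis by (simp add: set_borel_measurable_def)
qed

lemma L2_on_boundI:
  assumes "g \<in> L2_on I" "set_borel_measurable lebesgue I f" "\<And>x. x \<in> I \<Longrightarrow> cmod (f x) \<le> C * cmod (g x)"
  shows "f \<in> L2_on I"
proof -
  have "set_integrable lebesgue I (\<lambda>x. (cmod (f x))\<^sup>2)"
  proof (rule set_integrable_bound)
    show "set_integrable lebesgue I (\<lambda>x. C\<^sup>2 * (cmod (g x))\<^sup>2)"
      using L2_onD[OF assms(1)] by simp
    show "set_borel_measurable lebesgue I (\<lambda>x. (cmod (f x))\<^sup>2)" by (rule set_borel_measurable_cmod_sq[OF assms(2)])
    have "norm ((cmod (f x))\<^sup>2) \<le> norm (C\<^sup>2 * (cmod (g x))\<^sup>2)" if "x \<in> I" for x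
      using power_mono[OF assms(3)[OF that], of 2] by (simp add: power_mult_distrib)
    then show "AE x in lebesgue. x \<in> I \<longrightarrow> norm ((cmod (f x))\<^sup>2) \<le> norm (C\<^sup>2 * (cmod (g x))\<^sup>2)"
      by simp
  qed
  with assms(2) show ?thesis by (simp add: L2_on_def)
qed

lemma L2_on_scale:
  assumes "f \<in> L2_on I" shows "(\<lambda>x. c * f x) \<in> L2_on I"
  using assms by (auto simp: L2_on_def norm_mult power_mult_distrib set_borel_measurable_def
      mult_scaleR_right[symmetric] simp del: mult_scaleR_right)

lemma L2_on_add:
  assumes "f \<in> L2_on I" "g \<in> L2_on I" shows "(\<lambda>x. f x + g x) \<in> L2_on I"
proof -
  have m: "set_borel_measurable lebesgue I (\<lambda>x. f x + g x)"
    using assms by (auto simp: L2_on_def intro: set_borel_measurable_add)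
  have "set_integrable lebesgue I (\<lambda>x. (cmod (f x + g x))\<^sup>2)"
  proof (rule set_integrable_bound)
    show "set_integrable lebesgue I (\<lambda>x. 2 * (cmod (f x))\<^sup>2 + 2 * (cmod (g x))\<^sup>2)"
      using assms by (auto simp: L2_on_def)
    show "set_borel_measurable lebesgue I (\<lambda>x. (cmod (f x + g x))\<^sup>2)" by (rule set_borel_measurable_cmod_sq[OF m])
    show "AE x in lebesgue. x \<in> I \<longrightarrow> norm ((cmod (f x + g x))\<^sup>2) \<le> norm (2 * (cmod (f x))\<^sup>2 + 2 * (cmod (g x))\<^sup>2)"
      by (simp add: cmod_add_sq)
  qed
  with m show ?thesis by (simp add: L2_on_def)
qed

lemma L2_on_diff:
  assumes "f \<in> L2_on I" "g \<in> L2_on I" shows "(\<lambda>x. f x - g x) \<in> L2_on I"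
  using L2_on_add[OF assms(1) L2_on_scale[OF assms(2), of "-1"]] by simp

lemma L2_on_cong:
  assumes "\<And>x. x \<in> I \<Longrightarrow> f x = g x" shows "f \<in> L2_on I \<longleftrightarrow> g \<in> L2_on I"
proof -
  have "(\<lambda>x. indicator I x *\<^sub>R f x) = (\<lambda>x. indicator I x *\<^sub>R g x)"
    "(\<lambda>x. indicator I x *\<^sub>R (cmod (f x))\<^sup>2) = (\<lambda>x. indicator I x *\<^sub>R (cmod (g x))\<^sup>2)"
    using assms by (auto simp: indicator_def fun_eq_iff)
  then show ?thesis by (simp add: L2_on_def set_borel_measurable_def set_integrable_def)
qed

text \<open>Intervals generate the Borel sets; the vanishing total integral handles complements and
  countable additivity handles disjoint unions, so the integral over every Borel set vanishes.
  Completion adds only null sets, and an integrable function all of whose set integrals vanish is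
  zero a.e.\<close>

lemma AE_zero_of_interval_integrals:
  fixes h :: "real \<Rightarrow> complex"
  assumes h: "integrable lebesgue h" and zero: "integral\<^sup>L lebesgue h = 0"
    and iv: "\<And>x y. x \<le> y \<Longrightarrow> (LINT t:{x..y}|lebesgue. h t) = 0"
  shows "AE t in lebesgue. h t = 0"
proof (rule sigma_finite_measure.density_zero[OF _ h])
  show "sigma_finite_measure (lebesgue :: real measure)"
  proof
    obtain A :: "real set set" where A: "countable A" "A \<subseteq> sets lborel" "\<Union>A = space lborel" "\<forall>a\<in>A. emeasure lborel a \<noteq> \<infinity>"
      using lborel.sigma_finite_countable by blast
    then show "\<exists>A :: real set set. countable A \<and> A \<subseteq> sets lebesgue \<and> \<Union> A = space lebesgue \<and> (\<forall>a\<in>A. emeasure lebesgue a \<noteq> \<infinity>)"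
      by (intro exI[of _ A]) (auto simp: subset_eq)
  qed
next
  have si: "set_integrable lebesgue A h" if "A \<in> sets lebesgue" for A
    using integrable_mult_indicator[OF that h] by (simp add: set_integrable_def)
  have B: "(LINT t:A|lebesgue. h t) = 0" if "A \<in> sets borel" for A
    using that
  proof (induction rule: borel_set_induct)
    case empty then show ?case by (simp add: set_lebesgue_integral_def)
  next
    case (interval a b) then show ?case by (rule iv)
  next
    case (compl A)
    have "(LINT t:UNIV|lebesgue. h t) = (LINT t:A|lebesgue. h t) + (LINT t:-A|lebesgue. h t)"
      using set_integral_Un[of A "-A" lebesgue h] si compl(1) by auto
    then show ?case using zero compl by (simp add: set_lebesgue_integral_def)
  next
    case (union f)
    have "(LINT t:(\<Union>i. f i)|lebesgue. h t) = (\<Sum>i. (LINT t:(f i)|lebesgue. h t))"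
      using union(1,2) by (intro lebesgue_integral_countable_add si) (auto simp: disjoint_family_on_def)
    then show ?case using union by simp
  qed
  fix A :: "real set" assume A: "A \<in> sets lebesgue"
  \<comment> \<open>A Lebesgue set is a Borel set up to a null set, which brings it within reach of
    \<open>B\<close>.\<close>
  let ?B = "main_part lborel A"
  have "AE x in lebesgue. (x \<in> A) = (x \<in> ?B)"
  proof -
    have "null_part lborel A \<in> null_sets lebesgue" using A by (metis null_part_null_sets)
    then have "AE x in lebesgue. x \<notin> null_part lborel A" by (rule AE_not_in)
    then show ?thesis
    proof eventually_elim
      case (elim x) then show ?case using main_part_null_part_Un[of A lborel] A by blast
    qed
  qed
  then have "(LINT t:A|lebesgue. h t) = (LINT t:?B|lebesgue. h t)"
    using borel_measurable_integrable[OF si[OF A, unfolded set_integrable_def]]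
      borel_measurable_integrable[OF si[of ?B, unfolded set_integrable_def]] A
    by (intro set_integral_cong_set) (auto simp: set_borel_measurable_def sets_completionI)
  then show "(LINT t:A|lebesgue. h t) = 0" using B[of ?B] main_part_sets[OF A] by simp
qed

section \<open>The fundamental theorem of calculus for weak derivatives\<close>

text \<open>The quadratic spline \<open>half_square\<close> provides test functions that are exactly \<open>C\<^sup>1\<close>.\<close>

definition half_square :: "real \<Rightarrow> real" where "half_square s = (max 0 s)\<^sup>2 / 2"

lemma half_square_deriv: "(half_square has_real_derivative max 0 s) (at s)"
proof -
  consider "s < 0" | "s = 0" | "s > 0" by linarith
  then show ?thesis
  proof cases
    case 1
    have "((\<lambda>s. 0) has_real_derivative max 0 s) (at s)" using 1 by (simp add: max_def)
    then show ?thesis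
      by (rule has_field_derivative_transform_within_open[of _ _ _ "{..<0}"]) (use 1 in \<open>auto simp: half_square_def\<close>)
  next
    case 2
    have "((\<lambda>h. (half_square (0 + h) - half_square 0) / h) \<longlongrightarrow> 0) (at 0)"
    proof (rule Lim_null_comparison)
      show "((\<lambda>h::real. \<bar>h\<bar>) \<longlongrightarrow> 0) (at 0)" by (auto intro!: tendsto_eq_intros)
      have "norm ((half_square (0 + h) - half_square 0) / h) \<le> \<bar>h\<bar>" for h
        by (auto simp: half_square_def max_def power2_eq_square)
      then show "\<forall>\<^sub>F h in at 0. norm ((half_square (0 + h) - half_square 0) / h) \<le> \<bar>h\<bar>" by simp
    qed
    then show ?thesis using 2 by (simp add: DERIV_def)
  next
    case 3
    have "((\<lambda>s. s\<^sup>2 / 2) has_real_derivative max 0 s) (at s)" using 3 by (auto intro!: derivative_eq_intros)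
    then show ?thesis
      by (rule has_field_derivative_transform_within_open[of _ _ _ "{0<..}"]) (use 3 in \<open>auto simp: half_square_def\<close>)
  qed
qed

text \<open>A C^1 transition from 0 to 1 over \<open>{0..2}\<close>: in the second difference of
  \<open>half_square\<close> the quadratic and linear parts cancel beyond 2 and leave 1. Its
  derivative is the tent function \<open>hat\<close>, which hence has integral 1.\<close>

definition step :: "real \<Rightarrow> real" where
  "step s = half_square s - 2 * half_square (s - 1) + half_square (s - 2)"

definition hat :: "real \<Rightarrow> real" where
  "hat s = max 0 s - 2 * max 0 (s - 1) + max 0 (s - 2)"

lemma step_deriv: "(step has_real_derivative hat s) (at s)"
  unfolding step_def [abs_def] hat_def
  by (auto intro!: derivative_eq_intros DERIV_chain2[OF half_square_deriv])

lemma hat_nonneg: "0 \<le> hat s" and hat_le: "s \<le> 0 \<Longrightarrow> hat s = 0" and hat_ge: "2 \<le> s \<Longrightarrow> hat s = 0"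
  by (auto simp: hat_def max_def)

lemma continuous_hat: "continuous_on S hat"
  unfolding hat_def [abs_def] by (intro continuous_intros)

lemma step_le: "s \<le> 0 \<Longrightarrow> step s = 0" and step_ge: "2 \<le> s \<Longrightarrow> step s = 1"
  by (auto simp: step_def half_square_def max_def power2_eq_square field_simps)

lemma step_mono: "s \<le> t \<Longrightarrow> step s \<le> step t"
  by (rule DERIV_nonneg_imp_nondecreasing[where f=step]) (auto intro: step_deriv hat_nonneg)

lemma step_bounds: "0 \<le> step s" "step s \<le> 1"
proof -
  show "0 \<le> step s" using step_mono[of "min s 0" s] by (simp add: step_le)
  show "step s \<le> 1" using step_mono[of s "max s 2"] by (simp add: step_ge)
qed

lemma step_affine_deriv:
  "((\<lambda>t. step (n * (t - p))) has_real_derivative n * hat (n * (t - p))) (at t within S)"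
proof -
  have "((\<lambda>t. n * (t - p)) has_real_derivative n) (at t within S)"
    by (auto intro!: derivative_eq_intros)
  from DERIV_chain2[OF step_deriv this] show ?thesis by (simp add: mult.commute)
qed

lemma set_integral_support:
  assumes "J \<subseteq> I" "\<And>x. x \<in> I - J \<Longrightarrow> f x = 0"
  shows "(LINT x:I|M. f x) = (LINT x:J|M. f x)"
proof -
  have "indicator I x *\<^sub>R f x = indicator J x *\<^sub>R f x" for x
    using assms by (auto simp: indicator_def)
  then show ?thesis by (simp only: set_lebesgue_integral_def)
qed

text \<open>The rescaled tent is nonnegative, has integral 1 and lives on
  \<open>{p..p + 2 / n}\<close>, so integrating against it averages \<open>F\<close> there, and the
  average is as close to \<open>L\<close> as \<open>F\<close> is.\<close>

lemma hat_average:
  fixes F :: "real \<Rightarrow> complex"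
  assumes n: "0 < n" and F: "continuous_on {p..p + 2 / n} F"
    and e: "\<And>t. t \<in> {p..p + 2 / n} \<Longrightarrow> cmod (F t - L) \<le> e" and I: "{p..p + 2 / n} \<subseteq> I"
  shows "cmod ((LINT t:I|lebesgue. F t * complex_of_real (n * hat (n * (t - p)))) - L) \<le> e"
    and "set_integrable lebesgue I (\<lambda>t. F t * complex_of_real (n * hat (n * (t - p))))"
proof -
  let ?J = "{p..p + 2 / n}" and ?r = "\<lambda>t. n * hat (n * (t - p))"
  have z: "?r t = 0" if "t \<notin> ?J" for t
  proof -
    have "t < p \<or> t > p + 2 / n" using that by auto
    then have "n * (t - p) \<le> 0 \<or> 2 \<le> n * (t - p)" using n by (auto simp: field_simps mult_le_0_iff)
    then show ?thesis using hat_le hat_ge by auto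
  qed
  have r1: "(?r has_integral (step (n * (p + 2/n - p)) - step (n * (p - p)))) ?J"
    using n by (intro fundamental_theorem_of_calculus)
       (auto simp: has_real_derivative_iff_has_vector_derivative[symmetric] intro!: step_affine_deriv)
  then have r: "(?r has_integral 1) ?J" using n by (simp add: step_le step_ge)
  have cr: "continuous_on ?J ?r"
    by (intro continuous_intros continuous_on_compose2[OF continuous_hat[of UNIV]]) auto
  have cF: "continuous_on ?J (\<lambda>t. F t * complex_of_real (?r t))"
    by (intro continuous_intros F cr)
  have si: "set_integrable lebesgue ?J (\<lambda>t. F t * complex_of_real (?r t))"
    using absolutely_integrable_continuous_real[OF cF] .
  have eqi: "(\<lambda>t. indicator I t *\<^sub>R (F t * complex_of_real (?r t))) = (\<lambda>t. indicator ?J t *\<^sub>R (F t * complex_of_real (?r t)))"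
  proof
    fix t show "indicator I t *\<^sub>R (F t * complex_of_real (?r t)) = indicator ?J t *\<^sub>R (F t * complex_of_real (?r t))"
      using I z[of t] by (cases "t \<in> ?J") (auto simp: indicator_def)
  qed
  show "set_integrable lebesgue I (\<lambda>t. F t * complex_of_real (?r t))"
    using si unfolding set_integrable_def eqi .
  have "(LINT t:I|lebesgue. F t * complex_of_real (?r t)) = integral ?J (\<lambda>t. F t * complex_of_real (?r t))"
    using set_lebesgue_integral_eq_integral(2)[OF si] unfolding set_lebesgue_integral_def eqi .
  moreover have "integral ?J (\<lambda>t. F t * complex_of_real (?r t)) - L = integral ?J (\<lambda>t. (F t - L) * complex_of_real (?r t))"
  proof -
    have "((\<lambda>t. complex_of_real (?r t)) has_integral complex_of_real 1) ?J" by (rule has_integral_of_real[OF r])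
    from has_integral_mult_right[OF this, of L]
    have "((\<lambda>t. L * complex_of_real (?r t)) has_integral L) ?J" by simp
    from has_integral_diff[OF integrable_integral[OF set_lebesgue_integral_eq_integral(1)[OF si]] this]
    show ?thesis by (simp add: integral_unique left_diff_distrib)
  qed
  moreover have "cmod (integral ?J (\<lambda>t. (F t - L) * complex_of_real (?r t))) \<le> integral ?J (\<lambda>t. e * ?r t)"
  proof (rule integral_norm_bound_integral)
    show "(\<lambda>t. (F t - L) * complex_of_real (?r t)) integrable_on ?J"
      by (intro integrable_continuous_real continuous_intros F cr)
    show "(\<lambda>t. e * ?r t) integrable_on ?J"
      by (intro integrable_continuous_real continuous_intros cr)
    fix t assume "t \<in> ?J"
    then show "cmod ((F t - L) * complex_of_real (?r t)) \<le> e * ?r t"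
      using e[of t] n hat_nonneg[of "n * (t - p)"]
      by (auto simp: norm_mult abs_mult intro!: mult_right_mono)
  qed
  moreover have "integral ?J (\<lambda>t. e * ?r t) = e"
    using integral_unique[OF has_integral_mult_right[OF r, of e]] by (simp only: mult_1_right)
  ultimately show "cmod ((LINT t:I|lebesgue. F t * complex_of_real (?r t)) - L) \<le> e" by (simp only:)
qed

text \<open>The averaging windows shrink to \<open>c\<close> from within \<open>{a..b}\<close>, so
  continuity relative to \<open>{a..b}\<close> suffices. This is what recovers the values of
  \<open>F\<close> at the end points \<open>a\<close> and \<open>b\<close>.\<close>

lemma hat_average_tendsto:
  fixes F :: "real \<Rightarrow> complex" and n p :: "nat \<Rightarrow> real"
  assumes F: "continuous_on {a..b} F" and c: "c \<in> {a..b}"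
    and n: "filterlim n at_top sequentially" and p: "p \<longlonglongrightarrow> c"
    and sub: "\<forall>\<^sub>F k in sequentially. {p k..p k + 2 / n k} \<subseteq> {a..b}" and I: "{a..b} \<subseteq> I"
  shows "(\<lambda>k. LINT t:I|lebesgue. F t * complex_of_real (n k * hat (n k * (t - p k)))) \<longlonglongrightarrow> F c"
proof (rule tendstoI)
  fix e :: real assume "e > 0"
  then obtain d where d: "d > 0" "\<And>t. t \<in> {a..b} \<Longrightarrow> dist t c < d \<Longrightarrow> dist (F t) (F c) < e / 2"
    using F c unfolding continuous_on_iff by (metis half_gt_zero)
  have n0: "\<forall>\<^sub>F k in sequentially. 0 < n k" using n by (simp add: filterlim_at_top_dense)
  have "(\<lambda>k. p k + 2 / n k) \<longlonglongrightarrow> c + 0"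
    by (intro tendsto_add p tendsto_divide_0[OF tendsto_const] filterlim_at_top_imp_at_infinity n)
  then have q: "\<forall>\<^sub>F k in sequentially. dist (p k + 2 / n k) c < d" using d(1) by (auto dest: tendstoD)
  have p': "\<forall>\<^sub>F k in sequentially. dist (p k) c < d" using p d(1) by (rule tendstoD)
  show "\<forall>\<^sub>F k in sequentially. dist (LINT t:I|lebesgue. F t * complex_of_real (n k * hat (n k * (t - p k)))) (F c) < e"
    using n0 q p' sub
  proof eventually_elim
    case (elim k)
    have "cmod ((LINT t:I|lebesgue. F t * complex_of_real (n k * hat (n k * (t - p k)))) - F c) \<le> e / 2"
    proof (rule hat_average)
      show "continuous_on {p k..p k + 2 / n k} F" by (rule continuous_on_subset[OF F elim(4)])
      fix t assume t: "t \<in> {p k..p k + 2 / n k}"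
      then have "dist t c < d" using elim(2,3) by (auto simp: dist_real_def)
      moreover have "t \<in> {a..b}" using t elim(4) by blast
      ultimately show "cmod (F t - F c) \<le> e / 2" using d(2)[of t] by (simp add: dist_norm)
    qed (use elim I in auto)
    then show ?case using \<open>e > 0\<close> by (simp add: dist_norm)
  qed
qed

lemma AE_lebesgue_neq: "AE t in lebesgue. t \<noteq> (c::real)"
proof -
  have "{c} \<in> null_sets lebesgue" by (simp add: negligible_iff_null_sets[symmetric])
  from AE_not_in[OF this] show ?thesis by simp
qed

text \<open>The weak derivative is tested against \<open>C\<^sup>1\<close> trapezoids inside \<open>{a..b}\<close> with ramps of width
  \<open>2 / n\<close> next to the end points: their derivatives are two approximate identities, and they
  converge to the indicator of \<open>{a<..<b}\<close>.\<close>

lemma weak_FTC: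
  fixes F K :: "real \<Rightarrow> complex"
  assumes ab: "a < b" and sub: "{a..b} \<subseteq> I" and int: "{a<..<b} \<subseteq> interior I"
    and F: "continuous_on {a..b} F" and K: "set_integrable lebesgue {a..b} K"
    and weak: "\<And>\<phi>. \<phi> \<in> test_functions I \<Longrightarrow> (LINT x:I|lebesgue. F x * complex_of_real (deriv \<phi> x)) =
        - (LINT x:I|lebesgue. K x * complex_of_real (\<phi> x))"
  shows "F b - F a = (LINT x:{a..b}|lebesgue. K x)"
proof -
  define n where "n k = real (Suc k)" for k
  \<comment> \<open>The rising ramp is \<open>{a + 1 / n k..a + 3 / n k}\<close>, the falling one
    \<open>{b - 3 / n k..b - 1 / n k}\<close>. The margins of width \<open>1 / n k\<close> keep the
    support compactly inside the open interval.\<close>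
  define p where "p k = a + 1 / n k" for k
  define q where "q k = b - 3 / n k" for k
  define \<phi> where "\<phi> k t = step (n k * (t - p k)) - step (n k * (t - q k))" for k t
  have n0: "n k > 0" for k by (simp add: n_def)
  have nlim: "filterlim n at_top sequentially"
    unfolding n_def by (rule filterlim_compose[OF filterlim_real_sequentially filterlim_Suc])
  have inv: "(\<lambda>k. c / n k) \<longlonglongrightarrow> 0" for c
    by (intro tendsto_divide_0[OF tendsto_const] filterlim_at_top_imp_at_infinity nlim)
  have p: "p \<longlonglongrightarrow> a" unfolding p_def using tendsto_add[OF tendsto_const inv, of a 1] by simp
  have q: "q \<longlonglongrightarrow> b" unfolding q_def using tendsto_diff[OF tendsto_const inv, of b 3] by simp
  \<comment> \<open>Six units of length \<open>1 / n k\<close> leave room for two margins and two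
    ramps without overlap: \<open>a + 3 / n k \<le> b - 3 / n k\<close>.\<close>
  have large: "\<forall>\<^sub>F k in sequentially. n k * (b - a) \<ge> 6"
  proof -
    have "\<forall>\<^sub>F k in sequentially. 6 / (b - a) \<le> n k" using nlim by (simp add: filterlim_at_top)
    then show ?thesis by eventually_elim (use ab in \<open>simp add: field_simps\<close>)
  qed
  have der: "(\<phi> k has_real_derivative (n k * hat (n k * (t - p k)) - n k * hat (n k * (t - q k)))) (at t)" for k t
    unfolding \<phi>_def by (intro derivative_intros step_affine_deriv)
  have derv: "deriv (\<phi> k) t = n k * hat (n k * (t - p k)) - n k * hat (n k * (t - q k))" for k t
    using der by (rule DERIV_imp_deriv)
  have aff: "n k * (t - p k) = n k * (t - a) - 1" "n k * (t - q k) = n k * (t - a) - n k * (b - a) + 3"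
    "n k * (t - q k) = 3 - n k * (b - t)" "n k * (t - p k) = n k * (b - a) - n k * (b - t) - 1" for k t
    using n0[of k] by (auto simp: p_def q_def field_simps)
  have supp: "\<phi> k t = 0" if l: "n k * (b - a) \<ge> 6" and t: "t \<notin> {a + 1 / n k .. b - 1 / n k}" for k t
  proof -
    consider "t < a + 1 / n k" | "t > b - 1 / n k" using t by force
    then show ?thesis
    proof cases
      case 1
      then have 1: "n k * (t - a) < 1" using n0[of k] by (simp add: field_simps)
      then have "n k * (t - p k) \<le> 0" "n k * (t - q k) \<le> 0"
        using l aff[of k t] by linarith+
      then show ?thesis by (simp add: \<phi>_def step_le)
    next
      case 2
      then have 1: "n k * (b - t) < 1" using n0[of k] by (simp add: field_simps)
      then have "n k * (t - p k) \<ge> 2" "n k * (t - q k) \<ge> 2"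
        using l aff(3,4)[of k t] by linarith+
      then show ?thesis by (simp add: \<phi>_def step_ge)
    qed
  qed
  have test: "\<phi> k \<in> test_functions I" if l: "n k * (b - a) \<ge> 6" for k
    unfolding test_functions_def
  proof (intro CollectI conjI exI[of _ "{a + 1 / n k .. b - 1 / n k}"])
    show "\<phi> k C1_differentiable_on UNIV"
      unfolding C1_differentiable_on_def
    proof (intro exI conjI ballI)
      show "continuous_on UNIV (\<lambda>t. n k * hat (n k * (t - p k)) - n k * hat (n k * (t - q k)))"
        by (intro continuous_intros continuous_on_compose2[OF continuous_hat[of UNIV]]) auto
    qed (use der in \<open>simp add: has_real_derivative_iff_has_vector_derivative\<close>)
    show "{a + 1 / n k .. b - 1 / n k} \<subseteq> interior I"
    proof -
      have "1 / n k > 0" using n0[of k] by (rule divide_pos_pos[OF zero_less_one])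
      then have "{a + 1 / n k .. b - 1 / n k} \<subseteq> {a<..<b}" by (auto simp del: zero_less_divide_1_iff)
      then show ?thesis using int by blast
    qed
  qed (use supp[OF l] in auto)
  have lim1: "(\<lambda>k. LINT t:I|lebesgue. F t * complex_of_real (n k * hat (n k * (t - p k)))) \<longlonglongrightarrow> F a"
  proof (rule hat_average_tendsto[OF F _ nlim p _ sub])
    show "\<forall>\<^sub>F k in sequentially. {p k..p k + 2 / n k} \<subseteq> {a..b}"
      using large
    proof eventually_elim
      case (elim k) then show ?case using n0[of k] less_imp_le[OF n0[of k]] by (auto simp: p_def field_simps)
    qed
  qed (use ab in auto)
  have lim2: "(\<lambda>k. LINT t:I|lebesgue. F t * complex_of_real (n k * hat (n k * (t - q k)))) \<longlonglongrightarrow> F b"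
  proof (rule hat_average_tendsto[OF F _ nlim q _ sub])
    show "\<forall>\<^sub>F k in sequentially. {q k..q k + 2 / n k} \<subseteq> {a..b}"
      using large
    proof eventually_elim
      case (elim k) then show ?case using n0[of k] less_imp_le[OF n0[of k]] by (auto simp: q_def field_simps)
    qed
  qed (use ab in auto)
  \<comment> \<open>The derivative of the trapezoid is a tent near \<open>a\<close> minus a tent
    near \<open>b\<close>, so the weak identity compares two averages of \<open>F\<close> with an
    integral of \<open>K\<close>.\<close>
  have A: "\<forall>\<^sub>F k in sequentially. - (LINT x:{a..b}|lebesgue. K x * complex_of_real (\<phi> k x)) =
      (LINT t:I|lebesgue. F t * complex_of_real (n k * hat (n k * (t - p k)))) -
      (LINT t:I|lebesgue. F t * complex_of_real (n k * hat (n k * (t - q k))))"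
    using large
  proof eventually_elim
    case (elim k)
    have pq: "{p k..p k + 2 / n k} \<subseteq> {a..b}" "{q k..q k + 2 / n k} \<subseteq> {a..b}"
      using elim n0[of k] by (auto simp: p_def q_def field_simps)
    have si: "set_integrable lebesgue I (\<lambda>t. F t * complex_of_real (n k * hat (n k * (t - r))))"
      if r: "{r..r + 2 / n k} \<subseteq> {a..b}" for r
    proof -
      have Fr: "continuous_on {r..r + 2 / n k} F" by (rule continuous_on_subset[OF F r])
      obtain e where "\<And>t. t \<in> {r..r + 2 / n k} \<Longrightarrow> cmod (F t - 0) \<le> e"
        using compact_imp_bounded[OF compact_continuous_image[OF Fr]] by (fastforce simp: bounded_iff)
      from hat_average(2)[OF n0 Fr this order_trans[OF r sub]] show ?thesis .
    qed
    have "(LINT x:{a..b}|lebesgue. K x * complex_of_real (\<phi> k x)) = (LINT x:I|lebesgue. K x * complex_of_real (\<phi> k x))"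
    proof (rule set_integral_support[OF sub, symmetric])
      fix x assume "x \<in> I - {a..b}"
      moreover have "1 / n k > 0" using n0[of k] by (rule divide_pos_pos[OF zero_less_one])
      ultimately have "x \<notin> {a + 1 / n k .. b - 1 / n k}"
        unfolding Diff_iff atLeastAtMost_iff by linarith
      then show "K x * complex_of_real (\<phi> k x) = 0" using supp[OF elim] by simp
    qed
    also have "- \<dots> = (LINT x:I|lebesgue. F x * complex_of_real (deriv (\<phi> k) x))"
      using weak[OF test[OF elim]] by simp
    also have "\<dots> = (LINT t:I|lebesgue. F t * complex_of_real (n k * hat (n k * (t - p k))) -
      F t * complex_of_real (n k * hat (n k * (t - q k))))"
      by (simp add: derv right_diff_distrib)
    also have "\<dots> = (LINT t:I|lebesgue. F t * complex_of_real (n k * hat (n k * (t - p k)))) -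
      (LINT t:I|lebesgue. F t * complex_of_real (n k * hat (n k * (t - q k))))"
      by (rule set_integral_diff(2)[OF si[OF pq(1)] si[OF pq(2)]])
    finally show ?case by simp
  qed
  have lim3: "(\<lambda>k. LINT x:{a..b}|lebesgue. K x * complex_of_real (\<phi> k x)) \<longlonglongrightarrow> (LINT x:{a..b}|lebesgue. K x)"
    unfolding set_lebesgue_integral_def
  proof (rule integral_dominated_convergence)
    let ?w = "\<lambda>x. norm (indicator {a..b} x *\<^sub>R K x)"
    show "integrable lebesgue ?w" by (rule integrable_norm[OF K[unfolded set_integrable_def]])
    show Km: "(\<lambda>x. indicator {a..b} x *\<^sub>R K x) \<in> borel_measurable lebesgue"
      by (rule borel_measurable_integrable[OF K[unfolded set_integrable_def]])
    fix k
    have "continuous_on UNIV (\<phi> k)"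
      by (rule DERIV_continuous_on[OF has_field_derivative_at_within[OF der]])
    then have "(\<lambda>x. complex_of_real (\<phi> k x)) \<in> borel_measurable lebesgue"
      by (intro measurable_completion) (auto intro!: borel_measurable_continuous_onI continuous_intros)
    from borel_measurable_times[OF Km this]
    show "(\<lambda>x. indicator {a..b} x *\<^sub>R (K x * complex_of_real (\<phi> k x))) \<in> borel_measurable lebesgue"
      by simp
    have "\<bar>\<phi> k x\<bar> \<le> 1" for x using step_bounds[of "n k * (x - p k)"] step_bounds[of "n k * (x - q k)"]
      by (auto simp: \<phi>_def)
    then have "norm (indicator {a..b} x *\<^sub>R (K x * complex_of_real (\<phi> k x))) \<le> ?w x" for x
      by (auto simp: norm_mult indicator_def intro!: mult_left_le)
    then show "AE x in lebesgue. norm (indicator {a..b} x *\<^sub>R (K x * complex_of_real (\<phi> k x))) \<le> ?w x" by simp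
  next
    \<comment> \<open>A point strictly between \<open>a\<close> and \<open>b\<close> eventually lies
      on the plateau, where \<open>\<phi> k\<close> equals 1. The two end points never do, but they
      form a null set.\<close>
    have "(\<lambda>k. indicator {a..b} x *\<^sub>R (K x * complex_of_real (\<phi> k x))) \<longlonglongrightarrow> indicator {a..b} x *\<^sub>R K x"
      if x: "x \<noteq> a" "x \<noteq> b" for x
    proof (cases "x \<in> {a..b}")
      case True
      then have x: "x - a > 0" "b - x > 0" using x by auto
      have "\<forall>\<^sub>F k in sequentially. 3 / (x - a) \<le> n k" "\<forall>\<^sub>F k in sequentially. 3 / (b - x) \<le> n k"
        using nlim by (auto simp: filterlim_at_top)
      then have "\<forall>\<^sub>F k in sequentially. indicator {a..b} x *\<^sub>R (K x * complex_of_real (\<phi> k x)) = indicator {a..b} x *\<^sub>R K x"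
      proof eventually_elim
        case (elim k)
        then have "3 \<le> n k * (x - a)" "3 \<le> n k * (b - x)"
          using x by (auto simp: pos_divide_le_eq)
        then have "n k * (x - p k) \<ge> 2" "n k * (x - q k) \<le> 0"
          using aff(1,3)[of k x] by linarith+
        then show ?case by (simp add: \<phi>_def step_ge step_le)
      qed
      then show ?thesis by (rule tendsto_eventually)
    qed simp
    then show "AE x in lebesgue. (\<lambda>k. indicator {a..b} x *\<^sub>R (K x * complex_of_real (\<phi> k x))) \<longlonglongrightarrow> indicator {a..b} x *\<^sub>R K x"
      using AE_lebesgue_neq[of a] AE_lebesgue_neq[of b] by auto
  qed
  have "(\<lambda>k. - (LINT x:{a..b}|lebesgue. K x * complex_of_real (\<phi> k x))) \<longlonglongrightarrow> F a - F b"
    by (rule Lim_transform_eventually[OF tendsto_diff[OF lim1 lim2]]) (use A in \<open>simp add: eq_commute\<close>)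
  from LIMSEQ_unique[OF this tendsto_minus[OF lim3]] show ?thesis by (simp add: algebra_simps)
qed

section \<open>Weak derivatives on an edge\<close>

lemma edge_Icc:
  assumes "a \<in> edge j" "b \<in> edge j"
  shows "{a..b} \<subseteq> edge j" and "{a<..<b} \<subseteq> interior (edge j)"
  using assms by (auto simp: edge_def interior_real_atLeast interior_real_atMost split: if_splits)

lemma edge_sets [simp]: "edge j \<in> sets borel" "edge j \<in> sets lebesgue"
  by (auto simp: edge_def)

lemma zero_in_edge [simp]: "0 \<in> edge j"
  by (simp add: edge_def)

lemma L2_on_subset:
  assumes f: "f \<in> L2_on I" and J: "J \<in> sets lebesgue" "J \<subseteq> I"
  shows "f \<in> L2_on J"
proof -
  have "(\<lambda>x. indicator J x *\<^sub>R (indicator I x *\<^sub>R f x)) \<in> borel_measurable lebesgue"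
    using L2_onD(1)[OF f] J unfolding set_borel_measurable_def by measurable
  also have "(\<lambda>x. indicator J x *\<^sub>R (indicator I x *\<^sub>R f x)) = (\<lambda>x. indicator J x *\<^sub>R f x)"
    using J(2) by (auto simp: indicator_def fun_eq_iff)
  finally show ?thesis
    using set_integrable_subset[OF L2_onD(2)[OF f] J] by (simp add: L2_on_def set_borel_measurable_def)
qed

lemma L2_on_Icc_continuous:
  fixes f :: "real \<Rightarrow> complex"
  assumes "continuous_on {a..b} f"
  shows "f \<in> L2_on {a..b}"
proof -
  have "set_integrable lebesgue {a..b} (\<lambda>x. (cmod (f x))\<^sup>2)"
    by (intro absolutely_integrable_continuous_real continuous_intros assms)
  then show ?thesis using set_borel_measurable_continuous[OF assms] by (simp add: L2_on_def)
qed

text \<open>The constant 1 is square integrable on a bounded interval, and a product of two square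
  integrable functions is integrable.\<close>

lemma L2_on_Icc_integrable:
  assumes "f \<in> L2_on I" "{a..b} \<subseteq> I"
  shows "set_integrable lebesgue {a..b} f"
  using L2_on_mult[OF L2_on_subset[OF assms(1) _ assms(2)] L2_on_Icc_continuous[of a b "\<lambda>_. 1"]]
  by simp

text \<open>Stated for a pair \<open>F\<close>, \<open>K\<close> rather than through
  \<open>is_weak_deriv\<close>, because for a product such as \<open>du * cnj u\<close> the
  derivative is in general only integrable, not square integrable. The degenerate interval is
  included.\<close>

lemma weak_FTC_edge:
  fixes F K :: "real \<Rightarrow> complex"
  assumes ab: "a \<in> edge j" "b \<in> edge j" "a \<le> b"
    and F: "continuous_on (edge j) F" and K: "set_integrable lebesgue {a..b} K"
    and weak: "\<And>\<phi>. \<phi> \<in> test_functions (edge j) \<Longrightarrow> (LINT x:edge j|lebesgue. F x * complex_of_real (deriv \<phi> x)) =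
        - (LINT x:edge j|lebesgue. K x * complex_of_real (\<phi> x))"
  shows "F b - F a = (LINT x:{a..b}|lebesgue. K x)"
proof (cases "a = b")
  case True
  have "AE x in lebesgue. indicator {b} x *\<^sub>R K x = 0"
    using AE_lebesgue_neq[of b] by eventually_elim auto
  then show ?thesis using True by (simp add: set_lebesgue_integral_def integral_eq_zero_AE)
next
  case False
  show ?thesis
    by (rule weak_FTC[OF _ edge_Icc[OF ab(1,2)] continuous_on_subset[OF F edge_Icc(1)[OF ab(1,2)]] K weak])
       (use ab False in auto)
qed

lemma is_weak_deriv_FTC:
  assumes "is_weak_deriv (edge j) f g" "continuous_on (edge j) f" "a \<in> edge j" "b \<in> edge j" "a \<le> b"
  shows "f b - f a = (LINT x:{a..b}|lebesgue. g x)"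
  using assms edge_Icc[OF assms(3,4)]
  by (intro weak_FTC_edge[OF assms(3-5)]) (auto simp: is_weak_deriv_def intro: L2_on_Icc_integrable)

lemma test_function_support:
  assumes "\<phi> \<in> test_functions I"
  obtains K where "compact K" "K \<subseteq> interior I" "\<And>x. x \<notin> K \<Longrightarrow> \<phi> x = 0" "\<And>x. x \<notin> K \<Longrightarrow> deriv \<phi> x = 0"
proof -
  obtain K where K: "compact K" "K \<subseteq> interior I" "\<And>x. x \<notin> K \<Longrightarrow> \<phi> x = 0"
    using assms by (auto simp: test_functions_def)
  have oK: "open (-K)" using compact_imp_closed[OF K(1)] by (simp add: open_Compl)
  have "deriv \<phi> x = 0" if "x \<notin> K" for x
  proof -
    have "((\<lambda>_. 0) has_real_derivative 0) (at x)" by simp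
    then have "(\<phi> has_real_derivative 0) (at x)"
      by (rule has_field_derivative_transform_within_open[of _ _ _ "- K"]) (use that K oK in auto)
    then show ?thesis by (rule DERIV_imp_deriv)
  qed
  with K show ?thesis by (rule that)
qed

lemma test_function_facts:
  assumes "\<phi> \<in> test_functions I"
  shows "continuous_on S \<phi>" "continuous_on S (deriv \<phi>)" "(\<phi> has_real_derivative deriv \<phi> x) (at x)"
    "J \<in> sets borel \<Longrightarrow> (\<lambda>x. complex_of_real (\<phi> x)) \<in> L2_on J"
    "J \<in> sets borel \<Longrightarrow> (\<lambda>x. complex_of_real (deriv \<phi> x)) \<in> L2_on J"
    "\<exists>C. \<forall>x. \<bar>\<phi> x\<bar> \<le> C \<and> \<bar>deriv \<phi> x\<bar> \<le> C"
proof -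
  obtain D where D: "\<And>x. (\<phi> has_vector_derivative D x) (at x)" "continuous_on UNIV D"
    using assms by (auto simp: test_functions_def C1_differentiable_on_def)
  obtain K where K: "compact K" "K \<subseteq> interior I" "\<And>x. x \<notin> K \<Longrightarrow> \<phi> x = 0" "\<And>x. x \<notin> K \<Longrightarrow> deriv \<phi> x = 0"
    by (rule test_function_support[OF assms], rule that)
  have D': "(\<phi> has_real_derivative D x) (at x)" for x
    using D(1) by (simp add: has_real_derivative_iff_has_vector_derivative)
  have dD: "deriv \<phi> = D" using D' by (auto intro!: ext DERIV_imp_deriv)
  show "(\<phi> has_real_derivative deriv \<phi> x) (at x)" using D' dD by simp
  have cU: "continuous_on UNIV \<phi>"
    by (rule DERIV_continuous_on[OF has_field_derivative_at_within[OF D']])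
  then show "continuous_on S \<phi>" using continuous_on_subset by blast
  show "continuous_on S (deriv \<phi>)" unfolding dD using D(2) continuous_on_subset by blast
  obtain a b where "K \<subseteq> cbox a b" using compact_imp_bounded[OF K(1)] bounded_subset_cbox_symmetric by blast
  then have ab: "K \<subseteq> {a..b}" by simp
  have z: "\<phi> x = 0" if "x \<notin> {a..b}" for x using K ab that by blast
  have z': "deriv \<phi> x = 0" if "x \<notin> {a..b}" for x using K ab that by blast
  have bd: "\<exists>C\<ge>0. \<forall>x. \<bar>h x\<bar> \<le> C" if h: "continuous_on UNIV h" "\<And>x. x \<notin> {a..b} \<Longrightarrow> h x = 0" for h :: "real \<Rightarrow> real"
  proof -
    have "bounded (h ` {a..b})"
      by (intro compact_imp_bounded compact_continuous_image continuous_on_subset[OF h(1)]) auto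
    then obtain C where C: "\<And>x. x \<in> {a..b} \<Longrightarrow> \<bar>h x\<bar> \<le> C" by (fastforce simp: bounded_iff)
    have "\<bar>h x\<bar> \<le> max C 0" for x using C[of x] h(2)[of x] by (cases "x \<in> {a..b}") auto
    then show ?thesis by (intro exI[of _ "max C 0"]) auto
  qed
  show "\<exists>C. \<forall>x. \<bar>\<phi> x\<bar> \<le> C \<and> \<bar>deriv \<phi> x\<bar> \<le> C"
  proof -
    obtain C1 C2 where "\<forall>x. \<bar>\<phi> x\<bar> \<le> C1" "\<forall>x. \<bar>deriv \<phi> x\<bar> \<le> C2"
      using bd[OF cU z] bd[OF _ z', unfolded dD, OF D(2)] dD by blast
    then show ?thesis by (intro exI[of _ "max C1 C2"]) (auto intro: max.coboundedI1 max.coboundedI2)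
  qed
  have main: "(\<lambda>x. complex_of_real (h x)) \<in> L2_on J" if J: "J \<in> sets borel" and h: "continuous_on UNIV h"
    and zero: "\<And>x. x \<notin> {a..b} \<Longrightarrow> h x = 0" for h J
  proof -
    have ch: "continuous_on A (\<lambda>x. complex_of_real (h x))" for A
      using continuous_on_subset[OF h] by (intro continuous_intros) auto
    from L2_on_Icc_continuous[OF this] have "(\<lambda>x. complex_of_real (h x)) \<in> L2_on {a..b}" .
    moreover have "indicator UNIV x *\<^sub>R complex_of_real (h x) = indicator {a..b} x *\<^sub>R complex_of_real (h x)"
      "indicator UNIV x *\<^sub>R (cmod (complex_of_real (h x)))\<^sup>2 = indicator {a..b} x *\<^sub>R (cmod (complex_of_real (h x)))\<^sup>2" for x
      using zero[of x] by (auto simp: indicator_def)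
    ultimately have "(\<lambda>x. complex_of_real (h x)) \<in> L2_on UNIV"
      unfolding L2_on_def set_borel_measurable_def set_integrable_def by (simp only: mem_Collect_eq)
    then show ?thesis by (rule L2_on_subset) (use J in auto)
  qed
  show "(\<lambda>x. complex_of_real (\<phi> x)) \<in> L2_on J" if "J \<in> sets borel"
    by (rule main[OF that cU z])
  show "(\<lambda>x. complex_of_real (deriv \<phi> x)) \<in> L2_on J" if "J \<in> sets borel"
    by (rule main[OF that _ z']) (use dD D in auto)
qed

text \<open>The hypothesis says that \<open>d\<close> is a weak derivative of the zero function. By
  the weak fundamental theorem all its interval integrals are therefore zero.\<close>

lemma AE_zero_of_weak_zero:
  assumes d: "d \<in> L2_on (edge j)"
    and z: "\<And>\<phi>. \<phi> \<in> test_functions (edge j) \<Longrightarrow> (LINT x:edge j|lebesgue. d x * complex_of_real (\<phi> x)) = 0"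
  shows "AE x in lebesgue. x \<in> edge j \<longrightarrow> d x = 0"
proof -
  have iv: "(LINT x:{a..b}|lebesgue. d x) = 0" if "a \<in> edge j" "b \<in> edge j" "a \<le> b" for a b
    using weak_FTC_edge[OF that continuous_on_const[of _ 0] L2_on_Icc_integrable[OF d edge_Icc(1)[OF that(1,2)]]] z
    by simp
  \<comment> \<open>A square integrable function need not be integrable on a half-line, so the edge
    is exhausted by bounded pieces.\<close>
  have "AE x in lebesgue. x \<in> edge j \<inter> {-real n..real n} \<longrightarrow> d x = 0" for n
  proof -
    define J where "J = edge j \<inter> {-real n..real n}"
    define h where "h x = indicator J x *\<^sub>R d x" for x
    obtain a b where J: "J = {a..b}" "a \<in> edge j" "b \<in> edge j" "a \<le> b"
    proof (cases "j = 1")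
      case True then show ?thesis by (intro that[of "-real n" 0]) (auto simp: J_def edge_def)
    next
      case False then show ?thesis by (intro that[of 0 "real n"]) (auto simp: J_def edge_def)
    qed
    have hint: "integrable lebesgue h"
      using L2_on_Icc_integrable[OF d edge_Icc(1)[OF J(2,3)]] unfolding h_def J set_integrable_def .
    have h0: "integral\<^sup>L lebesgue h = 0"
      using iv[OF J(2-4)] unfolding h_def J set_lebesgue_integral_def .
    have "(LINT t:{x..y}|lebesgue. h t) = 0" for x y
    proof -
      have "(LINT t:{x..y}|lebesgue. h t) = (LINT t:{x..y} \<inter> J|lebesgue. d t)"
        unfolding set_lebesgue_integral_def h_def
        by (intro arg_cong[where f="integral\<^sup>L lebesgue"]) (auto simp: indicator_def)
      also have "{x..y} \<inter> J = {max x a..min y b}" by (auto simp: J)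
      also have "(LINT t:{max x a..min y b}|lebesgue. d t) = 0"
      proof (cases "max x a \<le> min y b")
        case True
        then have "max x a \<in> {a..b}" "min y b \<in> {a..b}" by auto
        then show ?thesis using edge_Icc(1)[OF J(2,3)] by (intro iv True) auto
      qed (simp add: set_lebesgue_integral_def)
      finally show ?thesis .
    qed
    from AE_zero_of_interval_integrals[OF hint h0 this]
    show ?thesis by eventually_elim (auto simp: h_def J_def indicator_def)
  qed
  then have "AE x in lebesgue. \<forall>n. x \<in> edge j \<inter> {-real n..real n} \<longrightarrow> d x = 0"
    unfolding AE_all_countable by blast
  then show ?thesis
  proof eventually_elim
    case (elim x)
    obtain n where "\<bar>x\<bar> \<le> real n" using real_arch_simple by blast
    then have "x \<in> {-real n..real n}" by auto
    then show ?case using elim by blast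
  qed
qed

text \<open>The difference of two weak derivatives annihilates all test functions. This is what
  frees \<open>H1_norm\<close> and \<open>laplacian\<close> from the choice made in
  \<open>weak_deriv\<close>.\<close>

lemma is_weak_deriv_AE_unique:
  assumes "is_weak_deriv (edge j) f g1" "is_weak_deriv (edge j) f g2"
  shows "AE x in lebesgue. x \<in> edge j \<longrightarrow> g1 x = g2 x"
proof -
  have L: "g1 \<in> L2_on (edge j)" "g2 \<in> L2_on (edge j)" using assms by (auto simp: is_weak_deriv_def)
  have "(LINT x:edge j|lebesgue. (g1 x - g2 x) * complex_of_real (\<phi> x)) = 0" if "\<phi> \<in> test_functions (edge j)" for \<phi>
  proof -
    note i = L2_on_mult[OF L(1) test_function_facts(4)[OF that edge_sets(1)]] L2_on_mult[OF L(2) test_function_facts(4)[OF that edge_sets(1)]]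
    have "(LINT x:edge j|lebesgue. g1 x * complex_of_real (\<phi> x)) = (LINT x:edge j|lebesgue. g2 x * complex_of_real (\<phi> x))"
      using bspec[OF assms(1)[unfolded is_weak_deriv_def, THEN conjunct2, THEN conjunct2] that]
        bspec[OF assms(2)[unfolded is_weak_deriv_def, THEN conjunct2, THEN conjunct2] that] by simp
    then show ?thesis using set_integral_diff(2)[OF i] by (simp add: left_diff_distrib)
  qed
  from AE_zero_of_weak_zero[OF L2_on_diff[OF L] this] show ?thesis by simp
qed

lemma set_integral_cong_AE':
  fixes f g :: "_ \<Rightarrow> complex"
  assumes "set_borel_measurable lebesgue I f" "set_borel_measurable lebesgue I g"
    "AE x in lebesgue. x \<in> I \<longrightarrow> f x = g x"
  shows "(LINT x:I|lebesgue. f x) = (LINT x:I|lebesgue. g x)"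
  unfolding set_lebesgue_integral_def
  using assms(1,2) unfolding set_borel_measurable_def
  by (intro integral_cong_AE) (use assms(3) in \<open>auto simp: indicator_def\<close>)

text \<open>Needed because the chosen representative of a first derivative agrees only a.e. with the
  continuous one, and \<open>laplacian\<close> differentiates the chosen one again.\<close>

lemma is_weak_deriv_cong_AE:
  assumes "is_weak_deriv (edge j) f g" "f' \<in> L2_on (edge j)" "AE x in lebesgue. x \<in> edge j \<longrightarrow> f x = f' x"
  shows "is_weak_deriv (edge j) f' g"
proof -
  have "(LINT x:edge j|lebesgue. f x * complex_of_real (deriv \<phi> x)) = (LINT x:edge j|lebesgue. f' x * complex_of_real (deriv \<phi> x))"
    if "\<phi> \<in> test_functions (edge j)" for \<phi>
    using assms test_function_facts(5)[OF that edge_sets(1)]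
    by (intro set_integral_cong_AE' set_borel_measurable_mult) (auto simp: is_weak_deriv_def dest: L2_onD)
  then show ?thesis using assms(1,2) by (simp add: is_weak_deriv_def)
qed

lemma is_weak_deriv_lincomb:
  assumes "is_weak_deriv (edge j) f g" "is_weak_deriv (edge j) f' g'"
  shows "is_weak_deriv (edge j) (\<lambda>x. a * f x + b * f' x) (\<lambda>x. a * g x + b * g' x)"
proof -
  have L: "f \<in> L2_on (edge j)" "g \<in> L2_on (edge j)" "f' \<in> L2_on (edge j)" "g' \<in> L2_on (edge j)"
    using assms by (auto simp: is_weak_deriv_def)
  have comb: "(LINT x:edge j|lebesgue. (a * u x + b * v x) * w x) =
      a * (LINT x:edge j|lebesgue. u x * w x) + b * (LINT x:edge j|lebesgue. v x * w x)"
    if "u \<in> L2_on (edge j)" "v \<in> L2_on (edge j)" "w \<in> L2_on (edge j)" for u v w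
    using set_integral_add(2)[OF L2_on_mult[OF L2_on_scale[OF that(1), of a] that(3)] L2_on_mult[OF L2_on_scale[OF that(2), of b] that(3)]]
    by (simp add: distrib_right mult.assoc)
  show ?thesis unfolding is_weak_deriv_def
  proof (intro conjI ballI)
    fix \<phi> assume t: "\<phi> \<in> test_functions (edge j)"
    show "(LINT x:edge j|lebesgue. (a * f x + b * f' x) * complex_of_real (deriv \<phi> x)) =
        - (LINT x:edge j|lebesgue. (a * g x + b * g' x) * complex_of_real (\<phi> x))"
      using assms t by (simp add: comb L test_function_facts[OF t] is_weak_deriv_def)
  qed (intro L2_on_add L2_on_scale L)+
qed

lemma H1_on_lincomb:
  assumes "f \<in> H1_on (edge j)" "f' \<in> H1_on (edge j)"
  shows "(\<lambda>x. a * f x + b * f' x) \<in> H1_on (edge j)"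
  using assms is_weak_deriv_lincomb unfolding H1_on_def
  by (auto intro!: continuous_intros) blast

lemma H2_on_lincomb:
  assumes "f \<in> H2_on (edge j)" "f' \<in> H2_on (edge j)"
  shows "(\<lambda>x. a * f x + b * f' x) \<in> H2_on (edge j)"
proof -
  obtain g g' where "g \<in> H1_on (edge j)" "is_weak_deriv (edge j) f g" "g' \<in> H1_on (edge j)" "is_weak_deriv (edge j) f' g'"
    using assms by (auto simp: H2_on_def)
  then show ?thesis
    using assms unfolding H2_on_def
    by (auto intro!: H1_on_lincomb bexI[of _ "\<lambda>x. a * g x + b * g' x"] is_weak_deriv_lincomb)
qed

lemma set_integral_subset_mono:
  fixes f :: "'a \<Rightarrow> real"
  assumes "set_integrable M B f" "A \<in> sets M" "A \<subseteq> B" "\<And>x. x \<in> B \<Longrightarrow> 0 \<le> f x"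
  shows "(LINT x:A|M. f x) \<le> (LINT x:B|M. f x)"
  unfolding set_lebesgue_integral_def
proof (rule integral_mono)
  show "integrable M (\<lambda>x. indicator A x *\<^sub>R f x)" "integrable M (\<lambda>x. indicator B x *\<^sub>R f x)"
    using set_integrable_subset[OF assms(1-3)] assms(1) by (simp_all add: set_integrable_def)
qed (use assms(3,4) in \<open>auto simp: indicator_def\<close>)

lemma FTC_oscillation:
  fixes F K :: "real \<Rightarrow> complex"
  assumes FTC: "\<And>c d. a \<le> c \<Longrightarrow> c \<le> d \<Longrightarrow> d \<le> b \<Longrightarrow> F d - F c = (LINT t:{c..d}|lebesgue. K t)"
    and K: "set_integrable lebesgue {a..b} K" and xy: "x \<in> {a..b}" "y \<in> {a..b}"
  shows "cmod (F x - F y) \<le> (LINT t:{a..b}|lebesgue. cmod (K t))"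
proof -
  have main: "cmod (F d - F c) \<le> (LINT t:{a..b}|lebesgue. cmod (K t))" if "a \<le> c" "c \<le> d" "d \<le> b" for c d
  proof -
    have si: "set_integrable lebesgue {c..d} K" by (rule set_integrable_subset[OF K]) (use that in auto)
    have "cmod (F d - F c) \<le> (LINT t:{c..d}|lebesgue. cmod (K t))"
      unfolding FTC[OF that] by (rule set_integral_norm_bound[OF si])
    also have "\<dots> \<le> (LINT t:{a..b}|lebesgue. cmod (K t))"
      by (rule set_integral_subset_mono) (use that set_integrable_norm[OF K] in auto)
    finally show ?thesis .
  qed
  show ?thesis
  proof (cases "x \<le> y")
    case True then show ?thesis using main[of x y] xy by (simp add: norm_minus_commute)
  next
    case False then show ?thesis using main[of y x] xy by simp
  qed
qed

section \<open>Sobolev functions on an edge\<close>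

lemma unit_interval_integral_const: "(LINT x:{a..a + 1 :: real}|lebesgue. c) = (c :: real)"
  by (simp add: set_lebesgue_integral_def)

text \<open>The variance of \<open>f\<close> over an interval of length 1 is nonnegative.\<close>

lemma unit_interval_Cauchy_Schwarz:
  fixes f :: "real \<Rightarrow> real"
  assumes "set_integrable lebesgue {a..a+1} f" "set_integrable lebesgue {a..a+1} (\<lambda>x. (f x)\<^sup>2)"
  shows "(LINT x:{a..a+1}|lebesgue. f x)\<^sup>2 \<le> (LINT x:{a..a+1}|lebesgue. (f x)\<^sup>2)"
proof -
  define m where "m = (LINT x:{a..a+1}|lebesgue. f x)"
  have c: "set_integrable lebesgue {a..a+1} (\<lambda>x. c)" for c :: real
    by (intro absolutely_integrable_continuous_real continuous_intros)
  note ci = unit_interval_integral_const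
  have "0 \<le> (LINT x:{a..a+1}|lebesgue. (f x - m)\<^sup>2)"
    unfolding set_lebesgue_integral_def by (intro integral_nonneg_AE) auto
  also have "(\<lambda>x. (f x - m)\<^sup>2) = (\<lambda>x. (f x)\<^sup>2 - 2 * m * f x + m\<^sup>2)"
    by (auto simp: power2_diff algebra_simps)
  also have "(LINT x:{a..a+1}|lebesgue. (f x)\<^sup>2 - 2 * m * f x + m\<^sup>2) = (LINT x:{a..a+1}|lebesgue. (f x)\<^sup>2) - 2 * m * m + m\<^sup>2"
    using assms by (simp add: set_integral_add set_integral_diff c ci m_def)
  finally show ?thesis by (simp add: m_def power2_eq_square)
qed

text \<open>On a unit interval \<open>f\<close> oscillates by at most the L^1 norm of
  \<open>g\<close>, hence by at most its L^2 norm. Averaging the resulting bound for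
  \<open>f x\<close> over all \<open>y\<close> in the interval turns the value of \<open>f\<close>
  at \<open>y\<close> into an integral.\<close>

lemma sup_bound:
  assumes w: "is_weak_deriv (edge j) f g" and c: "continuous_on (edge j) f" and x: "x \<in> edge j"
  shows "(cmod (f x))\<^sup>2 \<le> 2 * (LINT y:edge j|lebesgue. (cmod (f y))\<^sup>2) + 2 * (LINT y:edge j|lebesgue. (cmod (g y))\<^sup>2)"
proof -
  \<comment> \<open>The unit interval extends away from the vertex, so that it stays inside the
    edge.\<close>
  obtain a where a: "a \<in> edge j" "a + 1 \<in> edge j" "x \<in> {a..a+1}"
  proof (cases "j = 1")
    case True then show ?thesis using x by (intro that[of "x - 1"]) (auto simp: edge_def)
  next
    case False then show ?thesis using x by (intro that[of x]) (auto simp: edge_def)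
  qed
  define J where "J = {a..a+1}"
  have J: "J \<subseteq> edge j" "J \<in> sets lebesgue" "x \<in> J" unfolding J_def using a edge_Icc(1)[OF a(1,2)] by auto
  have L: "f \<in> L2_on (edge j)" "g \<in> L2_on (edge j)" using w by (auto simp: is_weak_deriv_def)
  have g1: "set_integrable lebesgue J g" using L2_on_Icc_integrable[OF L(2)] J unfolding J_def by blast
  have f2: "set_integrable lebesgue J (\<lambda>y. (cmod (f y))\<^sup>2)" and g2: "set_integrable lebesgue J (\<lambda>y. (cmod (g y))\<^sup>2)"
    using L2_on_subset[OF L(1) J(2,1)] L2_on_subset[OF L(2) J(2,1)] by (auto dest: L2_onD)
  have const: "(LINT y:J|lebesgue. c) = c" "set_integrable lebesgue J (\<lambda>y. c)" for c :: real
    unfolding J_def by (auto simp: set_lebesgue_integral_def intro!: absolutely_integrable_continuous_real)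
  have pt: "(cmod (f x))\<^sup>2 \<le> 2 * (cmod (f y))\<^sup>2 + 2 * (LINT t:J|lebesgue. (cmod (g t))\<^sup>2)" if "y \<in> J" for y
  proof -
    have "cmod (f x - f y) \<le> (LINT t:J|lebesgue. cmod (g t))"
      unfolding J_def
    proof (rule FTC_oscillation)
      show "f d - f e = (LINT t:{e..d}|lebesgue. g t)" if "a \<le> e" "e \<le> d" "d \<le> a + 1" for d e
        using that J(1) by (intro is_weak_deriv_FTC[OF w c]) (auto simp: J_def)
    qed (use g1 J that in \<open>auto simp: J_def\<close>)
    then have "(cmod (f x - f y))\<^sup>2 \<le> (LINT t:J|lebesgue. cmod (g t))\<^sup>2" by (intro power_mono) auto
    also have "\<dots> \<le> (LINT t:J|lebesgue. (cmod (g t))\<^sup>2)"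
      unfolding J_def using g1 g2 by (intro unit_interval_Cauchy_Schwarz) (auto simp: J_def intro: set_integrable_norm)
    finally have "(cmod (f x - f y))\<^sup>2 \<le> (LINT t:J|lebesgue. (cmod (g t))\<^sup>2)" .
    moreover have "(cmod (f x))\<^sup>2 \<le> 2 * (cmod (f y))\<^sup>2 + 2 * (cmod (f x - f y))\<^sup>2"
      using cmod_add_sq[of "f y" "f x - f y"] by simp
    ultimately show ?thesis by simp
  qed
  have "(cmod (f x))\<^sup>2 = (LINT y:J|lebesgue. (cmod (f x))\<^sup>2)" by (simp add: const)
  also have "\<dots> \<le> (LINT y:J|lebesgue. 2 * (cmod (f y))\<^sup>2 + 2 * (LINT t:J|lebesgue. (cmod (g t))\<^sup>2))"
    by (intro set_integral_mono set_integral_add set_integrable_mult_right f2 const pt)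
  also have "\<dots> = 2 * (LINT y:J|lebesgue. (cmod (f y))\<^sup>2) + 2 * (LINT t:J|lebesgue. (cmod (g t))\<^sup>2)"
    using f2 const by (simp add: set_integral_add)
  also have "\<dots> \<le> 2 * (LINT y:edge j|lebesgue. (cmod (f y))\<^sup>2) + 2 * (LINT y:edge j|lebesgue. (cmod (g y))\<^sup>2)"
    using J L by (intro add_mono mult_left_mono set_integral_subset_mono) (auto dest: L2_onD)
  finally show ?thesis .
qed

text \<open>By the weak fundamental theorem \<open>f\<close> is a constant plus the ordinary
  integral of the continuous \<open>g\<close>, which can be differentiated classically, one-sidedly
  at the vertex.\<close>

lemma weak_deriv_classical:
  assumes w: "is_weak_deriv (edge j) f g" and c: "continuous_on (edge j) f" "continuous_on (edge j) g" and x: "x \<in> edge j"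
  shows "(f has_vector_derivative g x) (at x within edge j)"
proof -
  \<comment> \<open>The integral has to start at a finite point; \<open>{a..b}\<close> is chosen to
    coincide with the edge near \<open>x\<close>, so both give the same filter at
    \<open>x\<close>.\<close>
  obtain a b where ab: "a \<in> edge j" "b \<in> edge j" "x \<in> {a..b}" "edge j \<inter> {x-1<..<x+1} - {x} = {a..b} \<inter> {x-1<..<x+1} - {x}"
  proof (cases "j = 1")
    case True then show ?thesis using x by (intro that[of "x - 1" 0]) (auto simp: edge_def)
  next
    case False then show ?thesis using x by (intro that[of 0 "x + 1"]) (auto simp: edge_def)
  qed
  note sub = edge_Icc(1)[OF ab(1,2)]
  have cg: "continuous_on {a..b} g" by (rule continuous_on_subset[OF c(2) sub])
  have "((\<lambda>u. f a + integral {a..u} g) has_vector_derivative 0 + g x) (at x within {a..b})"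
    by (intro has_vector_derivative_add has_vector_derivative_const integral_has_vector_derivative cg ab)
  then have I: "((\<lambda>u. f a + integral {a..u} g) has_vector_derivative g x) (at x within {a..b})" by simp
  have "f u = f a + integral {a..u} g" if u: "u \<in> {a..b}" for u
  proof -
    have "f u - f a = (LINT t:{a..u}|lebesgue. g t)"
      using u sub ab by (intro is_weak_deriv_FTC[OF w c(1)]) auto
    also have "\<dots> = integral {a..u} g"
      by (intro set_lebesgue_integral_eq_integral absolutely_integrable_continuous_real continuous_on_subset[OF cg]) (use u in auto)
    finally show ?thesis by (simp add: algebra_simps)
  qed
  from has_vector_derivative_transform[OF ab(3) this I]
  have "(f has_vector_derivative g x) (at x within {a..b})" .
  moreover have "at x within edge j = at x within {a..b}"
    by (rule at_within_nhd[of _ "{x-1<..<x+1}"]) (use ab in auto)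
  ultimately show ?thesis by simp
qed

section \<open>Boundary terms and integration by parts on a half-line\<close>

definition far_unit :: "nat \<Rightarrow> nat \<Rightarrow> real set" where
  "far_unit j n = (if j = 1 then {-real n - 1..-real n} else {real n..real n + 1})"

text \<open>Dominated convergence with majorant the norm of \<open>u\<close>. It serves both for
  unit intervals escaping to infinity and for bounded pieces exhausting the edge.\<close>

lemma set_integral_eventually_tendsto:
  fixes u :: "real \<Rightarrow> 'b :: {banach, second_countable_topology}"
  assumes u: "set_integrable lebesgue I u" and A: "\<And>n. A n \<in> sets lebesgue" "\<And>n. A n \<subseteq> I" "B \<in> sets lebesgue" "B \<subseteq> I"
    and ev: "\<And>x. \<forall>\<^sub>F n in sequentially. x \<in> A n \<longleftrightarrow> x \<in> B"
  shows "(\<lambda>n. LINT x:A n|lebesgue. u x) \<longlonglongrightarrow> (LINT x:B|lebesgue. u x)"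
  unfolding set_lebesgue_integral_def
proof (rule integral_dominated_convergence)
  show "integrable lebesgue (\<lambda>x. norm (indicator I x *\<^sub>R u x))"
    by (rule integrable_norm[OF u[unfolded set_integrable_def]])
  have m: "(\<lambda>x. indicator C x *\<^sub>R u x) \<in> borel_measurable lebesgue" if "C \<in> sets lebesgue" "C \<subseteq> I" for C
    using set_integrable_subset[OF u that] by (auto simp: set_integrable_def)
  show "(\<lambda>x. indicator B x *\<^sub>R u x) \<in> borel_measurable lebesgue"
    "\<And>n. (\<lambda>x. indicator (A n) x *\<^sub>R u x) \<in> borel_measurable lebesgue"
    by (intro m A)+
  show "AE x in lebesgue. norm (indicator (A n) x *\<^sub>R u x) \<le> norm (indicator I x *\<^sub>R u x)" for n
    using A(2)[of n] by (auto simp: indicator_def)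
  have "(\<lambda>n. indicator (A n) x *\<^sub>R u x) \<longlonglongrightarrow> indicator B x *\<^sub>R u x" for x
    by (rule tendsto_eventually, rule eventually_mono[OF ev[of x]]) (simp add: indicator_def)
  then show "AE x in lebesgue. (\<lambda>n. indicator (A n) x *\<^sub>R u x) \<longlonglongrightarrow> indicator B x *\<^sub>R u x" by simp
qed

lemma eventually_nat_gt_abs: "\<forall>\<^sub>F n in sequentially. \<bar>x\<bar> + 2 < real n"
  using filterlim_real_sequentially by (simp add: filterlim_at_top_dense)

lemma far_unit_tendsto:
  fixes u :: "real \<Rightarrow> 'b :: {banach, second_countable_topology}"
  assumes "set_integrable lebesgue (edge j) u"
  shows "(\<lambda>n. LINT x:far_unit j n|lebesgue. u x) \<longlonglongrightarrow> 0"
proof -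
  have "\<forall>\<^sub>F n in sequentially. x \<in> far_unit j n \<longleftrightarrow> x \<in> {}" for x
    by (rule eventually_mono[OF eventually_nat_gt_abs[of x]]) (auto simp: far_unit_def)
  from set_integral_eventually_tendsto[OF assms _ _ _ _ this] show ?thesis
    by (auto simp: far_unit_def edge_def set_lebesgue_integral_def)
qed

lemma edge_integral_tendsto:
  fixes u :: "real \<Rightarrow> 'b :: {banach, second_countable_topology}"
  assumes "set_integrable lebesgue (edge j) u"
  shows "(\<lambda>n. LINT x:edge j \<inter> {-real n..real n}|lebesgue. u x) \<longlonglongrightarrow> (LINT x:edge j|lebesgue. u x)"
proof (rule set_integral_eventually_tendsto[OF assms])
  show "\<forall>\<^sub>F n in sequentially. x \<in> edge j \<inter> {-real n..real n} \<longleftrightarrow> x \<in> edge j" for x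
    by (rule eventually_mono[OF eventually_nat_gt_abs[of x]]) auto
qed auto

text \<open>No decay of \<open>F\<close> is assumed: it follows from the integrability of \<open>F\<close> and of its derivative, by
  averaging over the unit intervals \<open>far_unit j n\<close>.\<close>

lemma boundary_term:
  fixes F K :: "real \<Rightarrow> complex"
  assumes FTC: "\<And>a b. a \<in> edge j \<Longrightarrow> b \<in> edge j \<Longrightarrow> a \<le> b \<Longrightarrow> F b - F a = (LINT t:{a..b}|lebesgue. K t)"
    and F: "set_integrable lebesgue (edge j) F" and K: "set_integrable lebesgue (edge j) K"
  shows "(LINT t:edge j|lebesgue. K t) = (if j = 1 then F 0 else - F 0)"
proof -
  \<comment> \<open>The sign points away from the vertex, so that \<open>p n\<close> is the end
    point of \<open>far_unit j n\<close> nearest to the vertex and runs off to infinity.\<close>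
  define s :: real where "s = (if j = 1 then -1 else 1)"
  define p where "p n = s * real n" for n
  have J: "far_unit j n = {min (p n) (p n + s)..min (p n) (p n + s) + 1}" "far_unit j n \<subseteq> edge j" "p n \<in> far_unit j n" for n
    by (auto simp: far_unit_def p_def s_def edge_def)
  have lim: "(\<lambda>n. F (p n)) \<longlonglongrightarrow> 0"
  proof -
    \<comment> \<open>On an interval of length 1 a value differs from the mean by at most the
      oscillation, which is bounded by the integral of the norm of \<open>K\<close>. Both this bound
      and the mean tend to 0.\<close>
    have "cmod (F (p n) - (LINT x:far_unit j n|lebesgue. F x)) \<le> (LINT x:far_unit j n|lebesgue. cmod (K x))" for n
    proof -
      define a where "a = min (p n) (p n + s)"
      have Ja: "far_unit j n = {a..a+1}" using J(1) by (simp add: a_def)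
      have ae: "{a..a+1} \<subseteq> edge j" "p n \<in> {a..a+1}" using J(2,3) Ja by auto
      have Ki: "set_integrable lebesgue {a..a+1} K" "set_integrable lebesgue {a..a+1} F"
        by (rule set_integrable_subset[OF K] set_integrable_subset[OF F]; use ae in auto)+
      define m where "m = (LINT x:{a..a+1}|lebesgue. cmod (K x))"
      have osc: "cmod (F (p n) - F x) \<le> m" if "x \<in> {a..a+1}" for x
        unfolding m_def by (rule FTC_oscillation[OF _ Ki(1) ae(2) that]) (use ae(1) in \<open>auto intro!: FTC\<close>)
      have c: "set_integrable lebesgue {a..a+1} (\<lambda>_. c)" for c :: complex
        by (intro absolutely_integrable_continuous_real continuous_intros)
      have c': "set_integrable lebesgue {a..a+1} (\<lambda>_. c)" for c :: real
        by (intro absolutely_integrable_continuous_real continuous_intros)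
      have "F (p n) - (LINT x:{a..a+1}|lebesgue. F x) = (LINT x:{a..a+1}|lebesgue. F (p n) - F x)"
        using set_integral_diff(2)[OF c Ki(2), of "F (p n)"] by (simp add: set_lebesgue_integral_def)
      also have "cmod \<dots> \<le> (LINT x:{a..a+1}|lebesgue. cmod (F (p n) - F x))"
        by (intro set_integral_norm_bound set_integral_diff c Ki)
      also have "\<dots> \<le> (LINT x:{a..a+1}|lebesgue. m)"
        by (intro set_integral_mono set_integrable_norm set_integral_diff c Ki c' osc)
      also have "\<dots> = m" by (simp add: set_lebesgue_integral_def)
      finally show ?thesis unfolding Ja m_def .
    qed
    moreover have "(\<lambda>n. LINT x:far_unit j n|lebesgue. cmod (K x)) \<longlonglongrightarrow> 0"
      by (rule far_unit_tendsto[OF set_integrable_norm[OF K]])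
    ultimately have "(\<lambda>n. F (p n) - (LINT x:far_unit j n|lebesgue. F x)) \<longlonglongrightarrow> 0"
      by (rule Lim_null_comparison[OF always_eventually[OF allI]])
    from tendsto_add[OF this far_unit_tendsto[OF F]] show ?thesis by simp
  qed
  \<comment> \<open>The vertex is the upper end of edge 1 and the lower end of every other edge,
    whence the opposite signs.\<close>
  have IK: "(LINT x:edge j \<inter> {-real n..real n}|lebesgue. K x) = (if j = 1 then F 0 - F (p n) else F (p n) - F 0)" for n
  proof (cases "j = 1")
    case True
    then have "edge j \<inter> {-real n..real n} = {p n..0}" by (auto simp: edge_def p_def s_def)
    then show ?thesis using True FTC[of "p n" 0] by (simp add: edge_def p_def s_def)
  next
    case False
    then have "edge j \<inter> {-real n..real n} = {0..p n}" by (auto simp: edge_def p_def s_def)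
    then show ?thesis using False FTC[of 0 "p n"] by (simp add: edge_def p_def s_def)
  qed
  have "(\<lambda>n. LINT x:edge j \<inter> {-real n..real n}|lebesgue. K x) \<longlonglongrightarrow> (if j = 1 then F 0 - 0 else 0 - F 0)"
    using tendsto_diff[OF tendsto_const lim] tendsto_diff[OF lim tendsto_const] unfolding IK by (cases "j = 1") (simp_all only: simp_thms if_True if_False)
  from LIMSEQ_unique[OF edge_integral_tendsto[OF K] this] show ?thesis by auto
qed

text \<open>Since \<open>\<phi>\<close> vanishes off a compact subset of the interior, the product
  is C^1 on the whole line whatever \<open>r\<close> is outside the edge. Having C^1 test functions
  pays off here: \<open>r\<close> is only C^1, and the product is still admissible.\<close>

lemma test_function_mult:
  assumes \<phi>: "\<phi> \<in> test_functions (edge j)" and r: "\<And>x. x \<in> edge j \<Longrightarrow> (r has_real_derivative r' x) (at x within edge j)"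
    and r': "continuous_on (edge j) r'"
  shows "(\<lambda>x. \<phi> x * r x) \<in> test_functions (edge j)"
    and "x \<in> edge j \<Longrightarrow> deriv (\<lambda>x. \<phi> x * r x) x = deriv \<phi> x * r x + \<phi> x * r' x"
proof -
  obtain K where K: "compact K" "K \<subseteq> interior (edge j)" "\<And>x. x \<notin> K \<Longrightarrow> \<phi> x = 0"
    and out: "\<And>x. x \<notin> K \<Longrightarrow> deriv \<phi> x = 0"
    by (rule test_function_support[OF \<phi>], rule that)
  define D where "D x = deriv \<phi> x * r x + \<phi> x * r' x" for x
  have oK: "open (-K)" using compact_imp_closed[OF K(1)] by (simp add: open_Compl)
  have der: "((\<lambda>x. \<phi> x * r x) has_real_derivative D x) (at x)" for x
  proof (cases "x \<in> K")
    case True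
    then have i: "x \<in> interior (edge j)" using K by blast
    from r[OF subsetD[OF interior_subset i]] have "(r has_real_derivative r' x) (at x)" by (simp only: at_within_interior[OF i])
    from DERIV_mult[OF test_function_facts(3)[OF \<phi>] this] show ?thesis by (simp add: D_def algebra_simps)
  next
    case False
    have "((\<lambda>_. 0) has_real_derivative 0) (at x)" by simp
    then have "((\<lambda>x. \<phi> x * r x) has_real_derivative 0) (at x)"
      by (rule has_field_derivative_transform_within_open[of _ _ _ "- K"]) (use False K oK in auto)
    moreover have "D x = 0" using False out K by (simp add: D_def)
    ultimately show ?thesis by simp
  qed
  have cr: "continuous_on (edge j) r" by (rule DERIV_continuous_on[OF r])
  have "continuous_on UNIV D"
  proof -
    have "continuous_on (interior (edge j)) D" unfolding D_def
      by (intro continuous_intros test_function_facts[OF \<phi>] continuous_on_subset[OF cr] continuous_on_subset[OF r'] interior_subset)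
    moreover have "continuous_on (-K) D"
      by (rule continuous_on_eq[of _ "\<lambda>_. 0"]) (use out K in \<open>auto simp: D_def\<close>)
    ultimately have "continuous_on (interior (edge j) \<union> - K) D" by (rule continuous_on_open_Un[OF open_interior oK])
    moreover have "interior (edge j) \<union> - K = UNIV" using K(2) by blast
    ultimately show ?thesis by (simp only:)
  qed
  then show "(\<lambda>x. \<phi> x * r x) \<in> test_functions (edge j)"
    unfolding test_functions_def C1_differentiable_on_def using der K
    by (auto simp: has_real_derivative_iff_has_vector_derivative intro!: exI[of _ D] exI[of _ K])
  show "deriv (\<lambda>x. \<phi> x * r x) x = deriv \<phi> x * r x + \<phi> x * r' x"
    using DERIV_imp_deriv[OF der] by (simp add: D_def)
qed

lemma set_integrable_mult_bounded:
  fixes F :: "real \<Rightarrow> complex"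
  assumes F: "set_integrable lebesgue I F" and h: "continuous_on UNIV h" "\<And>x. \<bar>h x\<bar> \<le> C"
  shows "set_integrable lebesgue I (\<lambda>x. F x * complex_of_real (h x))"
proof (rule set_integrable_bound)
  show "set_integrable lebesgue I (\<lambda>x. complex_of_real C * F x)" using F by simp
  have "(\<lambda>x. complex_of_real (h x)) \<in> borel_measurable lebesgue"
    by (intro measurable_completion) (auto intro!: borel_measurable_continuous_onI continuous_intros h)
  from borel_measurable_times[OF borel_measurable_integrable[OF F[unfolded set_integrable_def]] this]
  show "set_borel_measurable lebesgue I (\<lambda>x. F x * complex_of_real (h x))"
    by (simp add: set_borel_measurable_def)
  have "\<bar>h x\<bar> \<le> \<bar>C\<bar>" for x using h(2)[of x] by simp
  then have "cmod (F x) * \<bar>h x\<bar> \<le> \<bar>C\<bar> * cmod (F x)" for x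
    by (subst mult.commute) (intro mult_right_mono, auto)
  then show "AE x in lebesgue. x \<in> I \<longrightarrow> norm (F x * complex_of_real (h x)) \<le> norm (complex_of_real C * F x)"
    by (simp add: norm_mult)
qed

text \<open>The product rule for \<open>du * cnj u\<close> is obtained weakly, by moving the C^1
  factor \<open>cnj u\<close> into the test function. Then \<open>boundary_term\<close> disposes of
  infinity.\<close>

lemma integration_by_parts:
  assumes u: "u \<in> L2_on (edge j)" "du \<in> L2_on (edge j)" "continuous_on (edge j) du"
    and der: "\<And>x. x \<in> edge j \<Longrightarrow> (u has_vector_derivative du x) (at x within edge j)"
    and w: "is_weak_deriv (edge j) du h"
  shows "(LINT x:edge j|lebesgue. h x * cnj (u x)) =
      (if j = 1 then du 0 * cnj (u 0) else - (du 0 * cnj (u 0))) - (LINT x:edge j|lebesgue. du x * cnj (du x))"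
proof -
  let ?F = "\<lambda>x. du x * cnj (u x)" and ?K = "\<lambda>x. h x * cnj (u x) + du x * cnj (du x)"
  have h: "h \<in> L2_on (edge j)" using w by (simp add: is_weak_deriv_def)
  have Fi: "set_integrable lebesgue (edge j) ?F" by (intro L2_on_mult L2_on_cnj u)
  have K1: "set_integrable lebesgue (edge j) (\<lambda>x. h x * cnj (u x))"
    and K2: "set_integrable lebesgue (edge j) (\<lambda>x. du x * cnj (du x))" by (intro L2_on_mult L2_on_cnj u h)+
  have Ki: "set_integrable lebesgue (edge j) ?K" by (intro set_integral_add K1 K2)
  have cu: "continuous_on (edge j) u" using der by (rule continuous_on_vector_derivative)
  have FTC: "?F b - ?F a = (LINT t:{a..b}|lebesgue. ?K t)" if ab: "a \<in> edge j" "b \<in> edge j" "a \<le> b" for a b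
  proof (rule weak_FTC_edge[OF ab])
    show "continuous_on (edge j) ?F" by (intro continuous_intros u cu)
    show "set_integrable lebesgue {a..b} ?K"
      by (rule set_integrable_subset[OF Ki _ edge_Icc(1)[OF ab(1,2)]]) auto
    fix \<phi> assume t: "\<phi> \<in> test_functions (edge j)"
    obtain C where C: "\<And>x. \<bar>\<phi> x\<bar> \<le> C" "\<And>x. \<bar>deriv \<phi> x\<bar> \<le> C" using test_function_facts(6)[OF t] by blast
    note mb = set_integrable_mult_bounded[OF _ test_function_facts(1)[OF t] C(1)]
    note mb' = set_integrable_mult_bounded[OF _ test_function_facts(2)[OF t] C(2)]
    \<comment> \<open>Test functions are real valued, so \<open>\<phi> x * cnj (u x)\<close> is
      split as \<open>p x - \<i> * q x\<close> and the weak identity is used for each part.\<close>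
    define p where "p x = \<phi> x * Re (u x)" for x
    define q where "q x = \<phi> x * Im (u x)" for x
    have dR: "((\<lambda>x. Re (u x)) has_real_derivative Re (du x)) (at x within edge j)"
     and dI: "((\<lambda>x. Im (u x)) has_real_derivative Im (du x)) (at x within edge j)" if "x \<in> edge j" for x
      using der[OF that] by (auto simp: has_vector_derivative_complex_iff has_real_derivative_iff_has_vector_derivative)
    have cR: "continuous_on (edge j) (\<lambda>x. Re (du x))" "continuous_on (edge j) (\<lambda>x. Im (du x))"
      by (intro continuous_intros u)+
    note P = test_function_mult[OF t dR cR(1), folded p_def] and Q = test_function_mult[OF t dI cR(2), folded q_def]
    note tp = test_function_facts[OF P(1)] and tq = test_function_facts[OF Q(1)]
    have comb: "(LINT x:edge j|lebesgue. g x * (complex_of_real (a x) - \<i> * complex_of_real (b x))) =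
      (LINT x:edge j|lebesgue. g x * complex_of_real (a x)) - \<i> * (LINT x:edge j|lebesgue. g x * complex_of_real (b x))"
      if "g \<in> L2_on (edge j)" "(\<lambda>x. complex_of_real (a x)) \<in> L2_on (edge j)" "(\<lambda>x. complex_of_real (b x)) \<in> L2_on (edge j)" for g a b
      using set_integral_diff(2)[OF L2_on_mult[OF that(1,2)] L2_on_mult[OF that(1) L2_on_scale[OF that(3), of \<i>]]]
      by (simp add: right_diff_distrib mult.left_commute)
    have "(LINT x:edge j|lebesgue. du x * (complex_of_real (deriv p x) - \<i> * complex_of_real (deriv q x))) =
       - (LINT x:edge j|lebesgue. h x * (complex_of_real (p x) - \<i> * complex_of_real (q x)))"
      using w P(1) Q(1) by (simp add: comb u h tp tq is_weak_deriv_def)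
    moreover have "(LINT x:edge j|lebesgue. h x * (complex_of_real (p x) - \<i> * complex_of_real (q x))) =
       (LINT x:edge j|lebesgue. h x * cnj (u x) * complex_of_real (\<phi> x))"
      by (intro set_lebesgue_integral_cong) (auto simp: p_def q_def complex_eq_iff algebra_simps)
    moreover have "(LINT x:edge j|lebesgue. du x * (complex_of_real (deriv p x) - \<i> * complex_of_real (deriv q x))) =
       (LINT x:edge j|lebesgue. ?F x * complex_of_real (deriv \<phi> x) + du x * cnj (du x) * complex_of_real (\<phi> x))"
      by (intro set_lebesgue_integral_cong) (auto simp: P(2) Q(2) complex_eq_iff algebra_simps)
    moreover have "(LINT x:edge j|lebesgue. ?F x * complex_of_real (deriv \<phi> x) + du x * cnj (du x) * complex_of_real (\<phi> x)) =
        (LINT x:edge j|lebesgue. ?F x * complex_of_real (deriv \<phi> x)) + (LINT x:edge j|lebesgue. du x * cnj (du x) * complex_of_real (\<phi> x))"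
      by (rule set_integral_add(2)[OF mb'[OF Fi] mb[OF K2]])
    moreover have "(LINT x:edge j|lebesgue. ?K x * complex_of_real (\<phi> x)) = (LINT x:edge j|lebesgue. h x * cnj (u x) * complex_of_real (\<phi> x)) + (LINT x:edge j|lebesgue. du x * cnj (du x) * complex_of_real (\<phi> x))"
      using set_integral_add(2)[OF mb[OF K1] mb[OF K2]] by (simp add: distrib_right)
    ultimately show "(LINT x:edge j|lebesgue. ?F x * complex_of_real (deriv \<phi> x)) = - (LINT x:edge j|lebesgue. ?K x * complex_of_real (\<phi> x))"
      by (simp add: algebra_simps eq_neg_iff_add_eq_0)
  qed
  have "(LINT t:edge j|lebesgue. ?K t) = (if j = 1 then ?F 0 else - ?F 0)"
    by (rule boundary_term[OF FTC Fi Ki])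
  then show ?thesis using set_integral_add(2)[OF K1 K2] by (auto simp: algebra_simps split: if_splits)
qed

section \<open>Energy spaces on the star graph\<close>

lemma weak_deriv_spec:
  assumes "f \<in> H1_on I" shows "is_weak_deriv I f (weak_deriv I f)"
  using assms unfolding H1_on_def weak_deriv_def by (auto intro: someI[of "is_weak_deriv I f"])

definition edge_sq :: "nat \<Rightarrow> (real \<Rightarrow> complex) \<Rightarrow> real" where
  "edge_sq j f = (LINT x:edge j|lebesgue. (cmod (f x))\<^sup>2)"

lemma edge_sq_nonneg: "0 \<le> edge_sq j f"
  unfolding edge_sq_def set_lebesgue_integral_def by (intro integral_nonneg_AE) auto

lemma edge_sq_cong_AE:
  assumes "f \<in> L2_on (edge j)" "g \<in> L2_on (edge j)" "AE x in lebesgue. x \<in> edge j \<longrightarrow> f x = g x"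
  shows "edge_sq j f = edge_sq j g"
  unfolding edge_sq_def set_lebesgue_integral_def
  using borel_measurable_integrable[OF L2_onD(2)[OF assms(1), unfolded set_integrable_def]]
    borel_measurable_integrable[OF L2_onD(2)[OF assms(2), unfolded set_integrable_def]]
  by (intro integral_cong_AE) (use assms(3) in \<open>auto simp: indicator_def\<close>)

lemma edge_sq_scale: "edge_sq j (\<lambda>x. c * f x) = (cmod c)\<^sup>2 * edge_sq j f"
  by (simp add: edge_sq_def norm_mult power_mult_distrib)

lemma edge_sq_mono:
  assumes "f \<in> L2_on (edge j)" "g \<in> L2_on (edge j)" "\<And>x. x \<in> edge j \<Longrightarrow> cmod (f x) \<le> cmod (g x)"
  shows "edge_sq j f \<le> edge_sq j g"
  unfolding edge_sq_def by (intro set_integral_mono power_mono assms L2_onD) auto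

text \<open>The factors 2 stand in for Minkowski's inequality: the later estimates need only
  boundedness or convergence to 0, so constants are immaterial.\<close>

lemma edge_sq_add:
  assumes "f \<in> L2_on (edge j)" "g \<in> L2_on (edge j)"
  shows "edge_sq j (\<lambda>x. f x + g x) \<le> 2 * edge_sq j f + 2 * edge_sq j g"
proof -
  have "edge_sq j (\<lambda>x. f x + g x) \<le> (LINT x:edge j|lebesgue. 2 * (cmod (f x))\<^sup>2 + 2 * (cmod (g x))\<^sup>2)"
    unfolding edge_sq_def using assms
    by (intro set_integral_mono cmod_add_sq L2_onD L2_on_add set_integral_add set_integrable_mult_right) auto
  also have "\<dots> = 2 * edge_sq j f + 2 * edge_sq j g"
    using L2_onD(2)[OF assms(1)] L2_onD(2)[OF assms(2)] by (simp add: edge_sq_def set_integral_add)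
  finally show ?thesis .
qed

section \<open>The L^2 pairing on the graph\<close>

definition L2_star :: "nat \<Rightarrow> star_fun set" where
  "L2_star N = {G. \<forall>j\<in>{1..N}. G j \<in> L2_on (edge j)}"

definition L2_sq :: "nat \<Rightarrow> star_fun \<Rightarrow> real" where
  "L2_sq N G = (\<Sum>j=1..N. edge_sq j (G j))"

lemma L2_sq_nonneg: "0 \<le> L2_sq N G"
  by (simp add: L2_sq_def sum_nonneg edge_sq_nonneg)

lemma L2_star_lincomb:
  assumes "U \<in> L2_star N" "W \<in> L2_star N" shows "(\<lambda>j x. a * U j x + b * W j x) \<in> L2_star N"
  using assms by (auto simp: L2_star_def intro!: L2_on_add L2_on_scale)

lemma L2_inner_lincomb_left:
  assumes "U \<in> L2_star N" "V \<in> L2_star N" "W \<in> L2_star N"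
  shows "L2_inner N (\<lambda>j x. a * U j x + b * V j x) W = a * L2_inner N U W + b * L2_inner N V W"
proof -
  have "(LINT x:edge j|lebesgue. (a * U j x + b * V j x) * cnj (W j x)) =
    a * (LINT x:edge j|lebesgue. U j x * cnj (W j x)) + b * (LINT x:edge j|lebesgue. V j x * cnj (W j x))"
    if "j \<in> {1..N}" for j
  proof -
    have L: "U j \<in> L2_on (edge j)" "V j \<in> L2_on (edge j)" "(\<lambda>x. cnj (W j x)) \<in> L2_on (edge j)"
      using assms that by (auto simp: L2_star_def intro!: L2_on_cnj)
    show ?thesis
      using set_integral_add(2)[OF L2_on_mult[OF L2_on_scale[OF L(1), of a] L(3)] L2_on_mult[OF L2_on_scale[OF L(2), of b] L(3)]]
      by (simp add: distrib_right mult.assoc)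
  qed
  then show ?thesis by (simp add: L2_inner_def sum.distrib sum_distrib_left)
qed

lemma L2_inner_cnj: "cnj (L2_inner N U W) = L2_inner N W U"
proof -
  have "cnj (LINT x:edge j|lebesgue. U j x * cnj (W j x)) = (LINT x:edge j|lebesgue. W j x * cnj (U j x))" for j
    unfolding set_lebesgue_integral_def by (subst Bochner_Integration.integral_cnj[symmetric]) (simp add: mult.commute)
  then show ?thesis by (simp add: L2_inner_def)
qed

lemma L2_inner_lincomb_right:
  assumes "U \<in> L2_star N" "V \<in> L2_star N" "W \<in> L2_star N"
  shows "L2_inner N W (\<lambda>j x. a * U j x + b * V j x) = cnj a * L2_inner N W U + cnj b * L2_inner N W V"
  using arg_cong[OF L2_inner_lincomb_left[OF assms, of a b], of cnj]
  by (simp only: L2_inner_cnj complex_cnj_add complex_cnj_mult)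

lemma L2_inner_self: "L2_inner N W W = complex_of_real (L2_sq N W)"
proof -
  have "(LINT x:edge j|lebesgue. W j x * cnj (W j x)) = complex_of_real (edge_sq j (W j))" for j
    unfolding edge_sq_def set_integral_complex_of_real[symmetric]
    by (intro set_lebesgue_integral_cong) (auto simp: complex_norm_square[symmetric] simp del: of_real_power)
  then show ?thesis by (simp add: L2_inner_def L2_sq_def)
qed

text \<open>Optimises a weighted arithmetic-geometric mean bound. If \<open>A\<close> or
  \<open>B\<close> is zero there is no optimal weight, and the infimum is approached by very large
  or very small weights.\<close>

lemma le_sqrt_mult_of_weighted:
  fixes X A B :: real
  assumes "0 \<le> A" "0 \<le> B" and le: "\<And>l. 0 < l \<Longrightarrow> 2 * X \<le> l * A + B / l"
  shows "X \<le> sqrt A * sqrt B"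
proof (cases "A = 0 \<or> B = 0")
  case True
  have "2 * X \<le> 0 + e" if e: "0 < e" for e
  proof (cases "A = 0")
    case True
    \<comment> \<open>A large weight makes the remaining term at most \<open>e\<close>;
      \<open>B + 1\<close> in place of \<open>B\<close> keeps it positive when
      \<open>B = 0\<close>.\<close>
    have "2 * X \<le> B / ((B + 1) / e)" using le[of "(B + 1) / e"] True assms e by simp
    also have "\<dots> \<le> e" using assms e by (simp add: field_simps)
    finally show ?thesis by simp
  next
    case False
    then have B: "B = 0" using \<open>A = 0 \<or> B = 0\<close> by simp
    have "2 * X \<le> (e / (A + 1)) * A" using le[of "e / (A + 1)"] B assms e by simp
    also have "\<dots> \<le> e" using assms e by (simp add: field_simps)
    finally show ?thesis by simp
  qed
  then have "2 * X \<le> 0" by (rule field_le_epsilon)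
  then show ?thesis using True by auto
next
  case False
  then have AB: "A > 0" "B > 0" using assms by auto
  define a b where "a = sqrt A" and "b = sqrt B"
  have ab: "a > 0" "b > 0" "A = a * a" "B = b * b" using AB by (auto simp: a_def b_def)
  \<comment> \<open>The weight \<open>b / a\<close> minimises the right-hand side.\<close>
  have "2 * X \<le> b / a * A + B / (b / a)" using ab by (intro le) auto
  also have "\<dots> = 2 * (a * b)" using ab(1,2) unfolding ab(3,4) by simp
  finally show ?thesis by (simp add: a_def b_def)
qed

text \<open>The pointwise bound is integrated and summed over the edges with the same weight
  \<open>l\<close>, and \<open>l\<close> is optimised only at the end. This treats integral and sum
  at once.\<close>

lemma L2_Cauchy_Schwarz:
  assumes "U \<in> L2_star N" "W \<in> L2_star N"
  shows "cmod (L2_inner N U W) \<le> sqrt (L2_sq N U) * sqrt (L2_sq N W)"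
proof (rule le_sqrt_mult_of_weighted[OF L2_sq_nonneg L2_sq_nonneg])
  fix l :: real assume l: "0 < l"
  have "2 * cmod (LINT x:edge j|lebesgue. U j x * cnj (W j x)) \<le> l * edge_sq j (U j) + edge_sq j (W j) / l"
    if "j \<in> {1..N}" for j
  proof -
    have L: "U j \<in> L2_on (edge j)" "W j \<in> L2_on (edge j)" using assms that by (auto simp: L2_star_def)
    have i: "set_integrable lebesgue (edge j) (\<lambda>x. U j x * cnj (W j x))" by (intro L2_on_mult L2_on_cnj L)
    have i2: "set_integrable lebesgue (edge j) (\<lambda>x. l * (cmod (U j x))\<^sup>2 + (cmod (W j x))\<^sup>2 / l)"
      using L by (intro set_integral_add) (auto dest: L2_onD)
    have pt: "2 * cmod (U j x * cnj (W j x)) \<le> l * (cmod (U j x))\<^sup>2 + (cmod (W j x))\<^sup>2 / l" for x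
    proof -
      have "0 \<le> (l * cmod (U j x) - cmod (W j x))\<^sup>2 / l" using l by simp
      also have "\<dots> = l * (cmod (U j x))\<^sup>2 + (cmod (W j x))\<^sup>2 / l - 2 * (cmod (U j x) * cmod (W j x))"
        using l by (simp add: power2_eq_square field_simps)
      finally show ?thesis by (simp add: norm_mult)
    qed
    have "2 * cmod (LINT x:edge j|lebesgue. U j x * cnj (W j x)) \<le> 2 * (LINT x:edge j|lebesgue. cmod (U j x * cnj (W j x)))"
      using set_integral_norm_bound[OF i] by simp
    also have "\<dots> = (LINT x:edge j|lebesgue. 2 * cmod (U j x * cnj (W j x)))" by simp
    also have "\<dots> \<le> (LINT x:edge j|lebesgue. l * (cmod (U j x))\<^sup>2 + (cmod (W j x))\<^sup>2 / l)"
      by (intro set_integral_mono set_integrable_mult_right set_integrable_norm i i2 pt)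
    also have "\<dots> = l * edge_sq j (U j) + edge_sq j (W j) / l"
      using L by (subst set_integral_add(2)) (auto simp: edge_sq_def dest: L2_onD)
    finally show ?thesis .
  qed
  then have "(\<Sum>j=1..N. 2 * cmod (LINT x:edge j|lebesgue. U j x * cnj (W j x))) \<le> (\<Sum>j=1..N. l * edge_sq j (U j) + edge_sq j (W j) / l)"
    by (rule sum_mono)
  moreover have "2 * cmod (L2_inner N U W) \<le> (\<Sum>j=1..N. 2 * cmod (LINT x:edge j|lebesgue. U j x * cnj (W j x)))"
    unfolding L2_inner_def sum_distrib_left[symmetric] by (intro mult_left_mono norm_sum) simp
  ultimately show "2 * cmod (L2_inner N U W) \<le> l * L2_sq N U + L2_sq N W / l"
    by (simp add: L2_sq_def sum.distrib sum_distrib_left sum_divide_distrib)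
qed

text \<open>By a.e. uniqueness any weak derivative computes the norm, not only the chosen
  one.\<close>

lemma H1_norm_eq:
  assumes "\<And>j. j \<in> {1..N} \<Longrightarrow> is_weak_deriv (edge j) (\<Psi> j) (g j)"
  shows "H1_norm N \<Psi> = sqrt (\<Sum>j=1..N. edge_sq j (\<Psi> j) + edge_sq j (g j))"
proof -
  have "edge_sq j (weak_deriv (edge j) (\<Psi> j)) = edge_sq j (g j)" if j: "j \<in> {1..N}" for j
  proof -
    have w: "is_weak_deriv (edge j) (\<Psi> j) (weak_deriv (edge j) (\<Psi> j))"
      unfolding weak_deriv_def by (rule someI[of "is_weak_deriv (edge j) (\<Psi> j)", OF assms[OF j]])
    show ?thesis
      using is_weak_deriv_AE_unique[OF w assms[OF j]] w assms[OF j]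
      by (intro edge_sq_cong_AE) (auto simp: is_weak_deriv_def)
  qed
  then show ?thesis unfolding H1_norm_def by (simp flip: edge_sq_def)
qed

lemma H1_GammaD:
  assumes "\<Psi> \<in> H1_Gamma N \<alpha>" "j \<in> {1..N}"
  shows "is_weak_deriv (edge j) (\<Psi> j) (weak_deriv (edge j) (\<Psi> j))" "continuous_on (edge j) (\<Psi> j)"
    "\<Psi> j \<in> L2_on (edge j)" "weak_deriv (edge j) (\<Psi> j) \<in> L2_on (edge j)"
proof -
  have H: "\<Psi> j \<in> H1_on (edge j)" using assms by (auto simp: H1_Gamma_def)
  then show w: "is_weak_deriv (edge j) (\<Psi> j) (weak_deriv (edge j) (\<Psi> j))" by (rule weak_deriv_spec)
  then show "\<Psi> j \<in> L2_on (edge j)" "weak_deriv (edge j) (\<Psi> j) \<in> L2_on (edge j)"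
    by (auto simp: is_weak_deriv_def)
  show "continuous_on (edge j) (\<Psi> j)" using H by (simp add: H1_on_def)
qed

lemma H1_norm_sq:
  "(H1_norm N \<Psi>)\<^sup>2 = (\<Sum>j=1..N. edge_sq j (\<Psi> j) + edge_sq j (weak_deriv (edge j) (\<Psi> j)))"
  unfolding H1_norm_def by (subst real_sqrt_pow2) (auto simp: edge_sq_def[symmetric] intro!: sum_nonneg add_nonneg_nonneg edge_sq_nonneg)

lemma H1_norm_nonneg: "0 \<le> H1_norm N \<Psi>"
  unfolding H1_norm_def by (auto simp: edge_sq_def[symmetric] intro!: sum_nonneg add_nonneg_nonneg edge_sq_nonneg)

lemma L2_sq_le_H1: "L2_sq N \<Psi> \<le> (H1_norm N \<Psi>)\<^sup>2"
  unfolding L2_sq_def H1_norm_sq by (intro sum_mono) (simp add: edge_sq_nonneg)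

lemma H1_Gamma_lincomb:
  assumes "U \<in> H1_Gamma N \<alpha>" "W \<in> H1_Gamma N \<alpha>"
  shows "(\<lambda>j x. a * U j x + b * W j x) \<in> H1_Gamma N \<alpha>"
  unfolding H1_Gamma_def
proof (intro CollectI conjI ballI)
  show "(\<lambda>j x. a * U j x + b * W j x) \<in> star_functions N"
    using assms by (auto simp: H1_Gamma_def star_functions_def)
  show "(\<lambda>x. a * U j x + b * W j x) \<in> H1_on (edge j)" if "j \<in> {1..N}" for j
    using assms that by (intro H1_on_lincomb) (auto simp: H1_Gamma_def)
  fix j assume j: "j \<in> {1..N}"
  have "complex_of_real (\<alpha> j) * (a * U j 0 + b * W j 0) = a * (complex_of_real (\<alpha> j) * U j 0) + b * (complex_of_real (\<alpha> j) * W j 0)"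
    by (simp add: algebra_simps)
  also have "\<dots> = a * (complex_of_real (\<alpha> 1) * U 1 0) + b * (complex_of_real (\<alpha> 1) * W 1 0)"
  proof -
    have "complex_of_real (\<alpha> j) * V j 0 = complex_of_real (\<alpha> 1) * V 1 0" if "V \<in> H1_Gamma N \<alpha>" for V
      using that j unfolding H1_Gamma_def by blast
    from this[OF assms(1)] this[OF assms(2)] show ?thesis by (simp only:)
  qed
  finally show "complex_of_real (\<alpha> j) * (a * U j 0 + b * W j 0) = complex_of_real (\<alpha> 1) * (a * U 1 0 + b * W 1 0)"
    by (simp add: algebra_simps)
qed

lemma H1_Gamma_diff:
  assumes "A \<in> H1_Gamma N \<alpha>" "B \<in> H1_Gamma N \<alpha>"
  shows "(\<lambda>j x. A j x - B j x) \<in> H1_Gamma N \<alpha>"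
  using H1_Gamma_lincomb[OF assms, of 1 "-1"] by simp

lemma H1_Gamma_L2_star: "\<Psi> \<in> H1_Gamma N \<alpha> \<Longrightarrow> \<Psi> \<in> L2_star N"
  by (simp add: L2_star_def H1_GammaD)

lemma H1_norm_lincomb:
  assumes "U \<in> H1_Gamma N \<alpha>" "W \<in> H1_Gamma N \<alpha>"
  shows "(H1_norm N (\<lambda>j x. a * U j x + b * W j x))\<^sup>2 \<le> 2 * (cmod a * H1_norm N U)\<^sup>2 + 2 * (cmod b * H1_norm N W)\<^sup>2"
proof -
  let ?u = "\<lambda>j. weak_deriv (edge j) (U j)" and ?w = "\<lambda>j. weak_deriv (edge j) (W j)"
  have w: "is_weak_deriv (edge j) (\<lambda>x. a * U j x + b * W j x) (\<lambda>x. a * ?u j x + b * ?w j x)" if "j \<in> {1..N}" for j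
    by (rule is_weak_deriv_lincomb[OF H1_GammaD(1)[OF assms(1) that] H1_GammaD(1)[OF assms(2) that]])
  have "(H1_norm N (\<lambda>j x. a * U j x + b * W j x))\<^sup>2 =
     (\<Sum>j=1..N. edge_sq j (\<lambda>x. a * U j x + b * W j x) + edge_sq j (\<lambda>x. a * ?u j x + b * ?w j x))"
    by (subst H1_norm_eq[OF w], assumption) (intro real_sqrt_pow2 sum_nonneg add_nonneg_nonneg edge_sq_nonneg)
  also have "\<dots> \<le> (\<Sum>j=1..N. (2 * edge_sq j (\<lambda>x. a * U j x) + 2 * edge_sq j (\<lambda>x. b * W j x)) +
       (2 * edge_sq j (\<lambda>x. a * ?u j x) + 2 * edge_sq j (\<lambda>x. b * ?w j x)))"
    by (intro sum_mono add_mono edge_sq_add L2_on_scale H1_GammaD[OF assms(1)] H1_GammaD[OF assms(2)])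
  also have "\<dots> = 2 * (cmod a * H1_norm N U)\<^sup>2 + 2 * (cmod b * H1_norm N W)\<^sup>2"
    by (simp add: edge_sq_scale power_mult_distrib H1_norm_sq sum.distrib sum_distrib_left algebra_simps)
  finally show ?thesis .
qed

lemma zero_H1_Gamma: "(\<lambda>j x. 0) \<in> H1_Gamma N \<alpha>" and H1_norm_zero: "H1_norm N (\<lambda>j x. 0) = 0"
proof -
  have w: "is_weak_deriv (edge j) (\<lambda>x. 0) (\<lambda>x. 0)" for j
    by (simp add: is_weak_deriv_def L2_on_def set_borel_measurable_def set_integrable_def)
  then show "(\<lambda>j x. 0) \<in> H1_Gamma N \<alpha>"
    by (auto simp: H1_Gamma_def star_functions_def H1_on_def)
  show "H1_norm N (\<lambda>j x. 0) = 0"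
    by (subst H1_norm_eq[OF w]) (simp add: edge_sq_def)
qed

lemma H1_norm_scale:
  assumes "U \<in> H1_Gamma N \<alpha>"
  shows "H1_norm N (\<lambda>j x. a * U j x) = cmod a * H1_norm N U"
proof -
  have w: "is_weak_deriv (edge j) (\<lambda>x. a * U j x) (\<lambda>x. a * weak_deriv (edge j) (U j) x)" if "j \<in> {1..N}" for j
    using is_weak_deriv_lincomb[OF H1_GammaD(1)[OF assms that] H1_GammaD(1)[OF assms that], of a 0] by simp
  have "(H1_norm N (\<lambda>j x. a * U j x))\<^sup>2 = (cmod a * H1_norm N U)\<^sup>2"
    unfolding power_mult_distrib H1_norm_sq[of N U]
      by (subst H1_norm_eq[OF w], assumption, unfold edge_sq_scale sum_distrib_left distrib_left)
        (intro real_sqrt_pow2 sum_nonneg add_nonneg_nonneg mult_nonneg_nonneg edge_sq_nonneg zero_le_power2)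
  then show ?thesis by (simp add: H1_norm_nonneg)
qed

section \<open>The dual space and its norm\<close>

lemma Hm1_lincomb_arg:
  assumes "F \<in> Hm1_Gamma N \<alpha>" "U \<in> H1_Gamma N \<alpha>" "W \<in> H1_Gamma N \<alpha>"
  shows "F (\<lambda>j x. a * U j x + b * W j x) = cnj a * F U + cnj b * F W"
  using assms unfolding Hm1_Gamma_def by blast

text \<open>A real supremum gives an upper bound only over a bounded set; the boundedness built into
  \<open>Hm1_Gamma\<close> provides this.\<close>

lemma Hm1_bdd_above:
  assumes F: "F \<in> Hm1_Gamma N \<alpha>"
  shows "bdd_above ((\<lambda>W. cmod (F W)) ` {W \<in> H1_Gamma N \<alpha>. H1_norm N W \<le> 1})"
proof -
  obtain C where C: "\<forall>W\<in>H1_Gamma N \<alpha>. cmod (F W) \<le> C * H1_norm N W"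
    using F by (auto simp: Hm1_Gamma_def)
  show ?thesis
  proof (rule bdd_aboveI2)
    fix W assume W: "W \<in> {W \<in> H1_Gamma N \<alpha>. H1_norm N W \<le> 1}"
    then have "cmod (F W) \<le> C * H1_norm N W" using C by blast
    also have "\<dots> \<le> \<bar>C\<bar> * 1" using W by (intro mult_mono) (auto simp: H1_norm_nonneg)
    finally show "cmod (F W) \<le> \<bar>C\<bar>" by simp
  qed
qed

text \<open>Scaling \<open>W\<close> to norm 1 puts it among the functions over which the supremum
  is taken.\<close>

lemma Hm1_bound:
  assumes F: "F \<in> Hm1_Gamma N \<alpha>" and W: "W \<in> H1_Gamma N \<alpha>"
  shows "cmod (F W) \<le> Hm1_norm N \<alpha> F * H1_norm N W"
proof -
  obtain C where C: "\<forall>W\<in>H1_Gamma N \<alpha>. cmod (F W) \<le> C * H1_norm N W"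
    using F by (auto simp: Hm1_Gamma_def)
  note bdd = Hm1_bdd_above[OF F]
  show ?thesis
  proof (cases "H1_norm N W = 0")
    \<comment> \<open>No scaling is possible here, but the boundedness of \<open>F\<close> already
      forces \<open>F W = 0\<close>.\<close>
    case True then show ?thesis using bspec[OF C W] by simp
  next
    case False
    then have p: "H1_norm N W > 0" using H1_norm_nonneg[of N W] by simp
    define c where "c = complex_of_real (1 / H1_norm N W)"
    have in1: "(\<lambda>j x. c * W j x) \<in> H1_Gamma N \<alpha>" using H1_Gamma_lincomb[OF W W, of c 0] by simp
    have n1: "H1_norm N (\<lambda>j x. c * W j x) = 1"
      unfolding H1_norm_scale[OF W] using p by (simp add: c_def norm_divide)
    have "cmod (F (\<lambda>j x. c * W j x)) \<le> Hm1_norm N \<alpha> F"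
      unfolding Hm1_norm_def by (rule cSUP_upper[OF _ bdd]) (use in1 n1 in simp)
    moreover have "F (\<lambda>j x. c * W j x) = cnj c * F W" using Hm1_lincomb_arg[OF F W W, of c 0] by simp
    ultimately have "cmod (cnj c) * cmod (F W) \<le> Hm1_norm N \<alpha> F" by (simp only: norm_mult)
    moreover have "cmod (cnj c) = 1 / H1_norm N W" using p by (simp add: c_def norm_divide)
    ultimately have "1 / H1_norm N W * cmod (F W) \<le> Hm1_norm N \<alpha> F" by (simp only:)
    then show ?thesis using p by (simp add: pos_divide_le_eq)
  qed
qed

lemma Hm1_norm_le:
  assumes "\<And>W. W \<in> H1_Gamma N \<alpha> \<Longrightarrow> H1_norm N W \<le> 1 \<Longrightarrow> cmod (F W) \<le> C"
  shows "Hm1_norm N \<alpha> F \<le> C"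
  unfolding Hm1_norm_def
  by (rule cSUP_least) (use assms zero_H1_Gamma[of N \<alpha>] H1_norm_zero[of N] in \<open>auto intro!: exI[of _ "\<lambda>j x. 0"]\<close>)

lemma Hm1_norm_nonneg:
  assumes "F \<in> Hm1_Gamma N \<alpha>" shows "0 \<le> Hm1_norm N \<alpha> F"
proof -
  have "cmod (F (\<lambda>j x. 0)) \<le> Hm1_norm N \<alpha> F"
    unfolding Hm1_norm_def by (intro cSUP_upper Hm1_bdd_above assms) (auto simp: zero_H1_Gamma H1_norm_zero)
  then show ?thesis using norm_ge_zero order_trans by blast
qed

lemma Hm1_Gamma_lincomb:
  assumes "F \<in> Hm1_Gamma N \<alpha>" "G \<in> Hm1_Gamma N \<alpha>"
  shows "(\<lambda>W. a * F W + b * G W) \<in> Hm1_Gamma N \<alpha>"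
  unfolding Hm1_Gamma_def
proof (intro CollectI conjI ballI allI)
  fix U W c d assume UW: "U \<in> H1_Gamma N \<alpha>" "W \<in> H1_Gamma N \<alpha>"
  show "a * F (\<lambda>j x. c * U j x + d * W j x) + b * G (\<lambda>j x. c * U j x + d * W j x) =
     cnj c * (a * F U + b * G U) + cnj d * (a * F W + b * G W)"
    using assms UW by (simp add: Hm1_lincomb_arg algebra_simps)
next
  show "\<exists>C. \<forall>W\<in>H1_Gamma N \<alpha>. cmod (a * F W + b * G W) \<le> C * H1_norm N W"
  proof (intro exI ballI)
    fix W assume W: "W \<in> H1_Gamma N \<alpha>"
    have "cmod (a * F W + b * G W) \<le> cmod a * cmod (F W) + cmod b * cmod (G W)"
      by (metis norm_triangle_ineq norm_mult)
    also have "\<dots> \<le> cmod a * (Hm1_norm N \<alpha> F * H1_norm N W) + cmod b * (Hm1_norm N \<alpha> G * H1_norm N W)"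
      by (intro add_mono mult_left_mono Hm1_bound assms W) auto
    finally show "cmod (a * F W + b * G W) \<le> (cmod a * Hm1_norm N \<alpha> F + cmod b * Hm1_norm N \<alpha> G) * H1_norm N W"
      by (simp add: algebra_simps)
  qed
qed

lemma L2_inner_H1_bound:
  assumes "G \<in> L2_star N" "W \<in> H1_Gamma N \<alpha>"
  shows "cmod (L2_inner N G W) \<le> sqrt (L2_sq N G) * H1_norm N W"
proof -
  have "cmod (L2_inner N G W) \<le> sqrt (L2_sq N G) * sqrt (L2_sq N W)"
    by (rule L2_Cauchy_Schwarz[OF assms(1) H1_Gamma_L2_star[OF assms(2)]])
  also have "\<dots> \<le> sqrt (L2_sq N G) * H1_norm N W"
    by (intro mult_left_mono real_le_lsqrt L2_sq_le_H1 H1_norm_nonneg) (auto simp: L2_sq_nonneg)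
  finally show ?thesis .
qed

lemma L2_inner_Hm1:
  assumes "G \<in> L2_star N"
  shows "L2_inner N G \<in> Hm1_Gamma N \<alpha>"
  unfolding Hm1_Gamma_def
proof (intro CollectI conjI ballI allI)
  fix U W c d assume UW: "U \<in> H1_Gamma N \<alpha>" "W \<in> H1_Gamma N \<alpha>"
  show "L2_inner N G (\<lambda>j x. c * U j x + d * W j x) = cnj c * L2_inner N G U + cnj d * L2_inner N G W"
    using UW assms by (intro L2_inner_lincomb_right) (auto intro: H1_Gamma_L2_star)
next
  show "\<exists>C. \<forall>W\<in>H1_Gamma N \<alpha>. cmod (L2_inner N G W) \<le> C * H1_norm N W"
    using L2_inner_H1_bound[OF assms] by blast
qed

section \<open>The extended Laplacian\<close>

text \<open>The choice made in \<open>weak_deriv\<close> occurs twice. The inner one agrees a.e.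
  with \<open>g\<close> and so still has the weak derivative \<open>h\<close>; the outer one then
  agrees a.e. with \<open>h\<close>.\<close>

lemma weak_deriv_twice:
  assumes fg: "is_weak_deriv (edge j) f g" and gh: "is_weak_deriv (edge j) g h"
  shows "is_weak_deriv (edge j) (weak_deriv (edge j) f) (weak_deriv (edge j) (weak_deriv (edge j) f))"
    and "AE x in lebesgue. x \<in> edge j \<longrightarrow> weak_deriv (edge j) (weak_deriv (edge j) f) x = h x"
    and "weak_deriv (edge j) (weak_deriv (edge j) f) \<in> L2_on (edge j)"
proof -
  have f: "is_weak_deriv (edge j) f (weak_deriv (edge j) f)"
    unfolding weak_deriv_def by (rule someI[of "is_weak_deriv (edge j) f", OF fg])
  then have "weak_deriv (edge j) f \<in> L2_on (edge j)" by (simp add: is_weak_deriv_def)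
  from is_weak_deriv_cong_AE[OF gh this is_weak_deriv_AE_unique[OF fg f]]
  have h: "is_weak_deriv (edge j) (weak_deriv (edge j) f) h" .
  then show w: "is_weak_deriv (edge j) (weak_deriv (edge j) f) (weak_deriv (edge j) (weak_deriv (edge j) f))"
    unfolding weak_deriv_def[of _ "weak_deriv (edge j) f"]
    by (rule someI[of "is_weak_deriv (edge j) (weak_deriv (edge j) f)"])
  show "AE x in lebesgue. x \<in> edge j \<longrightarrow> weak_deriv (edge j) (weak_deriv (edge j) f) x = h x"
    by (rule is_weak_deriv_AE_unique[OF w h])
  show "weak_deriv (edge j) (weak_deriv (edge j) f) \<in> L2_on (edge j)"
    using w by (simp add: is_weak_deriv_def)
qed

text \<open>The vertex is an accumulation point of each half-line, so one-sided derivatives there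
  are unique.\<close>

lemma not_trivial_edge: "at 0 within edge j \<noteq> bot"
proof -
  have "(0::real) islimpt {0..}"
    by (rule islimpt_subset[OF islimpt_greaterThanLessThan1[of 0 "1::real"]]) auto
  moreover have "(0::real) islimpt {..0}"
    by (rule islimpt_subset[OF islimpt_greaterThanLessThan2[of "-1" "0::real"]]) auto
  ultimately show ?thesis by (simp add: edge_def trivial_limit_within)
qed

text \<open>The first derivative has a continuous version \<open>g j\<close> up to the vertex. Hence
  \<open>U j\<close> is classically differentiable on its edge, and the quantity in the vertex
  condition is the boundary value \<open>g j 0\<close>.\<close>

lemma H2_Gamma_derivatives:
  assumes U: "U \<in> H2_Gamma N \<alpha>"
  shows "\<exists>g h. \<forall>j\<in>{1..N}. is_weak_deriv (edge j) (U j) (g j) \<and> is_weak_deriv (edge j) (g j) (h j) \<and>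
    continuous_on (edge j) (g j) \<and> (\<forall>x\<in>edge j. (U j has_vector_derivative g j x) (at x within edge j)) \<and>
    deriv_at_vertex U j = g j 0"
proof -
  have H1: "U \<in> H1_Gamma N \<alpha>" using U by (simp add: H2_Gamma_def)
  have "\<forall>j\<in>{1..N}. \<exists>g h. is_weak_deriv (edge j) (U j) g \<and> is_weak_deriv (edge j) g h \<and> continuous_on (edge j) g"
    using U by (fastforce simp: H2_Gamma_def H2_on_def H1_on_def)
  then have "\<exists>g. \<forall>j\<in>{1..N}. \<exists>h. is_weak_deriv (edge j) (U j) (g j) \<and> is_weak_deriv (edge j) (g j) h \<and> continuous_on (edge j) (g j)"
    by (rule bchoice)
  then obtain g where "\<forall>j\<in>{1..N}. \<exists>h. is_weak_deriv (edge j) (U j) (g j) \<and> is_weak_deriv (edge j) (g j) h \<and> continuous_on (edge j) (g j)" ..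
  from bchoice[OF this] obtain h where gh: "\<forall>j\<in>{1..N}. is_weak_deriv (edge j) (U j) (g j) \<and> is_weak_deriv (edge j) (g j) (h j) \<and> continuous_on (edge j) (g j)" ..
  have d: "(U j has_vector_derivative g j x) (at x within edge j)" if "j \<in> {1..N}" "x \<in> edge j" for j x
    using weak_deriv_classical[OF _ H1_GammaD(2)[OF H1 that(1)]] gh that by blast
  have "deriv_at_vertex U j = g j 0" if "j \<in> {1..N}" for j
    unfolding deriv_at_vertex_def by (rule vector_derivative_within[OF not_trivial_edge d[OF that zero_in_edge]])
  with gh d show ?thesis by (intro exI[of _ g] exI[of _ h]) blast
qed

lemma laplacian_L2_star:
  assumes "U \<in> H2_Gamma N \<alpha>" shows "laplacian U \<in> L2_star N"
proof -
  show ?thesis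
    using H2_Gamma_derivatives[OF assms] unfolding L2_star_def laplacian_def by (blast intro: weak_deriv_twice(3))
qed

lemma L2_inner_cong_AE:
  assumes "U \<in> L2_star N" "V \<in> L2_star N" "W \<in> L2_star N"
    and "\<And>j. j \<in> {1..N} \<Longrightarrow> AE x in lebesgue. x \<in> edge j \<longrightarrow> U j x = V j x"
  shows "L2_inner N U W = L2_inner N V W"
  unfolding L2_inner_def
proof (rule sum.cong[OF refl])
  fix j assume j: "j \<in> {1..N}"
  have "U j \<in> L2_on (edge j)" "V j \<in> L2_on (edge j)" "W j \<in> L2_on (edge j)"
    using assms(1-3) j by (auto simp: L2_star_def)
  then show "(LINT x:edge j|lebesgue. U j x * cnj (W j x)) = (LINT x:edge j|lebesgue. V j x * cnj (W j x))"
    using assms(4)[OF j]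
    by (intro set_integral_cong_AE' set_borel_measurable_mult set_borel_measurable_cnj) (auto dest: L2_onD)
qed

text \<open>Integration by parts on each edge leaves minus the squared norm of the derivative, which
  is real, and boundary terms at the vertex. As the boundary values are
  \<open>c / \<alpha> j\<close>, these terms add up to \<open>cnj c\<close> times the difference of
  the two sides of the derivative condition, which is 0.\<close>

lemma laplacian_real:
  assumes U: "U \<in> H2_Gamma N \<alpha>" and bal: "balanced_star N \<alpha>"
  shows "Im (L2_inner N (laplacian U) U) = 0"
proof -
  obtain g h where *: "\<forall>j\<in>{1..N}. is_weak_deriv (edge j) (U j) (g j) \<and> is_weak_deriv (edge j) (g j) (h j) \<and>
    continuous_on (edge j) (g j) \<and> (\<forall>x\<in>edge j. (U j has_vector_derivative g j x) (at x within edge j)) \<and>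
    deriv_at_vertex U j = g j 0"
    using H2_Gamma_derivatives[OF U] by blast
  have gh: "\<And>j. j \<in> {1..N} \<Longrightarrow> is_weak_deriv (edge j) (U j) (g j)"
    "\<And>j. j \<in> {1..N} \<Longrightarrow> is_weak_deriv (edge j) (g j) (h j)"
    "\<And>j. j \<in> {1..N} \<Longrightarrow> continuous_on (edge j) (g j)"
    "\<And>j x. j \<in> {1..N} \<Longrightarrow> x \<in> edge j \<Longrightarrow> (U j has_vector_derivative g j x) (at x within edge j)"
    "\<And>j. j \<in> {1..N} \<Longrightarrow> deriv_at_vertex U j = g j 0"
    using * by blast+
  have N: "N \<ge> 3" and pos: "\<And>j. j \<in> {1..N} \<Longrightarrow> \<alpha> j > 0" using bal by (auto simp: balanced_star_def)
  have H1: "U \<in> H1_Gamma N \<alpha>" using U by (simp add: H2_Gamma_def)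
  have hL: "h \<in> L2_star N" and gL: "g \<in> L2_star N" using gh(2) by (auto simp: L2_star_def is_weak_deriv_def)
  define B where "B j = (if j = 1 then g j 0 * cnj (U j 0) else - (g j 0 * cnj (U j 0)))" for j
  \<comment> \<open>The common value of \<open>\<alpha> j * U j 0\<close> over all edges.\<close>
  define c where "c = complex_of_real (\<alpha> 1) * U 1 0"
  have U0: "U j 0 = c / complex_of_real (\<alpha> j)" if j: "j \<in> {1..N}" for j
  proof -
    have "complex_of_real (\<alpha> j) * U j 0 = c" using H1 j unfolding H1_Gamma_def c_def by blast
    then show ?thesis using pos[OF j] by (auto simp: field_simps)
  qed
  have "L2_inner N (laplacian U) U = L2_inner N h U"
    by (rule L2_inner_cong_AE[OF laplacian_L2_star[OF U] hL H1_Gamma_L2_star[OF H1]])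
       (unfold laplacian_def, rule weak_deriv_twice(2)[OF gh(1,2)])
  also have "\<dots> = (\<Sum>j=1..N. B j - complex_of_real (edge_sq j (g j)))"
    unfolding L2_inner_def
  proof (rule sum.cong[OF refl])
    fix j assume j: "j \<in> {1..N}"
    have "(LINT x:edge j|lebesgue. h j x * cnj (U j x)) = B j - (LINT x:edge j|lebesgue. g j x * cnj (g j x))"
      unfolding B_def using gL j
      by (intro integration_by_parts gh H1_GammaD(3)[OF H1]) (auto simp: L2_star_def)
    also have "(LINT x:edge j|lebesgue. g j x * cnj (g j x)) = complex_of_real (edge_sq j (g j))"
      unfolding edge_sq_def set_integral_complex_of_real[symmetric]
      by (intro set_lebesgue_integral_cong) (auto simp: complex_norm_square[symmetric] simp del: of_real_power)
    finally show "(LINT x:edge j|lebesgue. h j x * cnj (U j x)) = B j - complex_of_real (edge_sq j (g j))" .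
  qed
  also have "\<dots> = (\<Sum>j=1..N. B j) - complex_of_real (\<Sum>j=1..N. edge_sq j (g j))"
    by (simp add: sum_subtractf)
  \<comment> \<open>The incoming edge contributes with the sign opposite to that of the outgoing
    edges, exactly as in the derivative condition.\<close>
  also have "(\<Sum>j=1..N. B j) = B 1 + (\<Sum>j=2..N. B j)"
    using N by (subst sum.atLeast_Suc_atMost) (auto simp: numeral_2_eq_2)
  also have "B 1 = cnj c * (deriv_at_vertex U 1 / complex_of_real (\<alpha> 1))"
    using N by (simp add: B_def gh(5) U0)
  also have "(\<Sum>j=2..N. B j) = - cnj c * (\<Sum>j=2..N. deriv_at_vertex U j / complex_of_real (\<alpha> j))"
    unfolding sum_distrib_left by (intro sum.cong) (auto simp: B_def gh(5) U0)
  also have "cnj c * (deriv_at_vertex U 1 / complex_of_real (\<alpha> 1)) + - cnj c * (\<Sum>j=2..N. deriv_at_vertex U j / complex_of_real (\<alpha> j)) = 0"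
    using U by (simp add: H2_Gamma_def)
  finally show ?thesis by simp
qed

text \<open>Linearity of \<open>laplacian\<close> holds only a.e., because each application chooses
  its own representative. Under \<open>L2_inner\<close> this makes no difference.\<close>

lemma H2_Gamma_lincomb:
  assumes "U \<in> H2_Gamma N \<alpha>" "V \<in> H2_Gamma N \<alpha>" and N: "N \<ge> 1"
  shows "(\<lambda>j x. a * U j x + b * V j x) \<in> H2_Gamma N \<alpha>"
    and "j \<in> {1..N} \<Longrightarrow> AE x in lebesgue. x \<in> edge j \<longrightarrow>
       laplacian (\<lambda>j x. a * U j x + b * V j x) j x = a * laplacian U j x + b * laplacian V j x"
proof -
  obtain g h where *: "\<forall>j\<in>{1..N}. is_weak_deriv (edge j) (U j) (g j) \<and> is_weak_deriv (edge j) (g j) (h j) \<and>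
    continuous_on (edge j) (g j) \<and> (\<forall>x\<in>edge j. (U j has_vector_derivative g j x) (at x within edge j)) \<and>
    deriv_at_vertex U j = g j 0"
    using H2_Gamma_derivatives[OF assms(1)] by blast
  have gh: "\<And>j. j \<in> {1..N} \<Longrightarrow> is_weak_deriv (edge j) (U j) (g j)"
    "\<And>j. j \<in> {1..N} \<Longrightarrow> is_weak_deriv (edge j) (g j) (h j)"
    "\<And>j. j \<in> {1..N} \<Longrightarrow> continuous_on (edge j) (g j)"
    "\<And>j x. j \<in> {1..N} \<Longrightarrow> x \<in> edge j \<Longrightarrow> (U j has_vector_derivative g j x) (at x within edge j)"
    "\<And>j. j \<in> {1..N} \<Longrightarrow> deriv_at_vertex U j = g j 0"
    using * by blast+
  obtain g' h' where *: "\<forall>j\<in>{1..N}. is_weak_deriv (edge j) (V j) (g' j) \<and> is_weak_deriv (edge j) (g' j) (h' j) \<and>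
    continuous_on (edge j) (g' j) \<and> (\<forall>x\<in>edge j. (V j has_vector_derivative g' j x) (at x within edge j)) \<and>
    deriv_at_vertex V j = g' j 0"
    using H2_Gamma_derivatives[OF assms(2)] by blast
  have gh': "\<And>j. j \<in> {1..N} \<Longrightarrow> is_weak_deriv (edge j) (V j) (g' j)"
    "\<And>j. j \<in> {1..N} \<Longrightarrow> is_weak_deriv (edge j) (g' j) (h' j)"
    "\<And>j. j \<in> {1..N} \<Longrightarrow> continuous_on (edge j) (g' j)"
    "\<And>j x. j \<in> {1..N} \<Longrightarrow> x \<in> edge j \<Longrightarrow> (V j has_vector_derivative g' j x) (at x within edge j)"
    "\<And>j. j \<in> {1..N} \<Longrightarrow> deriv_at_vertex V j = g' j 0"
    using * by blast+
  let ?W = "\<lambda>j x. a * U j x + b * V j x"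
  have dW: "deriv_at_vertex ?W j = a * deriv_at_vertex U j + b * deriv_at_vertex V j" if j: "j \<in> {1..N}" for j
    unfolding deriv_at_vertex_def[of ?W] gh(5)[OF j] gh'(5)[OF j]
    by (intro vector_derivative_within not_trivial_edge has_vector_derivative_add has_vector_derivative_mult_right gh(4) gh'(4) j zero_in_edge)
  have K: "deriv_at_vertex U 1 / complex_of_real (\<alpha> 1) = (\<Sum>j=2..N. deriv_at_vertex U j / complex_of_real (\<alpha> j))"
    "deriv_at_vertex V 1 / complex_of_real (\<alpha> 1) = (\<Sum>j=2..N. deriv_at_vertex V j / complex_of_real (\<alpha> j))"
    using assms by (simp_all add: H2_Gamma_def)
  have "deriv_at_vertex ?W 1 / complex_of_real (\<alpha> 1) = a * (deriv_at_vertex U 1 / complex_of_real (\<alpha> 1)) + b * (deriv_at_vertex V 1 / complex_of_real (\<alpha> 1))"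
    using N by (simp add: dW add_divide_distrib)
  also have "\<dots> = (\<Sum>j=2..N. (a * deriv_at_vertex U j + b * deriv_at_vertex V j) / complex_of_real (\<alpha> j))"
    unfolding K by (simp add: sum_distrib_left sum.distrib add_divide_distrib)
  also have "\<dots> = (\<Sum>j=2..N. deriv_at_vertex ?W j / complex_of_real (\<alpha> j))"
    by (intro sum.cong) (auto simp: dW)
  finally show "?W \<in> H2_Gamma N \<alpha>"
    using assms unfolding H2_Gamma_def by (auto intro!: H1_Gamma_lincomb H2_on_lincomb)
  assume j: "j \<in> {1..N}"
  have 1: "AE x in lebesgue. x \<in> edge j \<longrightarrow> laplacian ?W j x = a * h j x + b * h' j x"
    unfolding laplacian_def
    by (rule weak_deriv_twice(2)[OF is_weak_deriv_lincomb[OF gh(1)[OF j] gh'(1)[OF j]] is_weak_deriv_lincomb[OF gh(2)[OF j] gh'(2)[OF j]]])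
  have 2: "AE x in lebesgue. x \<in> edge j \<longrightarrow> laplacian U j x = h j x"
    "AE x in lebesgue. x \<in> edge j \<longrightarrow> laplacian V j x = h' j x"
    unfolding laplacian_def by (rule weak_deriv_twice(2)[OF gh(1)[OF j] gh(2)[OF j]] weak_deriv_twice(2)[OF gh'(1)[OF j] gh'(2)[OF j]])+
  show "AE x in lebesgue. x \<in> edge j \<longrightarrow> laplacian ?W j x = a * laplacian U j x + b * laplacian V j x"
    using 1 2(1) 2(2) by eventually_elim simp
qed

lemma Hm1_Gamma_diff:
  assumes "F \<in> Hm1_Gamma N \<alpha>" "G \<in> Hm1_Gamma N \<alpha>"
  shows "(\<lambda>W. F W - G W) \<in> Hm1_Gamma N \<alpha>"
  using Hm1_Gamma_lincomb[OF assms, of 1 "-1"] by simp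

lemma Hm1_norm_triangle_diff:
  assumes F: "F \<in> Hm1_Gamma N \<alpha>" and G: "G \<in> Hm1_Gamma N \<alpha>"
    and le: "\<And>W. W \<in> H1_Gamma N \<alpha> \<Longrightarrow> cmod (K W) \<le> cmod (F W) + cmod (G W)"
  shows "Hm1_norm N \<alpha> K \<le> Hm1_norm N \<alpha> F + Hm1_norm N \<alpha> G"
proof (rule Hm1_norm_le)
  fix W assume W: "W \<in> H1_Gamma N \<alpha>" "H1_norm N W \<le> 1"
  have "cmod (K W) \<le> Hm1_norm N \<alpha> F * H1_norm N W + Hm1_norm N \<alpha> G * H1_norm N W"
    using le[OF W(1)] Hm1_bound[OF F W(1)] Hm1_bound[OF G W(1)] by linarith
  also have "\<dots> \<le> Hm1_norm N \<alpha> F * 1 + Hm1_norm N \<alpha> G * 1"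
    by (intro add_mono mult_left_mono W Hm1_norm_nonneg F G)
  finally show "cmod (K W) \<le> Hm1_norm N \<alpha> F + Hm1_norm N \<alpha> G" by simp
qed

lemma tendsto_zero_squeeze:
  fixes f g :: "'a \<Rightarrow> real"
  assumes "\<And>n. 0 \<le> f n" "\<And>n. f n \<le> g n" "(g \<longlongrightarrow> 0) F"
  shows "(f \<longlongrightarrow> 0) F"
  using assms by (intro tendsto_sandwich[OF always_eventually[OF allI] always_eventually[OF allI] tendsto_const assms(3)])

lemma H1_norm_tendsto_add:
  assumes UV: "\<And>n. U n \<in> H1_Gamma N \<alpha>" "\<And>n. V n \<in> H1_Gamma N \<alpha>"
    and lim: "((\<lambda>n. H1_norm N (U n)) \<longlongrightarrow> 0) F" "((\<lambda>n. H1_norm N (V n)) \<longlongrightarrow> 0) F"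
  shows "((\<lambda>n. H1_norm N (\<lambda>j x. a * U n j x + b * V n j x)) \<longlongrightarrow> 0) F"
proof -
  have "((\<lambda>n. 2 * (cmod a * H1_norm N (U n))\<^sup>2 + 2 * (cmod b * H1_norm N (V n))\<^sup>2) \<longlongrightarrow> 2 * (cmod a * 0)\<^sup>2 + 2 * (cmod b * 0)\<^sup>2) F"
    by (intro tendsto_intros lim)
  then have lim0: "((\<lambda>n. 2 * (cmod a * H1_norm N (U n))\<^sup>2 + 2 * (cmod b * H1_norm N (V n))\<^sup>2) \<longlongrightarrow> 0) F"
    by simp
  have "((\<lambda>n. (H1_norm N (\<lambda>j x. a * U n j x + b * V n j x))\<^sup>2) \<longlongrightarrow> 0) F"
    by (rule tendsto_zero_squeeze[OF _ _ lim0])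
       (rule zero_le_power2 H1_norm_lincomb[OF UV])+
  from tendsto_real_sqrt[OF this] show ?thesis by (simp add: H1_norm_nonneg)
qed

text \<open>The differences of the two approximating sequences approximate the difference.
  Uniqueness applies this to two solutions.\<close>

lemma ext_laplacian_diff:
  assumes F: "ext_laplacian N \<alpha> \<Psi> F" and G: "ext_laplacian N \<alpha> \<Phi> G" and N: "N \<ge> 1"
  shows "ext_laplacian N \<alpha> (\<lambda>j x. \<Psi> j x - \<Phi> j x) (\<lambda>W. F W - G W)"
proof -
  obtain U where U: "\<And>n. U n \<in> H2_Gamma N \<alpha>" "(\<lambda>n. H1_norm N (\<lambda>j x. U n j x - \<Psi> j x)) \<longlonglongrightarrow> 0"
    "(\<lambda>n. Hm1_norm N \<alpha> (\<lambda>W. L2_inner N (laplacian (U n)) W - F W)) \<longlonglongrightarrow> 0"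
    using F by (auto simp: ext_laplacian_def)
  obtain V where V: "\<And>n. V n \<in> H2_Gamma N \<alpha>" "(\<lambda>n. H1_norm N (\<lambda>j x. V n j x - \<Phi> j x)) \<longlonglongrightarrow> 0"
    "(\<lambda>n. Hm1_norm N \<alpha> (\<lambda>W. L2_inner N (laplacian (V n)) W - G W)) \<longlonglongrightarrow> 0"
    using G by (auto simp: ext_laplacian_def)
  have P: "\<Psi> \<in> H1_Gamma N \<alpha>" "\<Phi> \<in> H1_Gamma N \<alpha>" and FG: "F \<in> Hm1_Gamma N \<alpha>" "G \<in> Hm1_Gamma N \<alpha>"
    using F G by (auto simp: ext_laplacian_def)
  define D where "D n = (\<lambda>j x. U n j x - V n j x)" for n
  have UH1: "U n \<in> H1_Gamma N \<alpha>" "V n \<in> H1_Gamma N \<alpha>" for n using U V by (auto simp: H2_Gamma_def)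
  note diffH1 = H1_Gamma_diff[where \<alpha>=\<alpha> and N=N]
  have D2: "D n \<in> H2_Gamma N \<alpha>" for n
    using H2_Gamma_lincomb(1)[OF U(1)[of n] V(1)[of n] N, of 1 "-1"] by (simp add: D_def)
  have lap: "L2_inner N (laplacian (D n)) W = L2_inner N (laplacian (U n)) W - L2_inner N (laplacian (V n)) W" if "W \<in> H1_Gamma N \<alpha>" for n W
  proof -
    have L: "laplacian (U n) \<in> L2_star N" "laplacian (V n) \<in> L2_star N" "laplacian (D n) \<in> L2_star N" "W \<in> L2_star N"
      using U V D2 that by (auto intro: laplacian_L2_star H1_Gamma_L2_star)
    have "L2_inner N (laplacian (D n)) W = L2_inner N (\<lambda>j x. 1 * laplacian (U n) j x + (-1) * laplacian (V n) j x) W"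
      using H2_Gamma_lincomb(2)[OF U(1)[of n] V(1)[of n] N, where a=1 and b="-1"]
      by (intro L2_inner_cong_AE L L2_star_lincomb) (auto simp: D_def)
    also have "\<dots> = L2_inner N (laplacian (U n)) W - L2_inner N (laplacian (V n)) W"
      using L by (subst L2_inner_lincomb_left) auto
    finally show ?thesis .
  qed
  show ?thesis
    unfolding ext_laplacian_def
  proof (intro conjI exI[of _ D] allI)
    show "(\<lambda>n. H1_norm N (\<lambda>j x. D n j x - (\<Psi> j x - \<Phi> j x))) \<longlonglongrightarrow> 0"
      using H1_norm_tendsto_add[OF diffH1[OF UH1(1) P(1)] diffH1[OF UH1(2) P(2)] U(2) V(2), of 1 "-1"]
      by (simp add: D_def algebra_simps)
    have le: "Hm1_norm N \<alpha> (\<lambda>W. L2_inner N (laplacian (D n)) W - (F W - G W)) \<le>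
       Hm1_norm N \<alpha> (\<lambda>W. L2_inner N (laplacian (U n)) W - F W) + Hm1_norm N \<alpha> (\<lambda>W. L2_inner N (laplacian (V n)) W - G W)" for n
    proof (rule Hm1_norm_triangle_diff)
      fix W assume "W \<in> H1_Gamma N \<alpha>"
      then have "L2_inner N (laplacian (D n)) W - (F W - G W) =
        (L2_inner N (laplacian (U n)) W - F W) - (L2_inner N (laplacian (V n)) W - G W)" by (simp add: lap)
      then show "cmod (L2_inner N (laplacian (D n)) W - (F W - G W)) \<le>
         cmod (L2_inner N (laplacian (U n)) W - F W) + cmod (L2_inner N (laplacian (V n)) W - G W)"
        by (simp only: norm_triangle_ineq4)
    qed (intro Hm1_Gamma_diff L2_inner_Hm1 laplacian_L2_star[OF U(1)] laplacian_L2_star[OF V(1)] FG)+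
    have ge: "0 \<le> Hm1_norm N \<alpha> (\<lambda>W. L2_inner N (laplacian (D n)) W - (F W - G W))" for n
      by (intro Hm1_norm_nonneg Hm1_Gamma_diff L2_inner_Hm1 laplacian_L2_star[OF D2] FG)
    show "(\<lambda>n. Hm1_norm N \<alpha> (\<lambda>W. L2_inner N (laplacian (D n)) W - (F W - G W))) \<longlonglongrightarrow> 0"
      by (rule tendsto_zero_squeeze[OF ge le]) (use tendsto_add[OF U(3) V(3)] in simp)
  qed (intro diffH1 P Hm1_Gamma_diff FG D2)+
qed

text \<open>Reality of the pairing passes from the domain to its closure: convergence in the dual
  norm together with convergence in H^1 makes the pairings converge to
  \<open>F \<Psi>\<close>.\<close>

lemma ext_laplacian_real:
  assumes F: "ext_laplacian N \<alpha> \<Psi> F" and bal: "balanced_star N \<alpha>"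
  shows "Im (F \<Psi>) = 0"
proof -
  obtain U where U: "\<And>n. U n \<in> H2_Gamma N \<alpha>" "(\<lambda>n. H1_norm N (\<lambda>j x. U n j x - \<Psi> j x)) \<longlonglongrightarrow> 0"
    "(\<lambda>n. Hm1_norm N \<alpha> (\<lambda>W. L2_inner N (laplacian (U n)) W - F W)) \<longlonglongrightarrow> 0"
    using F by (auto simp: ext_laplacian_def)
  have P: "\<Psi> \<in> H1_Gamma N \<alpha>" and FH: "F \<in> Hm1_Gamma N \<alpha>" using F by (auto simp: ext_laplacian_def)
  have UH1: "U n \<in> H1_Gamma N \<alpha>" for n using U by (auto simp: H2_Gamma_def)
  have DH1: "(\<lambda>j x. U n j x - \<Psi> j x) \<in> H1_Gamma N \<alpha>" for n using H1_Gamma_lincomb[OF UH1 P, where a=1 and b="-1"] by simp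
  let ?a = "\<lambda>n. H1_norm N (\<lambda>j x. U n j x - \<Psi> j x)"
  let ?G = "\<lambda>n W. L2_inner N (laplacian (U n)) W - F W"
  let ?b = "\<lambda>n. Hm1_norm N \<alpha> (?G n)"
  have GH: "?G n \<in> Hm1_Gamma N \<alpha>" for n by (intro Hm1_Gamma_diff L2_inner_Hm1 laplacian_L2_star[OF U(1)] FH)
  have bd: "norm (L2_inner N (laplacian (U n)) (U n) - F \<Psi>) \<le> ?b n * sqrt (2 * (?a n)\<^sup>2 + 2 * (H1_norm N \<Psi>)\<^sup>2) + Hm1_norm N \<alpha> F * ?a n" for n
  proof -
    have "(H1_norm N (U n))\<^sup>2 \<le> 2 * (?a n)\<^sup>2 + 2 * (H1_norm N \<Psi>)\<^sup>2"
      using H1_norm_lincomb[OF DH1[of n] P, of 1 1] by simp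
    then have Un: "H1_norm N (U n) \<le> sqrt (2 * (?a n)\<^sup>2 + 2 * (H1_norm N \<Psi>)\<^sup>2)" by (rule real_le_rsqrt)
    have 1: "cmod (?G n (U n)) \<le> ?b n * H1_norm N (U n)" by (rule Hm1_bound[OF GH UH1])
    also have "\<dots> \<le> ?b n * sqrt (2 * (?a n)\<^sup>2 + 2 * (H1_norm N \<Psi>)\<^sup>2)" by (intro mult_left_mono Un Hm1_norm_nonneg GH)
    finally have 1: "cmod (?G n (U n)) \<le> ?b n * sqrt (2 * (?a n)\<^sup>2 + 2 * (H1_norm N \<Psi>)\<^sup>2)" .
    have 2: "cmod (F (\<lambda>j x. U n j x - \<Psi> j x)) \<le> Hm1_norm N \<alpha> F * ?a n" by (rule Hm1_bound[OF FH DH1])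
    have "F (\<lambda>j x. U n j x - \<Psi> j x) = F (U n) - F \<Psi>" using Hm1_lincomb_arg[OF FH UH1 P, where a=1 and b="-1"] by simp
    \<comment> \<open>One term is small in the dual norm against bounded \<open>U n\<close>, the
      other is the fixed functional \<open>F\<close> applied to a small function.\<close>
    then have "L2_inner N (laplacian (U n)) (U n) - F \<Psi> = ?G n (U n) + F (\<lambda>j x. U n j x - \<Psi> j x)" by simp
    then show ?thesis by (simp only:) (rule order_trans[OF norm_triangle_ineq add_mono[OF 1 2]])
  qed
  have lim: "(\<lambda>n. ?b n * sqrt (2 * (?a n)\<^sup>2 + 2 * (H1_norm N \<Psi>)\<^sup>2) + Hm1_norm N \<alpha> F * ?a n) \<longlonglongrightarrow>
     0 * sqrt (2 * 0\<^sup>2 + 2 * (H1_norm N \<Psi>)\<^sup>2) + Hm1_norm N \<alpha> F * 0"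
    by (intro tendsto_intros U)
  have "(\<lambda>n. L2_inner N (laplacian (U n)) (U n) - F \<Psi>) \<longlonglongrightarrow> 0"
    by (rule Lim_null_comparison[OF always_eventually[OF allI[OF bd]] lim[unfolded mult_zero_left mult_zero_right add_0_left]])
  from tendsto_Im[OF this] have "(\<lambda>n. - Im (F \<Psi>)) \<longlonglongrightarrow> 0"
    by (simp add: laplacian_real[OF U(1) bal])
  then show ?thesis by (simp add: LIMSEQ_const_iff)
qed

section \<open>Uniqueness\<close>

lemma L2_inner_diff_left:
  assumes "U \<in> L2_star N" "V \<in> L2_star N" "W \<in> L2_star N"
  shows "L2_inner N (\<lambda>j x. U j x - V j x) W = L2_inner N U W - L2_inner N V W"
  using L2_inner_lincomb_left[OF assms, of 1 "-1"] by simp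

lemma continuous_H1_diff:
  assumes "continuous_H1 N \<alpha> \<Psi>" "continuous_H1 N \<alpha> \<Phi>"
  shows "continuous_H1 N \<alpha> (\<lambda>t j x. \<Psi> t j x - \<Phi> t j x)"
  unfolding continuous_H1_def
proof (intro conjI allI)
  have m: "\<And>t. \<Psi> t \<in> H1_Gamma N \<alpha>" "\<And>t. \<Phi> t \<in> H1_Gamma N \<alpha>" using assms by (auto simp: continuous_H1_def)
  fix t
  show "(\<lambda>j x. \<Psi> t j x - \<Phi> t j x) \<in> H1_Gamma N \<alpha>" by (rule H1_Gamma_diff[OF m])
  have "((\<lambda>s. H1_norm N (\<lambda>j x. 1 * (\<Psi> s j x - \<Psi> t j x) + (-1) * (\<Phi> s j x - \<Phi> t j x))) \<longlongrightarrow> 0) (at t)"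
    by (rule H1_norm_tendsto_add[OF H1_Gamma_diff[OF m(1) m(1)] H1_Gamma_diff[OF m(2) m(2)]])
       (use assms in \<open>auto simp: continuous_H1_def\<close>)
  then show "((\<lambda>s. H1_norm N (\<lambda>j x. \<Psi> s j x - \<Phi> s j x - (\<Psi> t j x - \<Phi> t j x))) \<longlongrightarrow> 0) (at t)"
    by (simp add: algebra_simps)
qed

lemma difference_quotient_Hm1:
  assumes "U \<in> L2_star N" "V \<in> L2_star N" "F \<in> Hm1_Gamma N \<alpha>"
  shows "(\<lambda>W. (L2_inner N U W - L2_inner N V W) / c - F W) \<in> Hm1_Gamma N \<alpha>"
  using Hm1_Gamma_lincomb[OF Hm1_Gamma_diff[OF L2_inner_Hm1[OF assms(1)] L2_inner_Hm1[OF assms(2)]] assms(3), of "1/c" "-1"]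
  by simp

lemma has_C1_deriv_Hm1_diff:
  assumes c: "continuous_H1 N \<alpha> \<Psi>" "continuous_H1 N \<alpha> \<Phi>"
    and D: "has_C1_deriv_Hm1 N \<alpha> \<Psi> D" and E: "has_C1_deriv_Hm1 N \<alpha> \<Phi> E"
  shows "has_C1_deriv_Hm1 N \<alpha> (\<lambda>t j x. \<Psi> t j x - \<Phi> t j x) (\<lambda>t W. D t W - E t W)"
  unfolding has_C1_deriv_Hm1_def
proof (intro conjI allI)
  have m: "\<And>t. \<Psi> t \<in> L2_star N" "\<And>t. \<Phi> t \<in> L2_star N"
    using c by (auto simp: continuous_H1_def intro: H1_Gamma_L2_star)
  note md = L2_star_lincomb[OF m(1) m(2), where a=1 and b="-1", simplified]
  have DH: "\<And>t. D t \<in> Hm1_Gamma N \<alpha>" "\<And>t. E t \<in> Hm1_Gamma N \<alpha>"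
    using D E by (auto simp: has_C1_deriv_Hm1_def)
  fix t
  show "(\<lambda>W. D t W - E t W) \<in> Hm1_Gamma N \<alpha>" by (rule Hm1_Gamma_diff[OF DH])
  have DD: "(\<lambda>W. D t W - E t W) \<in> Hm1_Gamma N \<alpha>" for t by (rule Hm1_Gamma_diff[OF DH])
  let ?d = "\<lambda>t j x. \<Psi> t j x - \<Phi> t j x"
  let ?q = "\<lambda>\<Psi> D s W. (L2_inner N (\<Psi> s) W - L2_inner N (\<Psi> t) W) / complex_of_real (s - t) - D t W"
  have lim: "((\<lambda>s. Hm1_norm N \<alpha> (?q \<Psi> D s) + Hm1_norm N \<alpha> (?q \<Phi> E s)) \<longlongrightarrow> 0) (at t)"
    by (rule tendsto_add_zero) (use D E in \<open>simp_all add: has_C1_deriv_Hm1_def\<close>)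
  show "((\<lambda>s. Hm1_norm N \<alpha> (\<lambda>W. (L2_inner N (?d s) W - L2_inner N (?d t) W) / complex_of_real (s - t) - (D t W - E t W))) \<longlongrightarrow> 0) (at t)"
  proof (rule tendsto_zero_squeeze[OF _ _ lim])
    fix s
    show "0 \<le> Hm1_norm N \<alpha> (\<lambda>W. (L2_inner N (?d s) W - L2_inner N (?d t) W) / complex_of_real (s - t) - (D t W - E t W))"
      by (intro Hm1_norm_nonneg difference_quotient_Hm1 md DD)
    show "Hm1_norm N \<alpha> (\<lambda>W. (L2_inner N (?d s) W - L2_inner N (?d t) W) / complex_of_real (s - t) - (D t W - E t W))
      \<le> Hm1_norm N \<alpha> (?q \<Psi> D s) + Hm1_norm N \<alpha> (?q \<Phi> E s)"
    proof (rule Hm1_norm_triangle_diff)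
      fix W assume "W \<in> H1_Gamma N \<alpha>"
      then have W: "W \<in> L2_star N" by (rule H1_Gamma_L2_star)
      have "(L2_inner N (?d s) W - L2_inner N (?d t) W) / complex_of_real (s - t) - (D t W - E t W) = ?q \<Psi> D s W - ?q \<Phi> E s W"
        unfolding L2_inner_diff_left[OF m(1) m(2) W] by (simp add: diff_divide_distrib)
      then show "cmod ((L2_inner N (?d s) W - L2_inner N (?d t) W) / complex_of_real (s - t) - (D t W - E t W)) \<le> cmod (?q \<Psi> D s W) + cmod (?q \<Phi> E s W)"
        by (simp only: norm_triangle_ineq4)
    qed (intro difference_quotient_Hm1 m DH)+
  qed
  have lim: "((\<lambda>s. Hm1_norm N \<alpha> (\<lambda>W. D s W - D t W) + Hm1_norm N \<alpha> (\<lambda>W. E s W - E t W)) \<longlongrightarrow> 0) (at t)"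
    by (rule tendsto_add_zero) (use D E in \<open>simp_all add: has_C1_deriv_Hm1_def\<close>)
  show "((\<lambda>s. Hm1_norm N \<alpha> (\<lambda>W. D s W - E s W - (D t W - E t W))) \<longlongrightarrow> 0) (at t)"
  proof (rule tendsto_zero_squeeze[OF _ _ lim])
    fix s
    show "0 \<le> Hm1_norm N \<alpha> (\<lambda>W. D s W - E s W - (D t W - E t W))"
      by (intro Hm1_norm_nonneg Hm1_Gamma_diff DH)
    show "Hm1_norm N \<alpha> (\<lambda>W. D s W - E s W - (D t W - E t W)) \<le> Hm1_norm N \<alpha> (\<lambda>W. D s W - D t W) + Hm1_norm N \<alpha> (\<lambda>W. E s W - E t W)"
    proof (rule Hm1_norm_triangle_diff)
      fix W
      have "D s W - E s W - (D t W - E t W) = (D s W - D t W) - (E s W - E t W)" by simp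
      then show "cmod (D s W - E s W - (D t W - E t W)) \<le> cmod (D s W - D t W) + cmod (E s W - E t W)"
        by (simp only: norm_triangle_ineq4)
    qed (intro Hm1_Gamma_diff DH)+
  qed
qed

text \<open>The increment of the squared norm is the real part of the pairing of
  \<open>w s - w t\<close> with \<open>w s + w t\<close>. The difference quotient converges in the
  dual space, while the sum converges in H^1 to \<open>2 * w t\<close>, so the product passes to the
  limit.\<close>

lemma energy_derivative:
  assumes c: "continuous_H1 N \<alpha> w" and D: "has_C1_deriv_Hm1 N \<alpha> w D"
  shows "((\<lambda>t. L2_sq N (w t)) has_real_derivative 2 * Re (D t (w t))) (at t)"
proof -
  have wH: "\<And>t. w t \<in> H1_Gamma N \<alpha>" using c by (simp add: continuous_H1_def)
  have wL: "\<And>t. w t \<in> L2_star N" using wH by (rule H1_Gamma_L2_star)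
  have DH: "\<And>t. D t \<in> Hm1_Gamma N \<alpha>" using D by (simp add: has_C1_deriv_Hm1_def)
  define Q where "Q s = (\<lambda>W. (L2_inner N (w s) W - L2_inner N (w t) W) / complex_of_real (s - t) - D t W)" for s
  have QH: "Q s \<in> Hm1_Gamma N \<alpha>" for s unfolding Q_def by (intro difference_quotient_Hm1 wL DH)
  let ?a = "\<lambda>s. H1_norm N (\<lambda>j x. w s j x - w t j x)" and ?q = "\<lambda>s. Hm1_norm N \<alpha> (Q s)"
  let ?g = "\<lambda>s. ?q s * sqrt (2 * (?a s)\<^sup>2 + 2 * (2 * H1_norm N (w t))\<^sup>2) + Hm1_norm N \<alpha> (D t) * ?a s"
  have lim: "(?g \<longlongrightarrow> 0 * sqrt (2 * 0\<^sup>2 + 2 * (2 * H1_norm N (w t))\<^sup>2) + Hm1_norm N \<alpha> (D t) * 0) (at t)"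
    using c D by (intro tendsto_intros) (auto simp: continuous_H1_def has_C1_deriv_Hm1_def Q_def)
  have bound: "\<bar>(L2_sq N (w s) - L2_sq N (w t)) / (s - t) - 2 * Re (D t (w t))\<bar> \<le> ?g s" if "s \<noteq> t" for s
  proof -
    \<comment> \<open>This is \<open>w s + w t\<close>, written as the small increment plus
      \<open>2 * w t\<close> so that the limit can be read off.\<close>
    define Z where "Z = (\<lambda>j x. 1 * (w s j x - w t j x) + 2 * w t j x)"
    have dH: "(\<lambda>j x. w s j x - w t j x) \<in> H1_Gamma N \<alpha>" by (rule H1_Gamma_diff[OF wH wH])
    have ZH: "Z \<in> H1_Gamma N \<alpha>" unfolding Z_def by (rule H1_Gamma_lincomb[OF dH wH])
    have Z': "Z = (\<lambda>j x. 1 * w s j x + 1 * w t j x)" by (auto simp: Z_def fun_eq_iff)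
    have "Re (L2_inner N (w s) Z - L2_inner N (w t) Z) = Re (L2_inner N (w s) (w s)) - Re (L2_inner N (w t) (w t)) +
       (Re (L2_inner N (w s) (w t)) - Re (L2_inner N (w t) (w s)))"
      unfolding Z' L2_inner_lincomb_right[OF wL wL wL] by simp
    also have "Re (L2_inner N (w s) (w t)) = Re (L2_inner N (w t) (w s))"
      using arg_cong[OF L2_inner_cnj[of N "w s" "w t"], of Re] by simp
    finally have E: "L2_sq N (w s) - L2_sq N (w t) = Re (L2_inner N (w s) Z - L2_inner N (w t) Z)"
      by (simp add: L2_inner_self)
    have quot: "(L2_sq N (w s) - L2_sq N (w t)) / (s - t) = Re (Q s Z + D t Z)"
      unfolding E Q_def using Re_divide_of_real[of "L2_inner N (w s) Z - L2_inner N (w t) Z" "s - t"] by simp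
    have DZ: "D t Z = D t (\<lambda>j x. w s j x - w t j x) + 2 * D t (w t)"
      unfolding Z_def by (subst Hm1_lincomb_arg[OF DH dH wH]) simp
    have nZ: "H1_norm N Z \<le> sqrt (2 * (?a s)\<^sup>2 + 2 * (2 * H1_norm N (w t))\<^sup>2)"
      unfolding Z_def using H1_norm_lincomb[OF dH wH[of t], of 1 2] by (intro real_le_rsqrt) simp
    have 1: "cmod (Q s Z) \<le> ?q s * sqrt (2 * (?a s)\<^sup>2 + 2 * (2 * H1_norm N (w t))\<^sup>2)"
      by (rule order_trans[OF Hm1_bound[OF QH ZH] mult_left_mono[OF nZ Hm1_norm_nonneg[OF QH]]])
    have 2: "cmod (D t (\<lambda>j x. w s j x - w t j x)) \<le> Hm1_norm N \<alpha> (D t) * ?a s"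
      by (rule Hm1_bound[OF DH dH])
    have "(L2_sq N (w s) - L2_sq N (w t)) / (s - t) - 2 * Re (D t (w t)) = Re (Q s Z + D t (\<lambda>j x. w s j x - w t j x))"
      unfolding quot DZ by simp
    also have "\<bar>\<dots>\<bar> \<le> cmod (Q s Z + D t (\<lambda>j x. w s j x - w t j x))" by (rule abs_Re_le_cmod)
    also have "\<dots> \<le> ?g s" by (rule order_trans[OF norm_triangle_ineq add_mono[OF 1 2]])
    finally show ?thesis .
  qed
  have "((\<lambda>s. (L2_sq N (w s) - L2_sq N (w t)) / (s - t) - 2 * Re (D t (w t))) \<longlongrightarrow> 0) (at t)"
  proof (rule Lim_null_comparison)
    show "\<forall>\<^sub>F s in at t. norm ((L2_sq N (w s) - L2_sq N (w t)) / (s - t) - 2 * Re (D t (w t))) \<le> ?g s"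
      unfolding eventually_at_filter real_norm_def using bound by (intro always_eventually) blast
    show "(?g \<longlongrightarrow> 0) (at t)" using lim unfolding mult_zero_left mult_zero_right add_0_left .
  qed
  then show ?thesis unfolding has_field_derivative_iff by (simp add: LIM_zero_iff)
qed

text \<open>Continuity bounds the norm near each point, and bounds on adjacent intervals combine to
  their maximum, so subdivision covers \<open>{a..b}\<close>.\<close>

lemma H1_norm_locally_bounded:
  assumes c: "continuous_H1 N \<alpha> w" and "a \<le> b"
  shows "\<exists>C. \<forall>s\<in>{a..b}. H1_norm N (w s) \<le> C"
  using \<open>a \<le> b\<close>
proof (induction rule: Bolzano)
  case (trans a b c)
  then obtain C C' where "\<forall>s\<in>{a..b}. H1_norm N (w s) \<le> C" "\<forall>s\<in>{b..c}. H1_norm N (w s) \<le> C'" by blast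
  then have "\<forall>s\<in>{a..c}. H1_norm N (w s) \<le> max C C'"
    by (metis atLeastAtMost_iff le_cases max.coboundedI1 max.coboundedI2)
  then show ?case ..
next
  case (local x)
  have wH: "\<And>t. w t \<in> H1_Gamma N \<alpha>" using c by (simp add: continuous_H1_def)
  have "((\<lambda>s. H1_norm N (\<lambda>j y. w s j y - w x j y)) \<longlongrightarrow> 0) (at x)" using c by (simp add: continuous_H1_def)
  then have "\<forall>\<^sub>F s in at x. H1_norm N (\<lambda>j y. w s j y - w x j y) < 1" by (rule order_tendstoD) simp
  then obtain d where d: "d > 0" "\<And>s. s \<noteq> x \<Longrightarrow> dist s x < d \<Longrightarrow> H1_norm N (\<lambda>j y. w s j y - w x j y) < 1"
    by (auto simp: eventually_at)
  have b: "H1_norm N (w s) \<le> sqrt (2 + 2 * (H1_norm N (w x))\<^sup>2)" if "dist s x < d" for s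
  proof (cases "s = x")
    case True then show ?thesis by (auto intro!: real_le_rsqrt)
  next
    case False
    let ?v = "\<lambda>j y. w s j y - w x j y"
    have "(H1_norm N ?v)\<^sup>2 \<le> 1\<^sup>2" using d(2)[OF False that] by (intro power_mono) (auto simp: H1_norm_nonneg)
    moreover have "(H1_norm N (w s))\<^sup>2 \<le> 2 * (H1_norm N ?v)\<^sup>2 + 2 * (H1_norm N (w x))\<^sup>2"
      using H1_norm_lincomb[OF H1_Gamma_diff[OF wH[of s] wH[of x]] wH[of x], of 1 1] by simp
    ultimately show ?thesis by (intro real_le_rsqrt) simp
  qed
  have "\<exists>C. \<forall>s\<in>{a..b}. H1_norm N (w s) \<le> C" if "a \<le> x \<and> x \<le> b \<and> b - a < d" for a b
    using that by (intro exI[of _ "sqrt (2 + 2 * (H1_norm N (w x))\<^sup>2)"] ballI b) (auto simp: dist_real_def)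
  with d(1) show ?case by blast
qed

text \<open>Multiplying by \<open>exp (- C * s)\<close> forwards and \<open>exp (C * s)\<close>
  backwards in time makes the energy monotone, so it cannot leave the value 0 in either
  direction.\<close>

lemma Gronwall_zero:
  fixes E E' :: "real \<Rightarrow> real"
  assumes der: "\<And>t. (E has_real_derivative E' t) (at t)" and nn: "\<And>t. 0 \<le> E t" and z: "E 0 = 0"
    and le: "\<And>s. \<bar>s\<bar> \<le> \<bar>t\<bar> \<Longrightarrow> \<bar>E' s\<bar> \<le> C * E s"
  shows "E t = 0"
proof (cases "t \<ge> 0")
  case True
  have "E t * exp (- C * t) \<le> E 0 * exp (- C * 0)"
  proof (rule DERIV_nonpos_imp_nonincreasing[where f="\<lambda>s. E s * exp (- C * s)", OF True])
    fix s assume s: "0 \<le> s" "s \<le> t"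
    have "((\<lambda>s. E s * exp (- C * s)) has_real_derivative (E' s - C * E s) * exp (- C * s)) (at s)"
      by (auto intro!: derivative_eq_intros der simp: algebra_simps)
    moreover have "(E' s - C * E s) * exp (- C * s) \<le> 0"
      using le[of s] s by (intro mult_nonpos_nonneg) auto
    ultimately show "\<exists>y. ((\<lambda>s. E s * exp (- C * s)) has_real_derivative y) (at s) \<and> y \<le> 0" by blast
  qed
  then have "E t * exp (- C * t) \<le> 0" using z by simp
  then have "E t \<le> 0" by (simp add: mult_le_0_iff)
  then show ?thesis using nn[of t] by simp
next
  case False
  have "E t * exp (C * t) \<le> E 0 * exp (C * 0)"
  proof (rule DERIV_nonneg_imp_nondecreasing[where f="\<lambda>s. E s * exp (C * s)"])
    fix s assume s: "t \<le> s" "s \<le> 0"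
    have "((\<lambda>s. E s * exp (C * s)) has_real_derivative (E' s + C * E s) * exp (C * s)) (at s)"
      by (auto intro!: derivative_eq_intros der simp: algebra_simps)
    moreover have "0 \<le> (E' s + C * E s) * exp (C * s)"
      using le[of s] s by (intro mult_nonneg_nonneg) auto
    ultimately show "\<exists>y. ((\<lambda>s. E s * exp (C * s)) has_real_derivative y) (at s) \<and> 0 \<le> y" by blast
  qed (use False in auto)
  then have "E t * exp (C * t) \<le> 0" using z by simp
  then have "E t \<le> 0" by (simp add: mult_le_0_iff)
  then show ?thesis using nn[of t] by simp
qed

section \<open>Estimates for the cubic term\<close>

lemma H1_Gamma_sup_bound:
  assumes W: "W \<in> H1_Gamma N \<alpha>" and j: "j \<in> {1..N}" and x: "x \<in> edge j"
  shows "(cmod (W j x))\<^sup>2 \<le> 2 * (H1_norm N W)\<^sup>2"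
proof -
  have "(cmod (W j x))\<^sup>2 \<le> 2 * (edge_sq j (W j) + edge_sq j (weak_deriv (edge j) (W j)))"
    using sup_bound[OF H1_GammaD(1)[OF W j] H1_GammaD(2)[OF W j] x] by (simp add: edge_sq_def)
  also have "\<dots> \<le> 2 * (H1_norm N W)\<^sup>2"
    unfolding H1_norm_sq using j
    by (intro mult_left_mono member_le_sum[where f="\<lambda>j. edge_sq j (W j) + edge_sq j (weak_deriv (edge j) (W j))"]) (auto simp: edge_sq_nonneg)
  finally show ?thesis .
qed

text \<open>Splitting off \<open>u - v\<close> from the cubic factor leaves the difference of the
  squared moduli times \<open>v\<close>. The first part contributes one \<open>m\<^sup>2\<close>,
  the second \<open>2 * m\<close> times \<open>m\<close>, together the factor 3.\<close>

lemma cubic_difference: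
  assumes "cmod u \<le> m" "cmod v \<le> m"
  shows "cmod (complex_of_real (a * (cmod u)\<^sup>2) * u - complex_of_real (a * (cmod v)\<^sup>2) * v) \<le> \<bar>a\<bar> * (3 * m\<^sup>2) * cmod (u - v)"
proof -
  have eq: "complex_of_real (a * (cmod u)\<^sup>2) * u - complex_of_real (a * (cmod v)\<^sup>2) * v =
    complex_of_real a * (complex_of_real ((cmod u)\<^sup>2) * (u - v) + complex_of_real ((cmod u)\<^sup>2 - (cmod v)\<^sup>2) * v)"
    by (simp add: algebra_simps)
  have d: "\<bar>(cmod u)\<^sup>2 - (cmod v)\<^sup>2\<bar> \<le> cmod (u - v) * (2 * m)"
  proof -
    have "\<bar>(cmod u)\<^sup>2 - (cmod v)\<^sup>2\<bar> = \<bar>cmod u - cmod v\<bar> * (cmod u + cmod v)"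
      by (simp add: power2_eq_square square_diff_square_factored abs_mult)
    also have "\<dots> \<le> cmod (u - v) * (2 * m)"
      using assms by (intro mult_mono norm_triangle_ineq3) auto
    finally show ?thesis .
  qed
  have "cmod (complex_of_real ((cmod u)\<^sup>2) * (u - v) + complex_of_real ((cmod u)\<^sup>2 - (cmod v)\<^sup>2) * v) \<le>
    (cmod u)\<^sup>2 * cmod (u - v) + \<bar>(cmod u)\<^sup>2 - (cmod v)\<^sup>2\<bar> * cmod v"
    by (rule order_trans[OF norm_triangle_ineq]) (simp only: norm_mult norm_of_real abs_power2 order_refl)
  also have "\<dots> \<le> m\<^sup>2 * cmod (u - v) + (cmod (u - v) * (2 * m)) * m"
    using assms d order_trans[OF norm_ge_zero assms(1)] by (intro add_mono mult_mono power_mono) auto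
  also have "\<dots> = 3 * m\<^sup>2 * cmod (u - v)" by (simp add: power2_eq_square)
  finally show ?thesis
    unfolding eq norm_mult norm_of_real by (simp add: mult_left_mono mult.assoc)
qed

lemma cubic_L2_star:
  assumes W: "W \<in> H1_Gamma N \<alpha>"
  shows "cubic \<beta> W \<in> L2_star N"
  unfolding L2_star_def
proof (intro CollectI ballI)
  fix j assume j: "j \<in> {1..N}"
  show "cubic \<beta> W j \<in> L2_on (edge j)"
  proof (rule L2_on_boundI[OF H1_GammaD(3)[OF W j]])
    show "set_borel_measurable lebesgue (edge j) (cubic \<beta> W j)"
      unfolding cubic_def by (intro set_borel_measurable_continuous continuous_intros H1_GammaD(2)[OF W j]) auto
    fix x assume x: "x \<in> edge j"
    have "cmod (cubic \<beta> W j x) = ((\<beta> j)\<^sup>2 * (cmod (W j x))\<^sup>2) * cmod (W j x)"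
      unfolding cubic_def norm_mult norm_of_real by (simp add: abs_mult)
    also have "\<dots> \<le> ((\<beta> j)\<^sup>2 * (2 * (H1_norm N W)\<^sup>2)) * cmod (W j x)"
      by (intro mult_right_mono mult_left_mono H1_Gamma_sup_bound[OF W j x]) auto
    finally show "cmod (cubic \<beta> W j x) \<le> ((\<beta> j)\<^sup>2 * (2 * (H1_norm N W)\<^sup>2)) * cmod (W j x)" .
  qed
qed

text \<open>The sup bound \<open>sqrt (2 * M\<^sup>2)\<close> inserted into the factor
  \<open>3 * m\<^sup>2\<close> gives \<open>6 * M\<^sup>2\<close>; the sum of all
  \<open>(\<beta> j)\<^sup>2\<close> dominates each coefficient, so one constant serves every
  edge.\<close>

lemma cubic_Lipschitz:
  assumes U: "U \<in> H1_Gamma N \<alpha>" "H1_norm N U \<le> M" and V: "V \<in> H1_Gamma N \<alpha>" "H1_norm N V \<le> M"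
  shows "cmod (L2_inner N (\<lambda>j x. cubic \<beta> U j x - cubic \<beta> V j x) (\<lambda>j x. U j x - V j x)) \<le>
     (\<Sum>j=1..N. (\<beta> j)\<^sup>2) * (6 * M\<^sup>2) * L2_sq N (\<lambda>j x. U j x - V j x)"
proof -
  let ?w = "\<lambda>j x. U j x - V j x" and ?K = "\<lambda>j x. cubic \<beta> U j x - cubic \<beta> V j x"
  define C where "C = (\<Sum>j=1..N. (\<beta> j)\<^sup>2) * (6 * M\<^sup>2)"
  have C0: "0 \<le> C" by (auto simp: C_def intro!: mult_nonneg_nonneg sum_nonneg)
  have M0: "0 \<le> M" using U(2) H1_norm_nonneg[of N U] by linarith
  have w: "?w \<in> L2_star N" by (intro H1_Gamma_L2_star[OF H1_Gamma_diff[OF U(1) V(1)]])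
  have K: "?K \<in> L2_star N" using L2_star_lincomb[OF cubic_L2_star[OF U(1)] cubic_L2_star[OF V(1)], of 1 _ "-1"] by simp
  have sb: "cmod (W j x) \<le> sqrt (2 * M\<^sup>2)" if "W \<in> H1_Gamma N \<alpha>" "H1_norm N W \<le> M" "j \<in> {1..N}" "x \<in> edge j" for W j x
    using H1_Gamma_sup_bound[OF that(1,3,4)] power_mono[OF that(2) H1_norm_nonneg, of 2] by (intro real_le_rsqrt) linarith
  have pt: "cmod (?K j x) \<le> cmod (complex_of_real C * ?w j x)" if "j \<in> {1..N}" "x \<in> edge j" for j x
  proof -
    have "cmod (?K j x) \<le> \<bar>(\<beta> j)\<^sup>2\<bar> * (3 * (sqrt (2 * M\<^sup>2))\<^sup>2) * cmod (?w j x)"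
      unfolding cubic_def by (rule cubic_difference[OF sb[OF U that] sb[OF V that]])
    also have "\<dots> = (\<beta> j)\<^sup>2 * (6 * M\<^sup>2) * cmod (?w j x)" by simp
    also have "\<dots> \<le> C * cmod (?w j x)"
      unfolding C_def using that(1) by (intro mult_right_mono member_le_sum) auto
    finally show ?thesis using C0 by (simp add: norm_mult)
  qed
  have "L2_sq N ?K \<le> (\<Sum>j=1..N. edge_sq j (\<lambda>x. complex_of_real C * ?w j x))"
    unfolding L2_sq_def using K w pt
    by (intro sum_mono edge_sq_mono L2_on_scale) (auto simp: L2_star_def)
  also have "\<dots> = C\<^sup>2 * L2_sq N ?w" by (simp add: edge_sq_scale L2_sq_def sum_distrib_left)
  finally have "sqrt (L2_sq N ?K) \<le> C * sqrt (L2_sq N ?w)"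
    using C0 by (metis real_sqrt_le_mono real_sqrt_mult real_sqrt_unique)
  then have "sqrt (L2_sq N ?K) * sqrt (L2_sq N ?w) \<le> C * sqrt (L2_sq N ?w) * sqrt (L2_sq N ?w)"
    by (intro mult_right_mono) (auto simp: L2_sq_nonneg)
  also have "\<dots> = C * L2_sq N ?w" by (simp add: L2_sq_nonneg)
  finally show ?thesis using L2_Cauchy_Schwarz[OF K w] unfolding C_def by linarith
qed

text \<open>A function vanishing a.e. on an edge has weak derivative 0, so \<open>sup_bound\<close>
  makes it vanish at every point. Off the edges it is 0 by the convention in
  \<open>star_functions\<close>.\<close>

lemma L2_sq_zero:
  assumes W: "W \<in> H1_Gamma N \<alpha>" and z: "L2_sq N W = 0"
  shows "W = (\<lambda>j x. 0)"
proof (intro ext)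
  fix j x
  show "W j x = 0"
  proof (cases "j \<in> {1..N} \<and> x \<in> edge j")
    case False then show ?thesis using W by (auto simp: H1_Gamma_def star_functions_def)
  next
    case True
    then have j: "j \<in> {1..N}" and x: "x \<in> edge j" by auto
    have "edge_sq j (W j) = 0"
      using z j sum_nonneg_eq_0_iff[of "{1..N}" "\<lambda>j. edge_sq j (W j)"] by (simp add: L2_sq_def edge_sq_nonneg)
    note L = H1_GammaD(3)[OF W j]
    have "integrable lebesgue (\<lambda>x. indicator (edge j) x *\<^sub>R (cmod (W j x))\<^sup>2)"
      using L2_onD(2)[OF L] by (simp add: set_integrable_def)
    then have "AE x in lebesgue. indicator (edge j) x *\<^sub>R (cmod (W j x))\<^sup>2 = 0"
      using \<open>edge_sq j (W j) = 0\<close> unfolding edge_sq_def set_lebesgue_integral_def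
      by (subst (asm) integral_nonneg_eq_0_iff_AE) auto
    then have ae: "AE x in lebesgue. x \<in> edge j \<longrightarrow> 0 = W j x" by eventually_elim (auto simp: indicator_def)
    have "is_weak_deriv (edge j) (\<lambda>x. 0) (\<lambda>x. 0)"
      by (simp add: is_weak_deriv_def L2_on_def set_borel_measurable_def set_integrable_def)
    from is_weak_deriv_cong_AE[OF this L ae] have "is_weak_deriv (edge j) (W j) (\<lambda>x. 0)" .
    from sup_bound[OF this H1_GammaD(2)[OF W j] x] \<open>edge_sq j (W j) = 0\<close>
    show ?thesis by (simp add: edge_sq_def)
  qed
qed

theorem nls_solution_unique:
  assumes bal: "balanced_star N \<alpha>" and P: "nls_solution N \<alpha> \<Psi>0 \<Psi>" and Q: "nls_solution N \<alpha> \<Psi>0 \<Phi>"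
  shows "\<Psi> = \<Phi>"
proof
  fix t
  obtain D L where c: "continuous_H1 N \<alpha> \<Psi>" and D: "has_C1_deriv_Hm1 N \<alpha> \<Psi> D" and L: "\<And>t. ext_laplacian N \<alpha> (\<Psi> t) (L t)"
    and eq: "\<And>t W. W \<in> H1_Gamma N \<alpha> \<Longrightarrow> \<i> * D t W = - L t W - 2 * L2_inner N (cubic \<alpha> (\<Psi> t)) W"
    using P unfolding nls_solution_def by blast
  obtain D' L' where c': "continuous_H1 N \<alpha> \<Phi>" and D': "has_C1_deriv_Hm1 N \<alpha> \<Phi> D'" and L': "\<And>t. ext_laplacian N \<alpha> (\<Phi> t) (L' t)"
    and eq': "\<And>t W. W \<in> H1_Gamma N \<alpha> \<Longrightarrow> \<i> * D' t W = - L' t W - 2 * L2_inner N (cubic \<alpha> (\<Phi> t)) W"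
    using Q unfolding nls_solution_def by blast
  have init: "\<Psi> 0 = \<Phi> 0" using P Q by (simp add: nls_solution_def)
  have N: "N \<ge> 1" using bal by (simp add: balanced_star_def)
  define w where "w t = (\<lambda>j x. \<Psi> t j x - \<Phi> t j x)" for t
  have H: "\<And>t. \<Psi> t \<in> H1_Gamma N \<alpha>" "\<And>t. \<Phi> t \<in> H1_Gamma N \<alpha>" using c c' by (auto simp: continuous_H1_def)
  have wH: "\<And>t. w t \<in> H1_Gamma N \<alpha>" unfolding w_def by (rule H1_Gamma_diff[OF H])
  have der: "((\<lambda>t. L2_sq N (w t)) has_real_derivative 2 * Re (D t (w t) - D' t (w t))) (at t)" for t
    unfolding w_def by (rule energy_derivative[OF continuous_H1_diff[OF c c'] has_C1_deriv_Hm1_diff[OF c c' D D']])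
  \<comment> \<open>The interval is symmetric because the Gronwall argument runs in both time
    directions.\<close>
  obtain M1 M2 where M: "\<forall>s\<in>{-\<bar>t\<bar>..\<bar>t\<bar>}. H1_norm N (\<Psi> s) \<le> M1" "\<forall>s\<in>{-\<bar>t\<bar>..\<bar>t\<bar>}. H1_norm N (\<Phi> s) \<le> M2"
    using H1_norm_locally_bounded[OF c, of "-\<bar>t\<bar>" "\<bar>t\<bar>"] H1_norm_locally_bounded[OF c', of "-\<bar>t\<bar>" "\<bar>t\<bar>"] by auto
  define M where "M = max M1 M2"
  define C where "C = (\<Sum>j=1..N. (\<alpha> j)\<^sup>2) * (6 * M\<^sup>2)"
  \<comment> \<open>The 4 is the 2 from differentiating a square times the 2 in front of the cubic
    term.\<close>
  have bound: "\<bar>2 * Re (D s (w s) - D' s (w s))\<bar> \<le> 4 * C * L2_sq N (w s)" if s: "\<bar>s\<bar> \<le> \<bar>t\<bar>" for s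
  proof -
    have "s \<in> {-\<bar>t\<bar>..\<bar>t\<bar>}" using s by auto
    then have b: "H1_norm N (\<Psi> s) \<le> M" "H1_norm N (\<Phi> s) \<le> M" using M by (auto simp: M_def max.coboundedI1 max.coboundedI2)
    let ?K = "L2_inner N (\<lambda>j x. cubic \<alpha> (\<Psi> s) j x - cubic \<alpha> (\<Phi> s) j x) (w s)"
    have K: "?K = L2_inner N (cubic \<alpha> (\<Psi> s)) (w s) - L2_inner N (cubic \<alpha> (\<Phi> s)) (w s)"
      by (intro L2_inner_diff_left cubic_L2_star[OF H(1)] cubic_L2_star[OF H(2)] H1_Gamma_L2_star[OF wH])
    have "\<i> * (D s (w s) - D' s (w s)) = - (L s (w s) - L' s (w s)) - 2 * ?K"
      unfolding K right_diff_distrib[of \<i>] eq[OF wH] eq'[OF wH] by (simp add: algebra_simps)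
    \<comment> \<open>The factor \<open>\<i>\<close> turns the real part on the left into an
      imaginary part, and there the Laplacian drops out.\<close>
    from arg_cong[OF this, of Im] have "Re (D s (w s) - D' s (w s)) = - Im (L s (w s) - L' s (w s)) - 2 * Im ?K" by simp
    moreover have "Im (L s (w s) - L' s (w s)) = 0"
      using ext_laplacian_real[OF ext_laplacian_diff[OF L L' N] bal, of s s] by (simp add: w_def)
    ultimately have "Re (D s (w s) - D' s (w s)) = - 2 * Im ?K" by simp
    moreover have "\<bar>Im ?K\<bar> \<le> C * L2_sq N (w s)"
      using abs_Im_le_cmod[of ?K] cubic_Lipschitz[OF H(1) b(1) H(2) b(2), of \<alpha>] unfolding C_def w_def by linarith
    ultimately show ?thesis by (simp add: abs_mult)
  qed
  have "L2_sq N (w t) = 0"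
  proof (rule Gronwall_zero[OF der _ _ bound])
    show "L2_sq N (w 0) = 0" by (simp add: w_def init L2_sq_def edge_sq_def)
  qed (rule L2_sq_nonneg)
  from L2_sq_zero[OF wH this] have "w t j x = 0" for j x by simp
  then show "\<Psi> t = \<Phi> t" by (auto simp: w_def fun_eq_iff)
qed

section \<open>Profiles with exponential decay\<close>

text \<open>The envelope is weaker than the decay \<open>exp (- \<bar>x\<bar>)\<close> of the soliton, to absorb the factor \<open>x\<close>
  produced by differentiating the phase with respect to \<open>v\<close>.\<close>

definition envelope :: "real \<Rightarrow> real" where "envelope x = exp (- \<bar>x\<bar> / 2)"

lemma envelope_pos: "0 < envelope x"
  by (simp add: envelope_def)

lemma continuous_envelope: "continuous_on S (\<lambda>x. complex_of_real (envelope x))"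
  unfolding envelope_def by (intro continuous_intros) auto

text \<open>The square of the envelope is \<open>exp (- \<bar>x\<bar>)\<close>, integrable on the
  right half-line and by reflection on the left one.\<close>

lemma envelope_L2: "(\<lambda>x. complex_of_real (envelope x)) \<in> L2_on (edge j)"
proof -
  have "(\<lambda>x::real. exp (- 1 * x)) integrable_on {0..}" by (rule integrable_on_exp_minus_to_infinity) simp
  then have "set_integrable lebesgue {0..} (\<lambda>x::real. exp (- x))"
    by (intro nonnegative_absolutely_integrable_1) auto
  then have i: "integrable lborel (\<lambda>x::real. indicator {0..} x *\<^sub>R exp (- x))"
    unfolding set_integrable_def by (subst (asm) integrable_completion) auto
  have r: "integrable lborel (\<lambda>x::real. indicator {0..} (0 + (-1) * x) *\<^sub>R exp (- (0 + (-1) * x)))"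
    by (rule lborel_integrable_real_affine[OF i]) simp
  have "integrable lborel (\<lambda>x::real. indicator (edge j) x *\<^sub>R (cmod (complex_of_real (envelope x)))\<^sup>2)"
  proof (cases "j = 1")
    case True
    show ?thesis using r
      by (rule iffD1[OF Bochner_Integration.integrable_cong[OF refl], rotated])
         (auto simp: True edge_def indicator_def envelope_def power2_eq_square mult_exp_exp)
  next
    case False
    show ?thesis using i
      by (rule iffD1[OF Bochner_Integration.integrable_cong[OF refl], rotated])
         (use False in \<open>auto simp: edge_def indicator_def envelope_def power2_eq_square mult_exp_exp\<close>)
  qed
  then have "set_integrable lebesgue (edge j) (\<lambda>x. (cmod (complex_of_real (envelope x)))\<^sup>2)"
    unfolding set_integrable_def by (subst integrable_completion) auto
  then show ?thesis
    by (simp add: L2_on_def set_borel_measurable_continuous[OF continuous_envelope])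
qed

text \<open>Continuity gives measurability and the bound gives square integrability with explicit
  dependence on \<open>C\<close>, so norm estimates reduce to pointwise ones.\<close>

definition envelope_bounded :: "real \<Rightarrow> (real \<Rightarrow> complex) \<Rightarrow> bool" where
  "envelope_bounded C f \<longleftrightarrow> continuous_on UNIV f \<and> (\<forall>x. cmod (f x) \<le> C * envelope x)"

lemma envelope_bounded_L2:
  assumes "envelope_bounded C f" shows "f \<in> L2_on (edge j)"
proof (rule L2_on_boundI[OF envelope_L2])
  show "set_borel_measurable lebesgue (edge j) f"
    using assms by (intro set_borel_measurable_continuous) (auto simp: envelope_bounded_def intro: continuous_on_subset)
  show "cmod (f x) \<le> C * cmod (complex_of_real (envelope x))" for x
    using assms envelope_pos[of x] by (simp add: envelope_bounded_def)
qed

lemma zero_notin_interior_edge: "0 \<notin> interior (edge j)"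
  by (auto simp: edge_def interior_real_atLeast interior_real_atMost)

text \<open>The ordinary fundamental theorem for \<open>f * \<phi>\<close> on a bounded interval
  outside of which the integrand vanishes on the edge.\<close>

lemma is_weak_deriv_of_classical:
  assumes der: "\<And>x. (f has_vector_derivative f' x) (at x)" and c: "continuous_on UNIV f'"
    and L: "f \<in> L2_on (edge j)" "f' \<in> L2_on (edge j)"
  shows "is_weak_deriv (edge j) f f'"
  unfolding is_weak_deriv_def
proof (intro conjI L ballI)
  fix \<phi> assume t: "\<phi> \<in> test_functions (edge j)"
  note T = test_function_facts[OF t]
  have cf: "continuous_on UNIV f" by (rule continuous_on_vector_derivative) (use der in auto)
  obtain K where K: "compact K" "K \<subseteq> interior (edge j)" "\<And>x. x \<notin> K \<Longrightarrow> \<phi> x = 0" "\<And>x. x \<notin> K \<Longrightarrow> deriv \<phi> x = 0"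
    by (rule test_function_support[OF t], rule that)
  obtain B where B: "\<And>x. x \<in> K \<Longrightarrow> \<bar>x\<bar> \<le> B" using compact_imp_bounded[OF K(1)] by (auto simp: bounded_iff)
  define R where "R = max B 0 + 1"
  have R: "R > 0" "\<And>x. \<bar>x\<bar> \<ge> R \<Longrightarrow> x \<notin> K" using B by (fastforce simp: R_def)+
  \<comment> \<open>One end point is the vertex, the other lies beyond \<open>K\<close>. The vertex
    is not interior to the edge, so it is not in \<open>K\<close> either, and no boundary term
    survives.\<close>
  obtain a b where ab: "a \<le> b" "a \<notin> K" "b \<notin> K" "{a..b} \<subseteq> edge j" "\<And>x. x \<in> edge j - {a..b} \<Longrightarrow> x \<notin> K"
  proof (cases "j = 1")
    case True show ?thesis
      by (rule that[of "-R" 0]) (use True R K(2) zero_notin_interior_edge[of j] in \<open>auto simp: edge_def\<close>)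
  next
    case False show ?thesis
      by (rule that[of 0 R]) (use False R K(2) zero_notin_interior_edge[of j] in \<open>auto simp: edge_def\<close>)
  qed
  define G where "G x = f x * complex_of_real (deriv \<phi> x) + f' x * complex_of_real (\<phi> x)" for x
  have "((\<lambda>x. f x * complex_of_real (\<phi> x)) has_vector_derivative G x) (at x within {a..b})" for x
  proof -
    have "((\<lambda>x. complex_of_real (\<phi> x)) has_vector_derivative complex_of_real (deriv \<phi> x)) (at x within {a..b})"
      using T(3)[of x] by (intro has_vector_derivative_of_real has_vector_derivative_at_within) (simp add: has_real_derivative_iff_has_vector_derivative)
    from has_vector_derivative_mult[OF has_vector_derivative_at_within[OF der] this] show ?thesis
      unfolding G_def .
  qed
  then have "(G has_integral (f b * complex_of_real (\<phi> b) - f a * complex_of_real (\<phi> a))) {a..b}"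
    by (intro fundamental_theorem_of_calculus ab) auto
  then have G0: "(G has_integral 0) {a..b}" using K(3) ab by simp
  have "continuous_on {a..b} G" unfolding G_def
    by (intro continuous_intros T continuous_on_subset[OF cf] continuous_on_subset[OF c]) auto
  from set_lebesgue_integral_eq_integral(2)[OF absolutely_integrable_continuous_real[OF this]]
  have "(LINT x:{a..b}|lebesgue. G x) = 0" using G0 by (simp add: integral_unique)
  moreover have "(LINT x:edge j|lebesgue. G x) = (LINT x:{a..b}|lebesgue. G x)"
    by (rule set_integral_support[OF ab(4)]) (use K ab(5) in \<open>auto simp: G_def\<close>)
  moreover have "(LINT x:edge j|lebesgue. G x) = (LINT x:edge j|lebesgue. f x * complex_of_real (deriv \<phi> x)) + (LINT x:edge j|lebesgue. f' x * complex_of_real (\<phi> x))"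
    unfolding G_def by (intro set_integral_add(2) L2_on_mult L T) auto
  ultimately show "(LINT x:edge j|lebesgue. f x * complex_of_real (deriv \<phi> x)) = - (LINT x:edge j|lebesgue. f' x * complex_of_real (\<phi> x))"
    by (simp add: eq_neg_iff_add_eq_0)
qed

lemma is_weak_deriv_cong:
  assumes "is_weak_deriv (edge j) f g" "\<And>x. x \<in> edge j \<Longrightarrow> f' x = f x" "\<And>x. x \<in> edge j \<Longrightarrow> g' x = g x"
  shows "is_weak_deriv (edge j) f' g'"
proof -
  have "f' \<in> L2_on (edge j)" "g' \<in> L2_on (edge j)"
    using assms L2_on_cong[of "edge j" f' f] L2_on_cong[of "edge j" g' g] by (auto simp: is_weak_deriv_def)
  moreover have "(LINT x:edge j|lebesgue. f' x * complex_of_real (h x)) = (LINT x:edge j|lebesgue. f x * complex_of_real (h x))"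
    "(LINT x:edge j|lebesgue. g' x * complex_of_real (h x)) = (LINT x:edge j|lebesgue. g x * complex_of_real (h x))" for h
    using assms by (auto intro!: set_lebesgue_integral_cong)
  ultimately show ?thesis using assms(1) by (simp add: is_weak_deriv_def)
qed

section \<open>Lifting functions from the line to the graph\<close>

lemma balanced_star_one: "balanced_star N \<alpha> \<Longrightarrow> 1 \<in> {1..N}"
  by (simp add: balanced_star_def)

lemma balanced_star_nonzero:
  assumes "balanced_star N \<alpha>" "j \<in> {1..N}" shows "\<alpha> j \<noteq> 0"
  using assms unfolding balanced_star_def by force

text \<open>Inverts the substitution u = \<alpha>_j \<psi>_j: edge 1 carries the left half of
  \<open>f\<close>, and each outgoing edge a copy of the right half. The value 0 elsewhere is the
  convention of \<open>star_functions\<close>.\<close>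

definition star_lift :: "nat \<Rightarrow> (nat \<Rightarrow> real) \<Rightarrow> (real \<Rightarrow> complex) \<Rightarrow> star_fun" where
  "star_lift N \<alpha> f = (\<lambda>j x. if j \<in> {1..N} \<and> x \<in> edge j then f x / complex_of_real (\<alpha> j) else 0)"

lemma star_lift_edge: "j \<in> {1..N} \<Longrightarrow> x \<in> edge j \<Longrightarrow> star_lift N \<alpha> f j x = f x / complex_of_real (\<alpha> j)"
  by (simp add: star_lift_def)

lemma star_lift_diff: "(\<lambda>j x. star_lift N \<alpha> f j x - star_lift N \<alpha> g j x) = star_lift N \<alpha> (\<lambda>x. f x - g x)"
  by (auto simp: star_lift_def fun_eq_iff diff_divide_distrib)

text \<open>The one constant, depending only on the graph, that converts a bound by
  \<open>C * envelope\<close> into a norm bound.\<close>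

definition lift_const :: "nat \<Rightarrow> (nat \<Rightarrow> real) \<Rightarrow> real" where
  "lift_const N \<alpha> = L2_sq N (star_lift N \<alpha> (\<lambda>x. complex_of_real (envelope x)))"

lemma star_lift_L2:
  assumes "envelope_bounded C f" shows "star_lift N \<alpha> f \<in> L2_star N"
  unfolding L2_star_def
proof (intro CollectI ballI)
  fix j assume j: "j \<in> {1..N}"
  have "(\<lambda>x. (1 / complex_of_real (\<alpha> j)) * f x) \<in> L2_on (edge j)"
    by (intro L2_on_scale envelope_bounded_L2[OF assms])
  then show "star_lift N \<alpha> f j \<in> L2_on (edge j)"
    using j by (subst L2_on_cong[where g="\<lambda>x. (1 / complex_of_real (\<alpha> j)) * f x"]) (auto simp: star_lift_edge)
qed

lemma envelope_bounded_envelope: "envelope_bounded 1 (\<lambda>x. complex_of_real (envelope x))"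
  unfolding envelope_bounded_def
  by (intro conjI allI continuous_envelope) (simp add: envelope_pos less_imp_le)

lemma star_lift_L2_sq:
  assumes "envelope_bounded C f" shows "L2_sq N (star_lift N \<alpha> f) \<le> C\<^sup>2 * lift_const N \<alpha>"
proof -
  let ?L = "star_lift N \<alpha>"
  have "edge_sq j (?L f j) \<le> C\<^sup>2 * edge_sq j (?L (\<lambda>x. complex_of_real (envelope x)) j)" if j: "j \<in> {1..N}" for j
  proof -
    have "edge_sq j (?L f j) \<le> edge_sq j (\<lambda>x. complex_of_real C * ?L (\<lambda>x. complex_of_real (envelope x)) j x)"
    proof (rule edge_sq_mono)
      show "?L f j \<in> L2_on (edge j)" using star_lift_L2[OF assms] j by (simp add: L2_star_def)
      show "(\<lambda>x. complex_of_real C * ?L (\<lambda>x. complex_of_real (envelope x)) j x) \<in> L2_on (edge j)"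
        using star_lift_L2[OF envelope_bounded_envelope] j by (intro L2_on_scale) (simp add: L2_star_def)
      fix x assume x: "x \<in> edge j"
      have "cmod (f x) \<le> \<bar>C\<bar> * envelope x"
        using assms envelope_pos[of x] by (auto simp: envelope_bounded_def intro: order_trans[OF _ mult_right_mono[of C "\<bar>C\<bar>"]])
      then show "cmod (?L f j x) \<le> cmod (complex_of_real C * ?L (\<lambda>x. complex_of_real (envelope x)) j x)"
        using envelope_pos[of x] by (simp add: star_lift_edge[OF j x] norm_divide norm_mult divide_right_mono)
    qed
    then show ?thesis by (simp add: edge_sq_scale)
  qed
  then show ?thesis unfolding lift_const_def L2_sq_def sum_distrib_left by (rule sum_mono)
qed

lemma lift_const_nonneg: "0 \<le> lift_const N \<alpha>"
  by (simp add: lift_const_def L2_sq_nonneg)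

lemma star_lift_weak_deriv:
  assumes "envelope_bounded C f" "envelope_bounded C' f'" "\<And>x. (f has_vector_derivative f' x) (at x)" "j \<in> {1..N}"
  shows "is_weak_deriv (edge j) (star_lift N \<alpha> f j) (star_lift N \<alpha> f' j)"
proof -
  have w: "is_weak_deriv (edge j) f f'"
    using assms by (intro is_weak_deriv_of_classical envelope_bounded_L2) (auto simp: envelope_bounded_def)
  show ?thesis
    by (rule is_weak_deriv_cong[OF is_weak_deriv_lincomb[OF w w, of "1 / complex_of_real (\<alpha> j)" 0]])
       (use assms(4) in \<open>auto simp: star_lift_edge\<close>)
qed

lemma star_lift_H1:
  assumes f: "envelope_bounded C f" "envelope_bounded C' f'" "\<And>x. (f has_vector_derivative f' x) (at x)"
    and bal: "balanced_star N \<alpha>"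
  shows "star_lift N \<alpha> f \<in> H1_Gamma N \<alpha>"
    and "H1_norm N (star_lift N \<alpha> f) = sqrt (L2_sq N (star_lift N \<alpha> f) + L2_sq N (star_lift N \<alpha> f'))"
proof -
  note a = balanced_star_one[OF bal] balanced_star_nonzero[OF bal]
  note w = star_lift_weak_deriv[OF f]
  show "star_lift N \<alpha> f \<in> H1_Gamma N \<alpha>"
    unfolding H1_Gamma_def
  proof (intro CollectI conjI ballI)
    show "star_lift N \<alpha> f \<in> star_functions N" by (auto simp: star_functions_def star_lift_def)
    fix j assume j: "j \<in> {1..N}"
    have "continuous_on (edge j) (\<lambda>x. f x / complex_of_real (\<alpha> j))"
      using f(1) a(2)[OF j] by (intro continuous_intros) (auto simp: envelope_bounded_def intro: continuous_on_subset)
    then have "continuous_on (edge j) (star_lift N \<alpha> f j)"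
      by (rule continuous_on_eq) (simp add: star_lift_edge[OF j])
    then show "star_lift N \<alpha> f j \<in> H1_on (edge j)" using w[OF j] by (auto simp: H1_on_def)
    show "complex_of_real (\<alpha> j) * star_lift N \<alpha> f j 0 = complex_of_real (\<alpha> 1) * star_lift N \<alpha> f 1 0"
      unfolding star_lift_edge[OF j zero_in_edge] star_lift_edge[OF a(1) zero_in_edge] using a(2)[OF j] a(2)[OF a(1)] by simp
  qed
  have "H1_norm N (star_lift N \<alpha> f) = sqrt (\<Sum>j=1..N. edge_sq j (star_lift N \<alpha> f j) + edge_sq j (star_lift N \<alpha> f' j))"
    by (rule H1_norm_eq) (rule w)
  then show "H1_norm N (star_lift N \<alpha> f) = sqrt (L2_sq N (star_lift N \<alpha> f) + L2_sq N (star_lift N \<alpha> f'))"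
    by (simp add: L2_sq_def sum.distrib)
qed

lemma star_lift_H1_norm_le:
  assumes f: "envelope_bounded C f" "envelope_bounded C f'" "\<And>x. (f has_vector_derivative f' x) (at x)"
    and bal: "balanced_star N \<alpha>" and C: "0 \<le> C"
  shows "H1_norm N (star_lift N \<alpha> f) \<le> C * sqrt (2 * lift_const N \<alpha>)"
proof -
  have "H1_norm N (star_lift N \<alpha> f) \<le> sqrt (C\<^sup>2 * (2 * lift_const N \<alpha>))"
    unfolding star_lift_H1(2)[OF f bal]
    using star_lift_L2_sq[OF f(1), of N \<alpha>] star_lift_L2_sq[OF f(2), of N \<alpha>] by (intro real_sqrt_le_mono) linarith
  also have "\<dots> = C * sqrt (2 * lift_const N \<alpha>)" using C by (simp add: real_sqrt_mult)
  finally show ?thesis .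
qed

text \<open>The lift already lies in the domain of the Laplacian: continuity of \<open>f\<close>
  gives the first vertex condition, continuity of \<open>f'\<close> and the balance of the weights
  give the second.\<close>

lemma star_lift_ext_laplacian:
  assumes f: "envelope_bounded C f" "envelope_bounded C' f'" "envelope_bounded C'' f''"
    "\<And>x. (f has_vector_derivative f' x) (at x)" "\<And>x. (f' has_vector_derivative f'' x) (at x)"
    and bal: "balanced_star N \<alpha>"
  shows "ext_laplacian N \<alpha> (star_lift N \<alpha> f) (L2_inner N (star_lift N \<alpha> f''))"
proof -
  let ?L = "star_lift N \<alpha>"
  note a = balanced_star_one[OF bal] balanced_star_nonzero[OF bal]
  have K: "1 / (\<alpha> 1)\<^sup>2 = (\<Sum>j=2..N. 1 / (\<alpha> j)\<^sup>2)" using bal by (simp add: balanced_star_def)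
  note w = star_lift_weak_deriv[OF f(1,2,4)] and w' = star_lift_weak_deriv[OF f(2,3,5)]
  note H1 = star_lift_H1(1)[OF f(1,2,4) bal] and H1' = star_lift_H1(1)[OF f(2,3,5) bal]
  have d0: "deriv_at_vertex (?L f) j = f' 0 / complex_of_real (\<alpha> j)" if j: "j \<in> {1..N}" for j
  proof -
    have "(?L f j has_vector_derivative ?L f' j 0) (at 0 within edge j)"
      by (rule weak_deriv_classical[OF w[OF j] H1_GammaD(2)[OF H1 j] H1_GammaD(2)[OF H1' j] zero_in_edge])
    then show ?thesis
      unfolding deriv_at_vertex_def star_lift_edge[OF j zero_in_edge] by (rule vector_derivative_within[OF not_trivial_edge])
  qed
  have "?L f \<in> H2_Gamma N \<alpha>"
    unfolding H2_Gamma_def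
  proof (intro CollectI conjI ballI H1)
    show "?L f j \<in> H2_on (edge j)" if "j \<in> {1..N}" for j
    proof -
      have "?L f j \<in> H1_on (edge j)" "?L f' j \<in> H1_on (edge j)"
        using H1 H1' that unfolding H1_Gamma_def by blast+
      then show ?thesis unfolding H2_on_def using w[OF that] by blast
    qed
    have "deriv_at_vertex (?L f) 1 / complex_of_real (\<alpha> 1) = f' 0 * complex_of_real (1 / (\<alpha> 1)\<^sup>2)"
      using d0[OF a(1)] by (simp add: power2_eq_square)
    \<comment> \<open>The balance condition: one factor \<open>1 / \<alpha> j\<close> comes from the
      lift, the other from the vertex condition.\<close>
    also have "\<dots> = (\<Sum>j=2..N. f' 0 * complex_of_real (1 / (\<alpha> j)\<^sup>2))"
      unfolding K of_real_sum sum_distrib_left ..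
    also have "\<dots> = (\<Sum>j=2..N. deriv_at_vertex (?L f) j / complex_of_real (\<alpha> j))"
      by (intro sum.cong) (auto simp: d0 power2_eq_square)
    finally show "deriv_at_vertex (?L f) 1 / complex_of_real (\<alpha> 1) = (\<Sum>j=2..N. deriv_at_vertex (?L f) j / complex_of_real (\<alpha> j))" .
  qed
  note H2 = this
  have lap: "L2_inner N (laplacian (?L f)) W = L2_inner N (?L f'') W" if "W \<in> H1_Gamma N \<alpha>" for W
    by (rule L2_inner_cong_AE[OF laplacian_L2_star[OF H2] star_lift_L2[OF f(3)] H1_Gamma_L2_star[OF that]])
       (unfold laplacian_def, rule weak_deriv_twice(2)[OF w w'])
  have z: "Hm1_norm N \<alpha> (\<lambda>W. L2_inner N (laplacian (?L f)) W - L2_inner N (?L f'') W) = 0"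
  proof (rule antisym)
    show "Hm1_norm N \<alpha> (\<lambda>W. L2_inner N (laplacian (?L f)) W - L2_inner N (?L f'') W) \<le> 0"
      by (rule Hm1_norm_le) (simp add: lap)
    show "0 \<le> Hm1_norm N \<alpha> (\<lambda>W. L2_inner N (laplacian (?L f)) W - L2_inner N (?L f'') W)"
      by (intro Hm1_norm_nonneg Hm1_Gamma_diff L2_inner_Hm1 laplacian_L2_star[OF H2] star_lift_L2[OF f(3)])
  qed
  show ?thesis
    unfolding ext_laplacian_def
    \<comment> \<open>A constant approximating sequence suffices.\<close>
    by (intro conjI exI[of _ "\<lambda>_. ?L f"] allI H1 H2 L2_inner_Hm1 star_lift_L2[OF f(3)])
       (simp_all add: z H1_norm_zero)
qed

text \<open>Pointwise Lipschitz bounds in time, relative to the envelope, integrate to Lipschitz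
  bounds in H^1. They are asked for only near \<open>t\<close>, as the constant of a moving profile
  depends on its position.\<close>

lemma continuous_H1_star_lift:
  assumes f: "\<And>t. envelope_bounded (C t) (f t)" "\<And>t. envelope_bounded (C' t) (f' t)" "\<And>t x. (f t has_vector_derivative f' t x) (at x)"
    and lip: "\<And>t. \<exists>K\<ge>0. \<forall>s. \<bar>s - t\<bar> \<le> 1 \<longrightarrow> envelope_bounded (K * \<bar>s - t\<bar>) (\<lambda>x. f s x - f t x) \<and>
          envelope_bounded (K * \<bar>s - t\<bar>) (\<lambda>x. f' s x - f' t x)"
    and bal: "balanced_star N \<alpha>"
  shows "continuous_H1 N \<alpha> (\<lambda>t. star_lift N \<alpha> (f t))"
  unfolding continuous_H1_def
proof (intro conjI allI star_lift_H1(1)[OF f bal])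
  fix t
  obtain K where K: "K \<ge> 0" "\<And>s. \<bar>s - t\<bar> \<le> 1 \<Longrightarrow> envelope_bounded (K * \<bar>s - t\<bar>) (\<lambda>x. f s x - f t x)"
      "\<And>s. \<bar>s - t\<bar> \<le> 1 \<Longrightarrow> envelope_bounded (K * \<bar>s - t\<bar>) (\<lambda>x. f' s x - f' t x)" using lip by blast
  show "((\<lambda>s. H1_norm N (\<lambda>j x. star_lift N \<alpha> (f s) j x - star_lift N \<alpha> (f t) j x)) \<longlongrightarrow> 0) (at t)"
    unfolding star_lift_diff
  proof (rule Lim_null_comparison)
    have "\<forall>\<^sub>F s in at t. \<bar>s - t\<bar> \<le> 1" unfolding eventually_at by (auto simp: dist_real_def intro!: exI[of _ 1])
    then show "\<forall>\<^sub>F s in at t. norm (H1_norm N (star_lift N \<alpha> (\<lambda>x. f s x - f t x))) \<le> K * \<bar>s - t\<bar> * sqrt (2 * lift_const N \<alpha>)"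
    proof eventually_elim
      case (elim s)
      have "H1_norm N (star_lift N \<alpha> (\<lambda>x. f s x - f t x)) \<le> K * \<bar>s - t\<bar> * sqrt (2 * lift_const N \<alpha>)"
        by (rule star_lift_H1_norm_le[OF K(2)[OF elim] K(3)[OF elim] has_vector_derivative_diff[OF f(3) f(3)] bal]) (use K in auto)
      then show ?case by (simp add: H1_norm_nonneg)
    qed
    show "((\<lambda>s. K * \<bar>s - t\<bar> * sqrt (2 * lift_const N \<alpha>)) \<longlongrightarrow> 0) (at t)"
      by (auto intro!: tendsto_eq_intros)
  qed
qed

text \<open>The pointwise remainder is quadratic in \<open>s - t\<close>, so the difference quotient
  converges even in L^2, and the L^2 norm controls the dual norm.\<close>

lemma has_C1_deriv_star_lift:
  assumes f: "\<And>t. envelope_bounded (C t) (f t)" "\<And>t. envelope_bounded (C' t) (g t)"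
    and lip: "\<And>t. \<exists>K\<ge>0. \<forall>s. \<bar>s - t\<bar> \<le> 1 \<longrightarrow> envelope_bounded (K * \<bar>s - t\<bar>) (\<lambda>x. g s x - g t x) \<and>
          envelope_bounded (K * \<bar>s - t\<bar>\<^sup>2) (\<lambda>x. f s x - f t x - complex_of_real (s - t) * g t x)"
  shows "has_C1_deriv_Hm1 N \<alpha> (\<lambda>t. star_lift N \<alpha> (f t)) (\<lambda>t. L2_inner N (star_lift N \<alpha> (g t)))"
  unfolding has_C1_deriv_Hm1_def
proof (intro conjI allI)
  let ?L = "star_lift N \<alpha>"
  fix t
  note Lf = star_lift_L2[OF f(1)] and Lg = star_lift_L2[OF f(2)]
  show "L2_inner N (?L (g t)) \<in> Hm1_Gamma N \<alpha>" by (intro L2_inner_Hm1 Lg)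
  obtain K where K: "K \<ge> 0" "\<And>s. \<bar>s - t\<bar> \<le> 1 \<Longrightarrow> envelope_bounded (K * \<bar>s - t\<bar>) (\<lambda>x. g s x - g t x)"
      "\<And>s. \<bar>s - t\<bar> \<le> 1 \<Longrightarrow> envelope_bounded (K * \<bar>s - t\<bar>\<^sup>2) (\<lambda>x. f s x - f t x - complex_of_real (s - t) * g t x)" using lip by blast
  have ev: "\<forall>\<^sub>F s in at t. \<bar>s - t\<bar> \<le> 1 \<and> s \<noteq> t" unfolding eventually_at by (auto simp: dist_real_def intro!: exI[of _ 1])
  have lim: "((\<lambda>s. K * \<bar>s - t\<bar> * sqrt (lift_const N \<alpha>)) \<longlongrightarrow> 0) (at t)"
    by (auto intro!: tendsto_eq_intros)
  have bd: "Hm1_norm N \<alpha> F \<le> K * \<bar>s - t\<bar> * sqrt (lift_const N \<alpha>)"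
    if h: "envelope_bounded (K * \<bar>s - t\<bar>) h" and F: "\<And>W. W \<in> H1_Gamma N \<alpha> \<Longrightarrow> F W = L2_inner N (?L h) W" for F h s
  proof (rule Hm1_norm_le)
    fix W assume W: "W \<in> H1_Gamma N \<alpha>" "H1_norm N W \<le> 1"
    have "cmod (F W) \<le> sqrt (L2_sq N (?L h)) * H1_norm N W"
      unfolding F[OF W(1)] by (rule L2_inner_H1_bound[OF star_lift_L2[OF h] W(1)])
    also have "\<dots> \<le> sqrt ((K * \<bar>s - t\<bar>)\<^sup>2 * lift_const N \<alpha>) * 1"
      by (intro mult_mono real_sqrt_le_mono star_lift_L2_sq[OF h] W) (auto simp: lift_const_nonneg H1_norm_nonneg)
    also have "\<dots> = K * \<bar>s - t\<bar> * sqrt (lift_const N \<alpha>)" using K(1) by (simp add: real_sqrt_mult abs_mult)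
    finally show "cmod (F W) \<le> K * \<bar>s - t\<bar> * sqrt (lift_const N \<alpha>)" .
  qed
  show "((\<lambda>s. Hm1_norm N \<alpha> (\<lambda>W. L2_inner N (?L (g s)) W - L2_inner N (?L (g t)) W)) \<longlongrightarrow> 0) (at t)"
  proof (rule Lim_null_comparison[OF _ lim])
    from ev show "\<forall>\<^sub>F s in at t. norm (Hm1_norm N \<alpha> (\<lambda>W. L2_inner N (?L (g s)) W - L2_inner N (?L (g t)) W)) \<le> K * \<bar>s - t\<bar> * sqrt (lift_const N \<alpha>)"
    proof eventually_elim
      case (elim s)
      have "0 \<le> Hm1_norm N \<alpha> (\<lambda>W. L2_inner N (?L (g s)) W - L2_inner N (?L (g t)) W)"
        by (intro Hm1_norm_nonneg Hm1_Gamma_diff L2_inner_Hm1 Lg)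
      moreover have "Hm1_norm N \<alpha> (\<lambda>W. L2_inner N (?L (g s)) W - L2_inner N (?L (g t)) W) \<le> K * \<bar>s - t\<bar> * sqrt (lift_const N \<alpha>)"
      proof (rule bd[OF K(2)])
        fix W assume "W \<in> H1_Gamma N \<alpha>"
        show "L2_inner N (?L (g s)) W - L2_inner N (?L (g t)) W = L2_inner N (?L (\<lambda>x. g s x - g t x)) W"
          unfolding star_lift_diff[symmetric] by (rule L2_inner_diff_left[OF Lg Lg H1_Gamma_L2_star, symmetric]) fact
      qed (use elim in simp)
      ultimately show ?case by simp
    qed
  qed
  show "((\<lambda>s. Hm1_norm N \<alpha> (\<lambda>W. (L2_inner N (?L (f s)) W - L2_inner N (?L (f t)) W) / complex_of_real (s - t) - L2_inner N (?L (g t)) W)) \<longlongrightarrow> 0) (at t)"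
  proof (rule Lim_null_comparison[OF _ lim])
    from ev show "\<forall>\<^sub>F s in at t. norm (Hm1_norm N \<alpha> (\<lambda>W. (L2_inner N (?L (f s)) W - L2_inner N (?L (f t)) W) / complex_of_real (s - t) - L2_inner N (?L (g t)) W)) \<le> K * \<bar>s - t\<bar> * sqrt (lift_const N \<alpha>)"
    proof eventually_elim
      case (elim s)
      \<comment> \<open>The remainder divided by \<open>s - t\<close>; one of its two factors
        \<open>\<bar>s - t\<bar>\<close> is left.\<close>
      define h where "h x = (1 / complex_of_real (s - t)) * (f s x - f t x - complex_of_real (s - t) * g t x)" for x
      have "envelope_bounded (K * \<bar>s - t\<bar>) h"
        unfolding envelope_bounded_def
      proof (intro conjI allI)
        have e: "envelope_bounded (K * \<bar>s - t\<bar>\<^sup>2) (\<lambda>x. f s x - f t x - complex_of_real (s - t) * g t x)" using K(3) elim by blast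
        show "continuous_on UNIV h" unfolding h_def by (intro continuous_on_mult continuous_on_const) (use e in \<open>simp add: envelope_bounded_def\<close>)
        fix x
        have "cmod (f s x - f t x - complex_of_real (s - t) * g t x) \<le> K * \<bar>s - t\<bar>\<^sup>2 * envelope x" using e unfolding envelope_bounded_def by blast
        then have "cmod (h x) \<le> (1 / \<bar>s - t\<bar>) * (K * \<bar>s - t\<bar>\<^sup>2 * envelope x)"
          unfolding h_def norm_mult norm_divide norm_of_real by (intro mult_mono) auto
        also have "\<dots> = K * \<bar>s - t\<bar> * envelope x"
        proof -
          have "1 / r * (K * r\<^sup>2 * envelope x) = K * r * envelope x" if "r \<noteq> 0" for r
            using that by (simp add: power2_eq_square)
          from this[of "\<bar>s - t\<bar>"] elim show ?thesis by (simp only: abs_eq_0 right_minus_eq) blast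
        qed
        finally show "cmod (h x) \<le> K * \<bar>s - t\<bar> * envelope x" .
      qed
      moreover have "(L2_inner N (?L (f s)) W - L2_inner N (?L (f t)) W) / complex_of_real (s - t) - L2_inner N (?L (g t)) W = L2_inner N (?L h) W"
        if "W \<in> H1_Gamma N \<alpha>" for W
      proof -
        note WL = H1_Gamma_L2_star[OF that]
        let ?c = "1 / complex_of_real (s - t)"
        let ?d = "\<lambda>j x. ?L (f s) j x - ?L (f t) j x"
        have "(\<lambda>j x. 1 * ?L (f s) j x + (-1) * ?L (f t) j x) \<in> L2_star N"
          by (rule L2_star_lincomb[OF Lf Lf])
        then have dL: "?d \<in> L2_star N" by simp
        \<comment> \<open>Here \<open>A\<close> stands for \<open>\<alpha> j\<close>; at
          \<open>A = 0\<close> both sides vanish by the convention for division by zero.\<close>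
        have "(1 / c) * (F - G - c * H) / A = (1 / c) * (F / A - G / A) + (-1) * (H / A)" if "c \<noteq> 0" for c F G H A :: complex
          using that by (cases "A = 0") (auto simp: field_simps)
        from this[of "complex_of_real (s - t)"] elim
        have "?L h = (\<lambda>j x. ?c * ?d j x + (-1) * ?L (g t) j x)"
          by (simp add: star_lift_def fun_eq_iff h_def)
        then have "L2_inner N (?L h) W = ?c * L2_inner N ?d W + (-1) * L2_inner N (?L (g t)) W"
          by (simp only: L2_inner_lincomb_left[OF dL Lg WL])
        also have "L2_inner N ?d W = L2_inner N (?L (f s)) W - L2_inner N (?L (f t)) W"
          by (rule L2_inner_diff_left[OF Lf Lf WL])
        finally show ?thesis by simp
      qed
      ultimately have "Hm1_norm N \<alpha> (\<lambda>W. (L2_inner N (?L (f s)) W - L2_inner N (?L (f t)) W) / complex_of_real (s - t) - L2_inner N (?L (g t)) W) \<le> K * \<bar>s - t\<bar> * sqrt (lift_const N \<alpha>)"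
        by (rule bd)
      moreover have "0 \<le> Hm1_norm N \<alpha> (\<lambda>W. (L2_inner N (?L (f s)) W - L2_inner N (?L (f t)) W) / complex_of_real (s - t) - L2_inner N (?L (g t)) W)"
        by (intro Hm1_norm_nonneg difference_quotient_Hm1 Lf L2_inner_Hm1 Lg)
      ultimately show ?case by simp
    qed
  qed
qed

section \<open>Travelling solitons\<close>

text \<open>The factor \<open>a + b * tanh \<xi>\<close> makes room for derivatives: the soliton is
  the case \<open>(a, b) = (1, 0)\<close>, and its first derivatives in time and space are again
  pulses with the same phase and centre. Bounds proved for general \<open>a\<close>,
  \<open>b\<close> thus apply to them as well.\<close>

definition pulse :: "real \<Rightarrow> real \<Rightarrow> complex \<Rightarrow> complex \<Rightarrow> complex" where
  "pulse p \<xi> a b = exp (\<i> * complex_of_real p) * complex_of_real (1 / cosh \<xi>) * (a + b * complex_of_real (tanh \<xi>))"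

text \<open>Derivative along a line on which the phase grows at rate \<open>p1\<close> and the
  argument at rate \<open>x1\<close>, so that one formula covers differentiation in \<open>t\<close>
  and in \<open>x\<close>.\<close>

definition pulse_deriv :: "real \<Rightarrow> real \<Rightarrow> real \<Rightarrow> real \<Rightarrow> complex \<Rightarrow> complex \<Rightarrow> complex" where
  "pulse_deriv p1 x1 p \<xi> a b = exp (\<i> * complex_of_real p) * complex_of_real (1 / cosh \<xi>) *
     ((\<i> * complex_of_real p1 - complex_of_real (x1 * tanh \<xi>)) * (a + b * complex_of_real (tanh \<xi>)) +
      b * complex_of_real (x1 * (1 - (tanh \<xi>)\<^sup>2)))"

lemma has_vector_derivative_pulse:
  "((\<lambda>r. pulse (p0 + p1 * r) (x0 + x1 * r) a b) has_vector_derivative pulse_deriv p1 x1 (p0 + p1 * r) (x0 + x1 * r) a b) (at r)"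
proof -
  define p where "p = (\<lambda>r. p0 + p1 * r)"
  define \<xi> where "\<xi> = (\<lambda>r. x0 + x1 * r)"
  have "((\<lambda>r. \<i> * complex_of_real (p r)) has_vector_derivative \<i> * complex_of_real p1) (at r)"
    unfolding p_def
    by (intro has_vector_derivative_mult_right has_vector_derivative_of_real)
       (auto intro!: derivative_eq_intros simp: has_real_derivative_iff_has_vector_derivative[symmetric])
  from field_vector_diff_chain_at[OF this DERIV_exp]
  have 1: "((\<lambda>r. exp (\<i> * complex_of_real (p r))) has_vector_derivative \<i> * complex_of_real p1 * exp (\<i> * complex_of_real (p r))) (at r)"
    by (simp add: o_def)
  have c: "cosh (\<xi> r) \<noteq> 0" using cosh_real_pos[of "\<xi> r"] by linarith
  have "((\<lambda>r. 1 / cosh (\<xi> r)) has_real_derivative - (x1 * tanh (\<xi> r)) * (1 / cosh (\<xi> r))) (at r)"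
    using c unfolding \<xi>_def by (auto intro!: derivative_eq_intros simp: tanh_def field_simps)
  then have 2: "((\<lambda>r. complex_of_real (1 / cosh (\<xi> r))) has_vector_derivative complex_of_real (- (x1 * tanh (\<xi> r)) * (1 / cosh (\<xi> r)))) (at r)"
    by (intro has_vector_derivative_of_real) (simp add: has_real_derivative_iff_has_vector_derivative)
  have "((\<lambda>r. tanh (\<xi> r)) has_real_derivative x1 * (1 - (tanh (\<xi> r))\<^sup>2)) (at r)"
    using c unfolding \<xi>_def by (auto intro!: derivative_eq_intros)
  then have 3: "((\<lambda>r. complex_of_real (tanh (\<xi> r))) has_vector_derivative complex_of_real (x1 * (1 - (tanh (\<xi> r))\<^sup>2))) (at r)"
    by (intro has_vector_derivative_of_real) (simp add: has_real_derivative_iff_has_vector_derivative)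
  have 4: "((\<lambda>r. a + b * complex_of_real (tanh (\<xi> r))) has_vector_derivative (0 + b * complex_of_real (x1 * (1 - (tanh (\<xi> r))\<^sup>2)))) (at r)"
    by (intro has_vector_derivative_add has_vector_derivative_const has_vector_derivative_mult_right 3)
  have "((\<lambda>r. pulse (p r) (\<xi> r) a b) has_vector_derivative pulse_deriv p1 x1 (p r) (\<xi> r) a b) (at r)"
    unfolding pulse_def
    by (rule has_vector_derivative_eq_rhs[OF has_vector_derivative_mult[OF has_vector_derivative_mult[OF 1 2] 4]])
       (simp add: pulse_deriv_def algebra_simps add_divide_distrib)
  then show ?thesis by (simp add: p_def \<xi>_def)
qed

lemma abs_tanh_le_1: "\<bar>tanh (x::real)\<bar> \<le> 1"
  using tanh_real_bounds[of x] by auto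

text \<open>\<open>cosh\<close> is at least half of \<open>exp \<bar>y\<bar>\<close>, and moving the
  centre by \<open>c\<close> costs at most the factor \<open>exp \<bar>c\<bar>\<close>.\<close>

lemma sech_le_envelope: "1 / cosh (x - c) \<le> 2 * exp \<bar>c\<bar> * envelope x"
proof -
  have "exp \<bar>y\<bar> \<le> 2 * cosh y" for y :: real
    by (simp add: cosh_def abs_if)
  from this[of "x - c"] have "1 / cosh (x - c) \<le> 2 / exp \<bar>x - c\<bar>"
    by (simp add: field_simps)
  also have "\<dots> = 2 * exp (- \<bar>x - c\<bar>)" by (simp add: exp_minus field_simps)
  also have "\<dots> \<le> 2 * exp (\<bar>c\<bar> + - \<bar>x\<bar> / 2)" by simp
  also have "\<dots> = 2 * exp \<bar>c\<bar> * envelope x" unfolding envelope_def exp_add by simp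
  finally show ?thesis .
qed

lemma cmod_pulse: "cmod (pulse p \<xi> a b) \<le> (cmod a + cmod b) * (1 / cosh \<xi>)"
proof -
  have "cmod (a + b * complex_of_real (tanh \<xi>)) \<le> cmod a + cmod b * 1"
    by (rule order_trans[OF norm_triangle_ineq]) (simp add: norm_mult mult_left_le abs_tanh_le_1)
  then show ?thesis
    by (simp add: pulse_def norm_mult norm_divide divide_right_mono)
qed

definition wave :: "real \<Rightarrow> complex \<Rightarrow> complex \<Rightarrow> real \<Rightarrow> real \<Rightarrow> complex" where
  "wave v a b t x = pulse (v * x + (1 - v\<^sup>2) * t) (x - 2 * v * t) a b"

definition wave_t :: "real \<Rightarrow> complex \<Rightarrow> complex \<Rightarrow> real \<Rightarrow> real \<Rightarrow> complex" where
  "wave_t v a b t x = pulse_deriv (1 - v\<^sup>2) (- 2 * v) (v * x + (1 - v\<^sup>2) * t) (x - 2 * v * t) a b"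

definition wave_x :: "real \<Rightarrow> complex \<Rightarrow> complex \<Rightarrow> real \<Rightarrow> real \<Rightarrow> complex" where
  "wave_x v a b t x = pulse_deriv v 1 (v * x + (1 - v\<^sup>2) * t) (x - 2 * v * t) a b"

lemma wave_t: "((\<lambda>t. wave v a b t x) has_vector_derivative wave_t v a b t x) (at t)"
  using has_vector_derivative_pulse[of "v * x" "1 - v\<^sup>2" x "- 2 * v" a b t] by (simp add: wave_def wave_t_def)

lemma wave_x: "(wave v a b t has_vector_derivative wave_x v a b t x) (at x)"
  using has_vector_derivative_pulse[of "(1 - v\<^sup>2) * t" v "- 2 * v * t" 1 a b x]
  by (simp add: wave_def[abs_def] wave_x_def add.commute)

lemma cmod_pulse_deriv:
  "cmod (pulse_deriv p1 x1 p \<xi> a b) \<le> ((\<bar>p1\<bar> + \<bar>x1\<bar>) * (cmod a + cmod b) + cmod b * \<bar>x1\<bar>) * (1 / cosh \<xi>)"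
proof -
  have "cmod (a + b * complex_of_real (tanh \<xi>)) \<le> cmod a + cmod b * 1"
    by (rule order_trans[OF norm_triangle_ineq]) (simp add: norm_mult mult_left_le abs_tanh_le_1)
  moreover have "cmod (\<i> * complex_of_real p1 - complex_of_real (x1 * tanh \<xi>)) \<le> \<bar>p1\<bar> + \<bar>x1\<bar> * 1"
    by (rule order_trans[OF norm_triangle_ineq4]) (simp add: norm_mult abs_mult mult_left_le abs_tanh_le_1)
  moreover have "cmod (b * complex_of_real (x1 * (1 - (tanh \<xi>)\<^sup>2))) \<le> cmod b * \<bar>x1\<bar>"
  proof -
    have "(tanh \<xi>)\<^sup>2 \<le> 1" using abs_tanh_le_1[of \<xi>] by (simp add: abs_square_le_1)
    then have "\<bar>x1\<bar> * \<bar>1 - (tanh \<xi>)\<^sup>2\<bar> \<le> \<bar>x1\<bar> * 1" by (intro mult_left_mono) auto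
    then show ?thesis unfolding norm_mult norm_of_real abs_mult by (intro mult_left_mono) auto
  qed
  ultimately have "cmod ((\<i> * complex_of_real p1 - complex_of_real (x1 * tanh \<xi>)) * (a + b * complex_of_real (tanh \<xi>)) +
      b * complex_of_real (x1 * (1 - (tanh \<xi>)\<^sup>2))) \<le> (\<bar>p1\<bar> + \<bar>x1\<bar>) * (cmod a + cmod b) + cmod b * \<bar>x1\<bar>"
    by (intro order_trans[OF norm_triangle_ineq] add_mono, unfold norm_mult[of "\<i> * complex_of_real p1 - complex_of_real (x1 * tanh \<xi>)"])
       (intro mult_mono, auto)
  then show ?thesis
    unfolding pulse_deriv_def norm_mult[of "exp (\<i> * complex_of_real p) * complex_of_real (1 / cosh \<xi>)"] norm_mult[of "exp (\<i> * complex_of_real p)"]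
    by (simp add: norm_divide divide_right_mono)
qed

lemma wave_continuous: "continuous_on UNIV (wave v a b t)" "continuous_on UNIV (wave_x v a b t)"
proof -
  have c: "cosh (y::real) \<noteq> 0" for y using cosh_real_pos[of y] by linarith
  show "continuous_on UNIV (wave v a b t)" "continuous_on UNIV (wave_x v a b t)"
    unfolding wave_def[abs_def] wave_x_def[abs_def] pulse_def pulse_deriv_def by (intro continuous_intros; simp add: c)+
qed

lemma wave_le_envelope:
  assumes "\<And>p \<xi>. cmod (P p \<xi>) \<le> A * (1 / cosh \<xi>)" "0 \<le> A" "\<bar>c\<bar> \<le> B"
  shows "cmod (P p (x - c)) \<le> A * (2 * exp B) * envelope x"
proof -
  have "cmod (P p (x - c)) \<le> A * (2 * exp \<bar>c\<bar> * envelope x)"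
    by (rule order_trans[OF assms(1) mult_left_mono[OF sech_le_envelope assms(2)]])
  also have "\<dots> \<le> A * (2 * exp B * envelope x)"
    using assms(2,3) envelope_pos[of x] by (intro mult_left_mono mult_right_mono) auto
  finally show ?thesis by (simp add: mult.assoc)
qed

lemma wave_bounded: "\<exists>C. envelope_bounded C (wave v a b t)" "\<exists>C. envelope_bounded C (wave_x v a b t)"
proof -
  have "cmod (wave v a b t x) \<le> (cmod a + cmod b) * (2 * exp \<bar>2 * v * t\<bar>) * envelope x" for x
    unfolding wave_def by (rule wave_le_envelope[OF cmod_pulse]) auto
  then show "\<exists>C. envelope_bounded C (wave v a b t)"
    using wave_continuous unfolding envelope_bounded_def by blast
  have "cmod (wave_x v a b t x) \<le> ((\<bar>v\<bar> + \<bar>1\<bar>) * (cmod a + cmod b) + cmod b * \<bar>1\<bar>) * (2 * exp \<bar>2 * v * t\<bar>) * envelope x" for x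
    unfolding wave_x_def by (rule wave_le_envelope[OF cmod_pulse_deriv]) auto
  then show "\<exists>C. envelope_bounded C (wave_x v a b t)"
    using wave_continuous unfolding envelope_bounded_def by blast
qed

text \<open>For times within 1 of \<open>t\<close> the centre stays within
  \<open>2 * \<bar>v\<bar> * (\<bar>t\<bar> + 1)\<close> of the vertex, which bounds the cost of the
  shift uniformly.\<close>

lemma wave_t_bounded: "\<exists>C\<ge>0. \<forall>s x. \<bar>s - t\<bar> \<le> 1 \<longrightarrow> cmod (wave_t v a b s x) \<le> C * envelope x"
proof -
  let ?A = "(\<bar>1 - v\<^sup>2\<bar> + \<bar>- 2 * v\<bar>) * (cmod a + cmod b) + cmod b * \<bar>- 2 * v\<bar>"
  have A: "0 \<le> ?A" by simp
  have "cmod (wave_t v a b s x) \<le> ?A * (2 * exp (2 * \<bar>v\<bar> * (\<bar>t\<bar> + 1))) * envelope x" if "\<bar>s - t\<bar> \<le> 1" for s x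
    unfolding wave_t_def
  proof (rule wave_le_envelope[OF cmod_pulse_deriv A])
    have "\<bar>s\<bar> \<le> \<bar>t\<bar> + 1" using that by linarith
    then show "\<bar>2 * v * s\<bar> \<le> 2 * \<bar>v\<bar> * (\<bar>t\<bar> + 1)" by (simp add: abs_mult mult_left_mono)
  qed
  moreover have "0 \<le> ?A * (2 * exp (2 * \<bar>v\<bar> * (\<bar>t\<bar> + 1)))" using A by (intro mult_nonneg_nonneg) auto
  ultimately show ?thesis by blast
qed

text \<open>Mean value inequality for the remainder. A bounded \<open>B\<close> yields the Lipschitz
  estimate; a Lipschitz \<open>B\<close> yields the quadratic remainder.\<close>

lemma wave_linearization:
  assumes B: "\<And>r. r \<in> closed_segment t s \<Longrightarrow> cmod (wave_t v a b r x - wave_t v a b t x) \<le> B"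
  shows "cmod (wave v a b s x - wave v a b t x - complex_of_real (s - t) * wave_t v a b t x) \<le> \<bar>s - t\<bar> * B"
  using vector_differentiable_bound_linearization[of "closed_segment t s" "\<lambda>t. wave v a b t x" "\<lambda>t. wave_t v a b t x" t s t B] B
  by (simp add: has_vector_derivative_at_within[OF wave_t] scaleR_conv_of_real)

lemma segment_dist: "r \<in> closed_segment t s \<Longrightarrow> \<bar>r - t\<bar> \<le> \<bar>s - (t::real)\<bar>"
  by (auto simp: closed_segment_eq_real_ivl split: if_splits)

lemma wave_Lipschitz:
  "\<exists>K\<ge>0. \<forall>s x. \<bar>s - t\<bar> \<le> 1 \<longrightarrow> cmod (wave v a b s x - wave v a b t x) \<le> K * \<bar>s - t\<bar> * envelope x"
proof -
  obtain C where C: "C \<ge> 0" "\<And>s x. \<bar>s - t\<bar> \<le> 1 \<Longrightarrow> cmod (wave_t v a b s x) \<le> C * envelope x"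
    using wave_t_bounded[of t v a b] by blast
  \<comment> \<open>The 3 consists of 2 from the remainder, where both derivatives are bounded by
    \<open>C\<close>, and 1 from the linear term.\<close>
  have "cmod (wave v a b s x - wave v a b t x) \<le> (3 * C) * \<bar>s - t\<bar> * envelope x" if s: "\<bar>s - t\<bar> \<le> 1" for s x
  proof -
    have "cmod (wave v a b s x - wave v a b t x - complex_of_real (s - t) * wave_t v a b t x) \<le> \<bar>s - t\<bar> * (2 * C * envelope x)"
    proof (rule wave_linearization)
      fix r assume "r \<in> closed_segment t s"
      then have "\<bar>r - t\<bar> \<le> 1" using segment_dist s by fastforce
      then show "cmod (wave_t v a b r x - wave_t v a b t x) \<le> 2 * C * envelope x"
        using C(2)[of r x] C(2)[of t x] norm_triangle_ineq4[of "wave_t v a b r x" "wave_t v a b t x"] by simp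
    qed
    moreover have "cmod (complex_of_real (s - t) * wave_t v a b t x) \<le> \<bar>s - t\<bar> * (C * envelope x)"
      unfolding norm_mult norm_of_real by (intro mult_left_mono C(2)) auto
    ultimately show ?thesis
      using norm_triangle_ineq[of "wave v a b s x - wave v a b t x - complex_of_real (s - t) * wave_t v a b t x" "complex_of_real (s - t) * wave_t v a b t x"]
      by (simp add: algebra_simps)
  qed
  then show ?thesis using C(1) by (intro exI[of _ "3 * C"]) auto
qed

text \<open>The time derivative of the soliton is itself a wave, so \<open>wave_Lipschitz\<close>
  applies to it too.\<close>

lemma wave_t_phase: "wave_t v 1 0 t x = wave v (\<i> * complex_of_real (1 - v\<^sup>2)) (complex_of_real (2 * v)) t x"
  by (simp add: wave_t_def wave_def pulse_deriv_def pulse_def)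

lemma wave_x_phase: "wave_x v 1 0 t x = wave v (\<i> * complex_of_real v) (- 1) t x"
  by (simp add: wave_x_def wave_def pulse_deriv_def pulse_def)

lemma sech_sq: "(1 / cosh (y::real))\<^sup>2 = 1 - (tanh y)\<^sup>2"
proof -
  have "cosh y \<noteq> 0" using cosh_real_pos[of y] by linarith
  have "(1 / cosh y)\<^sup>2 = ((cosh y)\<^sup>2 - (sinh y)\<^sup>2) / (cosh y)\<^sup>2"
    using cosh_square_eq[of y] by (simp add: power_divide)
  also have "\<dots> = 1 - (tanh y)\<^sup>2"
    unfolding diff_divide_distrib tanh_def power_divide using \<open>cosh y \<noteq> 0\<close> by simp
  finally show ?thesis .
qed

lemma cmod_wave: "cmod (wave v 1 0 t x) = 1 / cosh (x - 2 * v * t)"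
  by (simp add: wave_def pulse_def norm_mult norm_divide)

text \<open>Every term is a multiple of the soliton \<open>E\<close>, and its squared modulus is
  \<open>1 - T\<^sup>2\<close>. What remains is a polynomial identity in \<open>V\<close> and
  \<open>T\<close>, and the frequency \<open>1 - v\<^sup>2\<close> is what makes it hold.\<close>

lemma wave_nls:
  "\<i> * wave_t v 1 0 t x + wave_x v (\<i> * complex_of_real v) (- 1) t x +
     2 * (complex_of_real ((cmod (wave v 1 0 t x))\<^sup>2) * wave v 1 0 t x) = 0"
proof -
  define E where "E = exp (\<i> * complex_of_real (v * x + (1 - v\<^sup>2) * t)) * complex_of_real (1 / cosh (x - 2 * v * t))"
  define T where "T = complex_of_real (tanh (x - 2 * v * t))"
  define V where "V = complex_of_real v"
  have 1: "wave_t v 1 0 t x = E * (\<i> * (1 - V\<^sup>2) + 2 * V * T)"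
    by (simp add: wave_t_def pulse_deriv_def E_def T_def V_def)
  have 2: "wave_x v (\<i> * complex_of_real v) (- 1) t x = E * ((\<i> * V - T) * (\<i> * V - T) - (1 - T\<^sup>2))"
    by (simp add: wave_x_def pulse_deriv_def E_def T_def V_def)
  have 3: "wave v 1 0 t x = E" by (simp add: wave_def pulse_def E_def)
  have 4: "complex_of_real ((cmod (wave v 1 0 t x))\<^sup>2) = 1 - T\<^sup>2"
    unfolding cmod_wave sech_sq by (simp add: T_def)
  show ?thesis unfolding 4 unfolding 1 2 3 by (simp add: algebra_simps power2_eq_square)
qed

definition travelling_soliton :: "nat \<Rightarrow> (nat \<Rightarrow> real) \<Rightarrow> real \<Rightarrow> real \<Rightarrow> star_fun" where
  "travelling_soliton N \<alpha> v t = star_lift N \<alpha> (wave v 1 0 t)"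

text \<open>The time derivative and the Laplacian are the lifts of the classical derivatives on the
  line, so the weak equation follows from a pointwise one on each edge.\<close>

theorem travelling_soliton_solution:
  assumes bal: "balanced_star N \<alpha>"
  shows "nls_solution N \<alpha> (travelling_soliton N \<alpha> v 0) (travelling_soliton N \<alpha> v)"
proof -
  let ?S = "travelling_soliton N \<alpha> v"
  let ?L = "star_lift N \<alpha>"
  \<comment> \<open>\<open>?a\<close>, \<open>?b\<close> are the coefficients of the time derivative
    as a wave; \<open>?c\<close> and -1 are those of the space derivative.\<close>
  let ?a = "\<i> * complex_of_real (1 - v\<^sup>2)" and ?b = "complex_of_real (2 * v)" and ?c = "\<i> * complex_of_real v"
  obtain C where C: "\<And>a b t. envelope_bounded (C a b t) (wave v a b t)"
    using wave_bounded(1)[of v] by metis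
  obtain C' where C': "\<And>a b t. envelope_bounded (C' a b t) (wave_x v a b t)"
    using wave_bounded(2)[of v] by metis
  have dx: "(wave v 1 0 t has_vector_derivative wave v ?c (-1) t x) (at x)" for t x
    using wave_x[of v 1 0 t x] by (simp add: wave_x_phase)
  have lip: "\<exists>K\<ge>0. \<forall>s. \<bar>s - t\<bar> \<le> 1 \<longrightarrow> envelope_bounded (K * \<bar>s - t\<bar>) (\<lambda>x. wave v a b s x - wave v a b t x)" for a b t
    using wave_Lipschitz[of t v a b] unfolding envelope_bounded_def
    by (auto intro!: continuous_on_diff wave_continuous simp: mult.assoc)
  have cont: "continuous_H1 N \<alpha> (?S)"
    unfolding travelling_soliton_def[abs_def]
  proof (rule continuous_H1_star_lift[OF C C dx _ bal])
    fix t
    obtain K1 K2 where K: "K1 \<ge> 0" "K2 \<ge> 0" "\<And>s. \<bar>s - t\<bar> \<le> 1 \<Longrightarrow> envelope_bounded (K1 * \<bar>s - t\<bar>) (\<lambda>x. wave v 1 0 s x - wave v 1 0 t x)"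
      "\<And>s. \<bar>s - t\<bar> \<le> 1 \<Longrightarrow> envelope_bounded (K2 * \<bar>s - t\<bar>) (\<lambda>x. wave v ?c (-1) s x - wave v ?c (-1) t x)"
      using lip[of t 1 0] lip[of t ?c "-1"] by blast
    have mono: "envelope_bounded (max K1 K2 * \<bar>s - t\<bar>) f" if "envelope_bounded (K * \<bar>s - t\<bar>) f" "K \<le> max K1 K2" for K s f
    proof -
      have "K * \<bar>s - t\<bar> * envelope x \<le> max K1 K2 * \<bar>s - t\<bar> * envelope x" for x
        using that(2) envelope_pos[of x] by (intro mult_right_mono) auto
      then show ?thesis using that(1) unfolding envelope_bounded_def by (meson order_trans)
    qed
    show "\<exists>K\<ge>0. \<forall>s. \<bar>s - t\<bar> \<le> 1 \<longrightarrow> envelope_bounded (K * \<bar>s - t\<bar>) (\<lambda>x. wave v 1 0 s x - wave v 1 0 t x) \<and>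
        envelope_bounded (K * \<bar>s - t\<bar>) (\<lambda>x. wave v ?c (-1) s x - wave v ?c (-1) t x)"
    proof (intro exI[of _ "max K1 K2"] conjI allI impI)
      show "0 \<le> max K1 K2" using K(1) by simp
      fix s assume s: "\<bar>s - t\<bar> \<le> 1"
      show "envelope_bounded (max K1 K2 * \<bar>s - t\<bar>) (\<lambda>x. wave v 1 0 s x - wave v 1 0 t x)"
        by (rule mono[OF K(3)[OF s]]) simp
      show "envelope_bounded (max K1 K2 * \<bar>s - t\<bar>) (\<lambda>x. wave v ?c (-1) s x - wave v ?c (-1) t x)"
        by (rule mono[OF K(4)[OF s]]) simp
    qed
  qed
  have C1: "has_C1_deriv_Hm1 N \<alpha> (?S) (\<lambda>t. L2_inner N (?L (wave v ?a ?b t)))"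
    unfolding travelling_soliton_def[abs_def]
  proof (rule has_C1_deriv_star_lift[OF C C])
    fix t
    obtain K where K: "K \<ge> 0" "\<And>s x. \<bar>s - t\<bar> \<le> 1 \<Longrightarrow> cmod (wave v ?a ?b s x - wave v ?a ?b t x) \<le> K * \<bar>s - t\<bar> * envelope x"
      using wave_Lipschitz[of t v ?a ?b] by blast
    have L: "cmod (wave v 1 0 s x - wave v 1 0 t x - complex_of_real (s - t) * wave v ?a ?b t x) \<le> K * \<bar>s - t\<bar>\<^sup>2 * envelope x"
      if s: "\<bar>s - t\<bar> \<le> 1" for s x
    proof -
      have "cmod (wave v 1 0 s x - wave v 1 0 t x - complex_of_real (s - t) * wave_t v 1 0 t x) \<le> \<bar>s - t\<bar> * (K * \<bar>s - t\<bar> * envelope x)"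
      proof (rule wave_linearization)
        fix r assume r: "r \<in> closed_segment t s"
        note d = segment_dist[OF r]
        have "cmod (wave_t v 1 0 r x - wave_t v 1 0 t x) \<le> K * \<bar>r - t\<bar> * envelope x"
          unfolding wave_t_phase using d s by (intro K(2)) linarith
        also have "\<dots> \<le> K * \<bar>s - t\<bar> * envelope x"
          using d K(1) envelope_pos[of x] by (intro mult_right_mono mult_left_mono) auto
        finally show "cmod (wave_t v 1 0 r x - wave_t v 1 0 t x) \<le> K * \<bar>s - t\<bar> * envelope x" .
      qed
      then show ?thesis by (simp add: wave_t_phase power2_eq_square mult_ac)
    qed
    show "\<exists>K\<ge>0. \<forall>s. \<bar>s - t\<bar> \<le> 1 \<longrightarrow> envelope_bounded (K * \<bar>s - t\<bar>) (\<lambda>x. wave v ?a ?b s x - wave v ?a ?b t x) \<and>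
        envelope_bounded (K * \<bar>s - t\<bar>\<^sup>2) (\<lambda>x. wave v 1 0 s x - wave v 1 0 t x - complex_of_real (s - t) * wave v ?a ?b t x)"
      unfolding envelope_bounded_def
      by (intro exI[of _ K] conjI allI impI K L continuous_on_diff continuous_on_mult continuous_on_const wave_continuous)
  qed
  have lap: "ext_laplacian N \<alpha> (?S t) (L2_inner N (?L (wave_x v ?c (-1) t)))" for t
    unfolding travelling_soliton_def by (rule star_lift_ext_laplacian[OF C C C' dx wave_x bal])
  have eq: "\<i> * L2_inner N (?L (wave v ?a ?b t)) W = - L2_inner N (?L (wave_x v ?c (-1) t)) W
      - 2 * L2_inner N (cubic \<alpha> (?S t)) W" if W: "W \<in> H1_Gamma N \<alpha>" for t W
  proof -
    have SH: "?S t \<in> H1_Gamma N \<alpha>" using cont by (simp add: continuous_H1_def)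
    let ?A = "?L (wave v ?a ?b t)" and ?B = "?L (wave_x v ?c (-1) t)" and ?K = "cubic \<alpha> (?S t)"
    have L: "?A \<in> L2_star N" "?B \<in> L2_star N" "?K \<in> L2_star N" "W \<in> L2_star N"
      by (rule star_lift_L2[OF C] star_lift_L2[OF C'] cubic_L2_star[OF SH] H1_Gamma_L2_star[OF W])+
    have pt: "\<i> * ?A j x = - ?B j x - 2 * ?K j x" for j x
    proof (cases "j \<in> {1..N} \<and> x \<in> edge j")
      case True
      then have j: "j \<in> {1..N}" and x: "x \<in> edge j" by auto
      have a: "complex_of_real (\<alpha> j) \<noteq> 0" using balanced_star_nonzero[OF bal j] by simp
      have "?K j x = complex_of_real ((cmod (wave v 1 0 t x))\<^sup>2) * wave v 1 0 t x / complex_of_real (\<alpha> j)"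
      proof -
        \<comment> \<open>The weight in the cubic term compensates exactly the factor
          \<open>1 / \<alpha> j\<close> inside the modulus, so every edge carries the same
          equation.\<close>
        have "(\<alpha> j)\<^sup>2 * (cmod (wave v 1 0 t x / complex_of_real (\<alpha> j)))\<^sup>2 = (cmod (wave v 1 0 t x))\<^sup>2"
          using balanced_star_nonzero[OF bal j] by (simp add: norm_divide power_divide)
        then show ?thesis
          unfolding cubic_def travelling_soliton_def star_lift_edge[OF j x] by (simp only: times_divide_eq_right)
      qed
      then have "\<i> * ?A j x + ?B j x + 2 * ?K j x = (\<i> * wave_t v 1 0 t x + wave_x v ?c (-1) t x + 2 * (complex_of_real ((cmod (wave v 1 0 t x))\<^sup>2) * wave v 1 0 t x)) / complex_of_real (\<alpha> j)"
        by (simp add: star_lift_edge[OF j x] wave_t_phase add_divide_distrib)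
      also have "\<dots> = 0" unfolding wave_nls by simp
      finally show ?thesis by (simp add: algebra_simps eq_neg_iff_add_eq_0)
    next
      case False
      then show ?thesis by (auto simp: star_lift_def cubic_def travelling_soliton_def)
    qed
    have "\<i> * L2_inner N ?A W = L2_inner N (\<lambda>j x. \<i> * ?A j x + 0 * ?A j x) W"
      by (subst L2_inner_lincomb_left[OF L(1,1,4)]) simp
    also have "(\<lambda>j x. \<i> * ?A j x + 0 * ?A j x) = (\<lambda>j x. (-1) * ?B j x + (-2) * ?K j x)"
      unfolding pt by simp
    also have "L2_inner N \<dots> W = - L2_inner N ?B W - 2 * L2_inner N ?K W"
      by (subst L2_inner_lincomb_left[OF L(2,3,4)]) simp
    finally show ?thesis .
  qed
  show ?thesis
    unfolding nls_solution_def
    by (intro conjI refl cont exI[of _ "\<lambda>t. L2_inner N (?L (wave v ?a ?b t))"]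
        exI[of _ "\<lambda>t. L2_inner N (?L (wave_x v ?c (-1) t))"] C1 allI lap ballI eq)
qed

section \<open>Instability\<close>

lemma half_soliton_eq: "half_soliton N \<alpha> = travelling_soliton N \<alpha> 0 0"
  by (auto simp: half_soliton_def travelling_soliton_def star_lift_def wave_def pulse_def fun_eq_iff field_simps)

text \<open>Half of the exponential decay absorbs the factor \<open>\<bar>x\<bar>\<close>, the other
  half is the envelope. The 4 is 2 from
  \<open>\<bar>x\<bar> / 2 \<le> exp (\<bar>x\<bar> / 2)\<close> times 2 from
  \<open>cosh\<close>.\<close>

lemma abs_mult_sech_le: "\<bar>x\<bar> * (1 / cosh x) \<le> 4 * envelope x"
proof -
  have "\<bar>x\<bar> / 2 \<le> exp (\<bar>x\<bar> / 2)" using exp_ge_add_one_self[of "\<bar>x\<bar> / 2"] by linarith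
  then have "\<bar>x\<bar> / 2 * (exp (- \<bar>x\<bar> / 2) * exp (- \<bar>x\<bar> / 2)) \<le> exp (\<bar>x\<bar> / 2) * (exp (- \<bar>x\<bar> / 2) * exp (- \<bar>x\<bar> / 2))"
    by (intro mult_right_mono) auto
  also have "\<dots> = envelope x" unfolding envelope_def exp_add[symmetric] by simp
  finally have 1: "\<bar>x\<bar> * exp (- \<bar>x\<bar>) \<le> 2 * envelope x" unfolding exp_add[symmetric] by simp
  have "exp \<bar>x\<bar> \<le> 2 * cosh x" by (simp add: cosh_def abs_if)
  then have "1 / cosh x \<le> 2 * exp (- \<bar>x\<bar>)" by (simp add: exp_minus field_simps)
  then have "\<bar>x\<bar> * (1 / cosh x) \<le> \<bar>x\<bar> * (2 * exp (- \<bar>x\<bar>))" by (intro mult_left_mono) auto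
  then show ?thesis using 1 by simp
qed

lemma cmod_exp_i_minus_1: "cmod (exp (\<i> * complex_of_real t) - 1) \<le> \<bar>t\<bar>"
  using abs_sin_x_le_abs_x[of "t / 2"] by (simp add: dist_exp_i_1)

text \<open>At time 0 the two profiles differ only by the phase \<open>exp (\<i> * v * x)\<close>,
  whose distance from 1 is at most \<open>\<bar>v\<bar> * \<bar>x\<bar>\<close>. The 6 is 4 for this
  term plus 2 for the derivative of the phase.\<close>

lemma boosted_soliton_difference:
  fixes v :: real
  defines "f \<equiv> \<lambda>x. wave v 1 0 0 x - wave 0 1 0 0 x"
    and "f' \<equiv> \<lambda>x. wave v (\<i> * complex_of_real v) (- 1) 0 x - wave 0 0 (- 1) 0 x"
  shows "(f has_vector_derivative f' x) (at x)" "envelope_bounded (6 * \<bar>v\<bar>) f" "envelope_bounded (6 * \<bar>v\<bar>) f'"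
proof -
  show "(f has_vector_derivative f' x) (at x)"
    unfolding f_def f'_def using has_vector_derivative_diff[OF wave_x[of v 1 0 0 x] wave_x[of 0 1 0 0 x]]
    by (simp add: wave_x_phase)
  define e where "e x = exp (\<i> * complex_of_real (v * x))" for x
  have e1: "cmod (e x) = 1" for x by (simp add: e_def)
  have e2: "cmod (e x - 1) \<le> \<bar>v\<bar> * \<bar>x\<bar>" for x
    using cmod_exp_i_minus_1[of "v * x"] by (simp add: e_def abs_mult)
  have S: "1 / cosh x \<le> 2 * envelope x" for x using sech_le_envelope[of x 0] by simp
  have S0: "0 \<le> 1 / cosh x" for x :: real using cosh_real_pos[of x] by simp
  have small: "cmod (e x - 1) * (1 / cosh x) \<le> \<bar>v\<bar> * (4 * envelope x)" for x
  proof -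
    have "cmod (e x - 1) * (1 / cosh x) \<le> \<bar>v\<bar> * \<bar>x\<bar> * (1 / cosh x)" by (intro mult_right_mono e2 S0)
    also have "\<dots> = \<bar>v\<bar> * (\<bar>x\<bar> * (1 / cosh x))" by simp
    also have "\<dots> \<le> \<bar>v\<bar> * (4 * envelope x)" by (intro mult_left_mono abs_mult_sech_le) simp
    finally show ?thesis .
  qed
  have f_eq: "f x = (e x - 1) * complex_of_real (1 / cosh x)" for x
    by (simp add: f_def wave_def pulse_def e_def algebra_simps diff_divide_distrib)
  have "cmod (f x) \<le> 6 * \<bar>v\<bar> * envelope x" for x
  proof -
    have "cmod (f x) = cmod (e x - 1) * (1 / cosh x)" unfolding f_eq norm_mult norm_of_real using S0[of x] by (simp only: abs_of_nonneg)
    also have "\<dots> \<le> \<bar>v\<bar> * (4 * envelope x)" by (rule small)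
    also have "\<dots> \<le> 6 * \<bar>v\<bar> * envelope x" using envelope_pos[of x] by simp
    finally show ?thesis .
  qed
  then show "envelope_bounded (6 * \<bar>v\<bar>) f"
    unfolding envelope_bounded_def f_def by (auto intro!: continuous_on_diff wave_continuous)
  have f'_eq: "f' x = \<i> * complex_of_real v * e x * complex_of_real (1 / cosh x) - (e x - 1) * complex_of_real (1 / cosh x) * complex_of_real (tanh x)" for x
    by (simp add: f'_def wave_def pulse_def e_def algebra_simps add_divide_distrib diff_divide_distrib)
  have "cmod (f' x) \<le> 6 * \<bar>v\<bar> * envelope x" for x
  proof -
    have "cmod (f' x) \<le> \<bar>v\<bar> * (1 / cosh x) + cmod (e x - 1) * (1 / cosh x) * \<bar>tanh x\<bar>"
      unfolding f'_eq by (rule order_trans[OF norm_triangle_ineq4]) (use S0[of x] in \<open>simp only: norm_mult norm_of_real norm_ii e1 abs_of_nonneg mult_1_left mult_1_right order_refl\<close>)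
    also have "\<dots> \<le> \<bar>v\<bar> * (2 * envelope x) + \<bar>v\<bar> * (4 * envelope x) * 1"
      by (intro add_mono mult_left_mono[OF S] mult_mono[OF small abs_tanh_le_1]) (auto simp: less_imp_le[OF envelope_pos])
    also have "\<dots> = 6 * \<bar>v\<bar> * envelope x" by simp
    finally show ?thesis .
  qed
  then show "envelope_bounded (6 * \<bar>v\<bar>) f'"
    unfolding envelope_bounded_def f'_def by (auto intro!: continuous_on_diff wave_continuous)
qed

lemma small_boost:
  assumes bal: "balanced_star N \<alpha>" and v: "0 < v"
  defines "V \<equiv> \<lambda>j x. travelling_soliton N \<alpha> v 0 j x - half_soliton N \<alpha> j x"
  shows "V \<in> H1_Gamma N \<alpha>" "H1_norm N V \<le> 6 * v * sqrt (2 * lift_const N \<alpha>)"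
proof -
  have V: "V = star_lift N \<alpha> (\<lambda>x. wave v 1 0 0 x - wave 0 1 0 0 x)"
    unfolding V_def half_soliton_eq travelling_soliton_def by (rule star_lift_diff)
  note b = boosted_soliton_difference(2,3,1)[of v]
  show "V \<in> H1_Gamma N \<alpha>" unfolding V by (rule star_lift_H1(1)[OF b bal])
  show "H1_norm N V \<le> 6 * v * sqrt (2 * lift_const N \<alpha>)"
    unfolding V using star_lift_H1_norm_le[OF b bal] v by simp
qed

text \<open>At time \<open>1 / (2 * v)\<close> the soliton has moved by the distance \<open>1\<close>, whatever the speed, and on
  the incoming edge its modulus can no longer match that of the half-soliton.\<close>

lemma shifted_soliton_far:
  assumes bal: "balanced_star N \<alpha>"
  shows "\<exists>\<epsilon>>0. \<forall>v>0. orbit_dist N (half_soliton N \<alpha>) (travelling_soliton N \<alpha> v (1 / (2 * v))) > \<epsilon>"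
proof -
  have one: "1 \<in> {1..N}" by (rule balanced_star_one[OF bal])
  have \<alpha>1: "\<alpha> 1 > 0" using bal one by (simp add: balanced_star_def)
  \<comment> \<open>The gap between the moduli. It is positive on \<open>{-1..0}\<close>, where
    \<open>x - 1\<close> is farther from 0 than \<open>x\<close>, and compactness bounds it below by
    \<open>m\<close>.\<close>
  define g where "g x = 1 / cosh x - 1 / cosh (x - 1)" for x :: real
  have c: "cosh (y::real) \<noteq> 0" for y using cosh_real_pos[of y] by linarith
  have "continuous_on {-1..0} g" unfolding g_def by (intro continuous_intros) (auto simp: c)
  then obtain x0 where x0: "x0 \<in> {-1..0}" "\<And>x. x \<in> {-1..0} \<Longrightarrow> g x0 \<le> g x"
    using continuous_attains_inf[of "{-1..0::real}" g] by auto
  define m where "m = g x0"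
  have m: "m > 0"
  proof -
    have "cosh x0 < cosh (x0 - 1)" using x0(1) by (subst cosh_real_nonpos_less_iff) auto
    then have "1 / cosh (x0 - 1) < 1 / cosh x0" by (intro divide_strict_left_mono) auto
    then show ?thesis by (simp add: m_def g_def)
  qed
  have far: "m / \<alpha> 1 \<le> H1_norm N (\<lambda>j x. exp (- \<i> * complex_of_real \<theta>) * travelling_soliton N \<alpha> v (1 / (2 * v)) j x - half_soliton N \<alpha> j x)"
    if v: "v > 0" for v \<theta>
  proof -
    let ?e = "exp (- \<i> * complex_of_real \<theta>)"
    define D where "D = (\<lambda>j x. ?e * travelling_soliton N \<alpha> v (1 / (2 * v)) j x + (-1) * half_soliton N \<alpha> j x)"
    have S: "travelling_soliton N \<alpha> v t \<in> H1_Gamma N \<alpha>" for v t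
      using travelling_soliton_solution[OF bal, of v] by (simp add: nls_solution_def continuous_H1_def)
    have DH: "D \<in> H1_Gamma N \<alpha>" unfolding D_def half_soliton_eq by (rule H1_Gamma_lincomb[OF S S])
    have pt: "(m / \<alpha> 1)\<^sup>2 \<le> (cmod (D 1 x))\<^sup>2" if x: "x \<in> {-1..0}" for x
    proof -
      have xe: "x \<in> edge 1" using x by (simp add: edge_def)
      let ?w = "wave v 1 0 (1 / (2 * v)) x" and ?h = "wave 0 1 0 0 x"
      have cw: "cmod ?w = 1 / cosh (x - 1)" "cmod ?h = 1 / cosh x" using v by (simp_all add: cmod_wave)
      \<comment> \<open>The reverse triangle inequality compares moduli only, which makes the
        estimate uniform in the phase \<theta>.\<close>
      have "m \<le> cmod ?h - cmod (?e * ?w)" using x0(2)[OF x] by (simp add: m_def g_def cw norm_mult)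
      also have "\<dots> \<le> cmod (?h - ?e * ?w)" by (rule norm_triangle_ineq2)
      also have "\<dots> = cmod (?e * ?w - ?h)" by (rule norm_minus_commute)
      finally have "m / \<alpha> 1 \<le> cmod (?e * ?w - ?h) / \<alpha> 1" using \<alpha>1 by (simp add: divide_right_mono)
      also have "\<dots> = cmod (D 1 x)"
      proof -
        have "D 1 x = (?e * ?w - ?h) / complex_of_real (\<alpha> 1)"
          unfolding D_def half_soliton_eq travelling_soliton_def star_lift_edge[OF one xe] by (simp add: diff_divide_distrib)
        then show ?thesis using \<alpha>1 by (simp add: norm_divide)
      qed
      finally show ?thesis using m \<alpha>1 by (intro power_mono) auto
    qed
    have D2: "set_integrable lebesgue (edge 1) (\<lambda>x. (cmod (D 1 x))\<^sup>2)"
      using L2_onD(2)[OF H1_GammaD(3)[OF DH one]] .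
    have sub: "{-1..0} \<subseteq> edge 1" by (auto simp: edge_def)
    have "(m / \<alpha> 1)\<^sup>2 = (LINT x:{-1..0::real}|lebesgue. (m / \<alpha> 1)\<^sup>2)"
      by (rule sym) (use unit_interval_integral_const[of "-1" "(m / \<alpha> 1)\<^sup>2"] in simp)
    also have "\<dots> \<le> (LINT x:{-1..0}|lebesgue. (cmod (D 1 x))\<^sup>2)"
      by (intro set_integral_mono pt set_integrable_subset[OF D2 _ sub] absolutely_integrable_continuous_real continuous_on_const) auto
    also have "\<dots> \<le> edge_sq 1 (D 1)"
      unfolding edge_sq_def by (rule set_integral_subset_mono[OF D2 _ sub]) auto
    also have "\<dots> \<le> L2_sq N D"
      unfolding L2_sq_def using one by (intro member_le_sum[where f="\<lambda>j. edge_sq j (D j)"]) (auto simp: edge_sq_nonneg)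
    also have "\<dots> \<le> (H1_norm N D)\<^sup>2" by (rule L2_sq_le_H1)
    finally have "m / \<alpha> 1 \<le> H1_norm N D" by (rule power2_le_imp_le) (rule H1_norm_nonneg)
    then show ?thesis by (simp add: D_def)
  qed
  have "m / (2 * \<alpha> 1) < orbit_dist N (half_soliton N \<alpha>) (travelling_soliton N \<alpha> v (1 / (2 * v)))" if "v > 0" for v
  proof -
    \<comment> \<open>The infimum over phases preserves only the weak inequality; halving the bound
      restores a strict one.\<close>
    have "m / (2 * \<alpha> 1) < m / \<alpha> 1" using m \<alpha>1 by (simp add: field_simps)
    also have "\<dots> \<le> orbit_dist N (half_soliton N \<alpha>) (travelling_soliton N \<alpha> v (1 / (2 * v)))"
      unfolding orbit_dist_def by (rule cINF_greatest) (use far[OF that] in auto)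
    finally show ?thesis .
  qed
  then show ?thesis using m \<alpha>1 by (intro exI[of _ "m / (2 * \<alpha> 1)"]) auto
qed

theorem theorem2p6:
  fixes N :: nat and \<alpha> :: "nat \<Rightarrow> real"
  assumes "balanced_star N \<alpha>"
  shows "(\<exists>\<epsilon>>0. \<exists>\<delta>\<^sub>0>0. \<forall>\<delta>. 0 < \<delta> \<and> \<delta> < \<delta>\<^sub>0 \<longrightarrow>
           (\<exists>V\<in>H1_Gamma N \<alpha>. H1_norm N V \<le> \<delta> \<and>
              (\<exists>!\<Psi>. nls_solution N \<alpha> (\<lambda>j x. half_soliton N \<alpha> j x + V j x) \<Psi>) \<and>
              (\<forall>\<Psi>. nls_solution N \<alpha> (\<lambda>j x. half_soliton N \<alpha> j x + V j x) \<Psi> \<longrightarrow>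
                 (\<exists>T>0. orbit_dist N (half_soliton N \<alpha>) (\<Psi> T) > \<epsilon>)))) \<and>
         \<not> orbitally_stable N \<alpha> (half_soliton N \<alpha>)"
proof -
  let ?h = "half_soliton N \<alpha>"
  let ?s = "travelling_soliton N \<alpha>"
  note bal = assms
  obtain \<epsilon> where \<epsilon>: "\<epsilon> > 0" "\<And>v. v > 0 \<Longrightarrow> orbit_dist N ?h (?s v (1 / (2 * v))) > \<epsilon>"
    using shifted_soliton_far[OF bal] by blast
  have main: "\<exists>v>0. H1_norm N (\<lambda>j x. ?s v 0 j x - ?h j x) \<le> \<delta>" if "\<delta> > 0" for \<delta>
  proof -
    \<comment> \<open>The size of the perturbation is linear in the speed, so
      \<open>\<delta> / B\<close> is slow enough; the added 1 keeps \<open>B\<close>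
      positive.\<close>
    define B where "B = 6 * sqrt (2 * lift_const N \<alpha>) + 1"
    have B: "B > 0" unfolding B_def using lift_const_nonneg[of N \<alpha>] by (intro add_nonneg_pos) auto
    have v: "\<delta> / B > 0" using B that by simp
    have "H1_norm N (\<lambda>j x. ?s (\<delta> / B) 0 j x - ?h j x) \<le> 6 * (\<delta> / B) * sqrt (2 * lift_const N \<alpha>)"
      by (rule small_boost(2)[OF bal v])
    also have "\<dots> = \<delta> / B * (6 * sqrt (2 * lift_const N \<alpha>))" by simp
    also have "\<dots> \<le> \<delta> / B * B" by (rule mult_left_mono) (use v in \<open>auto simp: B_def\<close>)
    also have "\<dots> = \<delta>" using B by simp
    finally show ?thesis using v by blast
  qed
  have init: "(\<lambda>j x. ?h j x + (?s v 0 j x - ?h j x)) = ?s v 0" for v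
    by simp
  note sol = travelling_soliton_solution[OF bal]
  have first: "\<exists>V\<in>H1_Gamma N \<alpha>. H1_norm N V \<le> \<delta> \<and>
              (\<exists>!\<Psi>. nls_solution N \<alpha> (\<lambda>j x. ?h j x + V j x) \<Psi>) \<and>
              (\<forall>\<Psi>. nls_solution N \<alpha> (\<lambda>j x. ?h j x + V j x) \<Psi> \<longrightarrow>
                 (\<exists>T>0. orbit_dist N ?h (\<Psi> T) > \<epsilon>))" if "\<delta> > 0" for \<delta>
  proof -
    obtain v where v: "v > 0" "H1_norm N (\<lambda>j x. ?s v 0 j x - ?h j x) \<le> \<delta>"
      using main[OF \<open>\<delta> > 0\<close>] by blast
    \<comment> \<open>Uniqueness transfers the escape of the explicit soliton to every solution with
      these data.\<close>
    have uniq: "\<Psi> = ?s v" if "nls_solution N \<alpha> (?s v 0) \<Psi>" for \<Psi>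
      by (rule nls_solution_unique[OF bal that sol])
    show ?thesis
    proof (intro bexI[of _ "\<lambda>j x. ?s v 0 j x - ?h j x"] conjI v(2) small_boost(1)[OF bal v(1)], unfold init)
      show "\<exists>!\<Psi>. nls_solution N \<alpha> (?s v 0) \<Psi>" using sol uniq by (rule ex1I)
      show "\<forall>\<Psi>. nls_solution N \<alpha> (?s v 0) \<Psi> \<longrightarrow> (\<exists>T>0. orbit_dist N ?h (\<Psi> T) > \<epsilon>)"
      proof (intro allI impI exI[of _ "1 / (2 * v)"] conjI)
        fix \<Psi> assume s: "nls_solution N \<alpha> (?s v 0) \<Psi>"
        show "orbit_dist N ?h (\<Psi> (1 / (2 * v))) > \<epsilon>"
          unfolding uniq[OF s] by (rule \<epsilon>(2)[OF v(1)])
      qed (use v(1) in simp)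
    qed
  qed
  moreover have "\<not> orbitally_stable N \<alpha> ?h"
  proof
    assume "orbitally_stable N \<alpha> ?h"
    then obtain \<delta> where \<delta>: "\<delta> > 0" "\<And>\<Psi>0 \<Psi> t. \<Psi>0 \<in> H1_Gamma N \<alpha> \<Longrightarrow> H1_norm N (\<lambda>j x. \<Psi>0 j x - ?h j x) \<le> \<delta> \<Longrightarrow>
        nls_solution N \<alpha> \<Psi>0 \<Psi> \<Longrightarrow> t > 0 \<Longrightarrow> orbit_dist N ?h (\<Psi> t) \<le> \<epsilon>"
      using \<epsilon>(1) unfolding orbitally_stable_def by meson
    obtain v where v: "v > 0" "H1_norm N (\<lambda>j x. ?s v 0 j x - ?h j x) \<le> \<delta>"
      using main[OF \<delta>(1)] by blast
    have "?s v 0 \<in> H1_Gamma N \<alpha>" using sol[of v] by (simp add: nls_solution_def continuous_H1_def)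
    from \<delta>(2)[OF this v(2) sol, of "1 / (2 * v)"] \<epsilon>(2)[OF v(1)] v(1) show False by simp
  qed
  \<comment> \<open>The construction works for every positive \<open>\<delta>\<close>, so the
    threshold 1 is an arbitrary choice.\<close>
  ultimately show ?thesis using \<epsilon>(1) by (intro conjI exI[of _ \<epsilon>] exI[of _ 1]) auto
qed

end
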